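(* Let $\Psi_{G_{sar}}(x,y)$ be the number of isomorphism classes of finite semisimple associative rings $R$ with $\#R\le x$ such that every simple ring occurring in the decomposition of $R$ as a direct sum of simple rings $M_n(\mathbb{F}_q)$ has cardinality at most $y$. Put \[ \alpha_1=\prod_{\substack{r,m\ge1\\ rm^2>1}}\zeta(rm^2). \] Then for every fixed $U>0$, as $x\to\infty$, \[ \Psi_{G_{sar}}(x,y)=(1+o(1))\,\alpha_1\,x\,\rho(u),\qquad u=\frac{\log x}{\log y}, \] uniformly for $y\ge2$ and $0<u\le U$.
   Context: $\zeta$ is the Riemann zeta function; the product defining $\alpha_1$ is over pairs of positive integers $(r,m)$. Here $G_{sar}$ is the set of isomorphism classes of finite semisimple associative rings under direct sum, with norm $|R|=\#R$ and primes the classes of the matrix rings $M_n(\mathbb{F}_q)$ with $n\ge1$, $q=p^r$, $p$ prime, $r\ge1$, so $|M_n(\mathbb{F}_q)|=p^{rn^2}$. By the Wedderburn-Artin theorem every such ring is a direct sum of these, uniquely up to ordering and isomorphism; the zero ring is the identity of $G_{sar}$ and is counted by $\Psi_{G_{sar}}(x,y)$. Dickman function: $\rho:[0,\infty)\to\mathbb{R}$ is the unique continuous function, differentiable on $(1,\infty)$, with $\rho(u)=1$ for $0\le u\le1$ and $u\rho'(u)+\rho(u-1)=0$ for $u>1$. *)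

theory Defs
  imports Complex_Main "HOL-Algebra.Chinese_Remainder"
begin

section \<open>Finite semisimple rings\<close>

definition left_ideal :: "'a set \<Rightarrow> ('a, 'b) ring_scheme \<Rightarrow> bool" where
  "left_ideal L R \<longleftrightarrow>
     additive_subgroup L R \<and> (\<forall>r\<in>carrier R. \<forall>a\<in>L. r \<otimes>\<^bsub>R\<^esub> a \<in> L)"

text \<open>A ring is semisimple if it is so as a left module over itself, that is, if every left ideal
  has a complement. The zero ring is semisimple.\<close>

definition semisimple_ring :: "('a, 'b) ring_scheme \<Rightarrow> bool" where
  "semisimple_ring R \<longleftrightarrow> ring R \<and>
     (\<forall>L. left_ideal L R \<longrightarrow>
        (\<exists>L'. left_ideal L' R \<and> L <+>\<^bsub>R\<^esub> L' = carrier R \<and> L \<inter> L' = {\<zero>\<^bsub>R\<^esub>}))"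

definition mat_ring :: "('a, 'b) ring_scheme \<Rightarrow> nat \<Rightarrow> (nat \<times> nat \<Rightarrow> 'a) ring" where
  "mat_ring F n =
     \<lparr> carrier = ({..<n} \<times> {..<n}) \<rightarrow>\<^sub>E carrier F,
       mult = (\<lambda>A B. \<lambda>(i, j)\<in>{..<n} \<times> {..<n}. \<Oplus>\<^bsub>F\<^esub>k\<in>{..<n}. A (i, k) \<otimes>\<^bsub>F\<^esub> B (k, j)),
       one = (\<lambda>(i, j)\<in>{..<n} \<times> {..<n}. if i = j then \<one>\<^bsub>F\<^esub> else \<zero>\<^bsub>F\<^esub>),
       zero = (\<lambda>(i, j)\<in>{..<n} \<times> {..<n}. \<zero>\<^bsub>F\<^esub>),
       add = (\<lambda>A B. \<lambda>(i, j)\<in>{..<n} \<times> {..<n}. A (i, j) \<oplus>\<^bsub>F\<^esub> B (i, j)) \<rparr>"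

text \<open>The list \<open>Ds\<close> of pairs \<open>(F, n)\<close> describes a decomposition of \<open>R\<close> as a direct sum of
  matrix rings \<open>M\<^sub>n(F)\<close> over finite fields. The empty list is the decomposition of the zero ring.
  Carriers of finite fields are taken in \<^typ>\<open>nat\<close>, which is no restriction up to isomorphism.\<close>

definition wedderburn_decomposition ::
    "('a, 'b) ring_scheme \<Rightarrow> (nat ring \<times> nat) list \<Rightarrow> bool" where
  "wedderburn_decomposition R Ds \<longleftrightarrow>
     (\<forall>(F, n)\<in>set Ds. field F \<and> finite (carrier F) \<and> n \<ge> 1) \<and>
     R \<simeq> RDirProd_list (map (\<lambda>(F, n). mat_ring F n) Ds)"

text \<open>Isomorphism classes are formed among the rings whose carrier is a set of natural numbers;
  every finite ring is isomorphic to one of these. The Wedderburn decomposition being unique up to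
  order and isomorphism, it does not matter which one bounds the simple components.\<close>

definition smooth_rings :: "real \<Rightarrow> real \<Rightarrow> nat ring set" where
  "smooth_rings x y =
     {R. semisimple_ring R \<and> finite (carrier R) \<and> real (card (carrier R)) \<le> x \<and>
         (\<exists>Ds. wedderburn_decomposition R Ds \<and>
               (\<forall>(F, n)\<in>set Ds. real (card (carrier (mat_ring F n))) \<le> y))}"

definition Psi_sar :: "real \<Rightarrow> real \<Rightarrow> nat" where
  "Psi_sar x y =
     card (smooth_rings x y // {(R, S). R \<in> smooth_rings x y \<and> S \<in> smooth_rings x y \<and> R \<simeq> S})"

section \<open>The constant and the Dickman function\<close>

text \<open>The Riemann zeta function, only used at arguments greater than \<open>1\<close>.\<close>

definition zeta :: "real \<Rightarrow> real" where
  "zeta s = (\<Sum>k. 1 / real (Suc k) powr s)"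

text \<open>The unordered infinite product, that is, the limit of the finite subproducts.\<close>

definition alpha1 :: real where
  "alpha1 = Lim (finite_subsets_at_top {(r, m). r \<ge> 1 \<and> m \<ge> 1 \<and> r * m\<^sup>2 > 1})
              (\<lambda>A. \<Prod>(r, m)\<in>A. zeta (real (r * m\<^sup>2)))"

text \<open>The value \<open>0\<close> on negative arguments only serves to make the function unique on the
  whole type.\<close>

definition dickman_rho :: "real \<Rightarrow> real" where
  "dickman_rho = (THE f.
     (\<forall>u<0. f u = 0) \<and>
     continuous_on {0..} f \<and>
     (\<forall>u\<in>{0..1}. f u = 1) \<and>
     (\<forall>u>1. \<exists>D. (f has_real_derivative D) (at u) \<and> u * D + f (u - 1) = 0))"

end

theory Submission
  imports Defs "HOL-Algebra.Algebraic_Closure" "HOL-Algebra.Multiplicative_Group" "HOL-Algebra.Sylow"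
    "HOL-Number_Theory.Residues" "HOL-Computational_Algebra.Polynomial" "HOL-Analysis.Analysis"
    "HOL-Real_Asymp.Real_Asymp"
begin

text \<open>
  By Wedderburn--Artin the isomorphism classes correspond to finite multisets of pairs \<open>(q, n)\<close> with
  \<open>q\<close> a prime power. The part of such a multiset that consists of the prime fields \<open>(p, 1)\<close> is an
  integer \<open>k\<close>, so that \<open>\<Psi>(x, y)\<close> is the sum, over the \<open>y\<close>-smooth multisets \<open>N\<close> without prime
  fields, of the number of \<open>y\<close>-smooth integers \<open>k \<le> x / |N|\<close>. The sum of \<open>1 / |N|\<close> over all \<open>N\<close> is
  the Euler product \<open>\<alpha>\<^sub>1\<close>, which converges absolutely. A finite set of multisets \<open>N\<close> therefore carries
  the sum up to \<open>\<epsilon> x\<close>, and for these \<open>log |N| / log y\<close> tends to \<open>0\<close>; so the result follows from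
  Dickman's theorem for smooth integers and the Lipschitz continuity of \<open>\<rho>\<close>.

  Dickman's theorem is proved by induction on \<open>\<lfloor>u\<rfloor>\<close> from Buchstab's identity and Mertens' second
  theorem. The interval between two consecutive integers is cut into short pieces, on each of which
  \<open>\<rho>\<close> is almost constant, so that no partial summation is required.
\<close>

section \<open>Finite fields\<close>

text \<open>Every ring in \<open>smooth_rings\<close> comes with a decomposition, so the passage to
  multisets rests on three facts: finite fields of prime power order exist and are unique; the
  multiset of pairs is an isomorphism invariant; products of matrix rings over finite fields are
  semisimple. Fields are compared through polynomials with integer coefficients, since
  \<open>int_eval\<close> sends the same polynomial into both. The analytic obstacle is uniformity.
  From u \<le> U follows y \<ge> x^(1/U), so y tends to infinity with x, and Dickman's theorem may
  be stated with a threshold on y alone, for every x \<ge> 1. Arguments x / p close to 1 do occur in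
  the Buchstab recursion, and there an error \<epsilon> x cannot hold, as counting integers costs a
  rounding error. The error is therefore carried as \<epsilon> x + 1; the summands 1 add up to a
  number of primes, which is o(x). An absolute error \<epsilon> x suffices in the end because \<rho>
  is positive and nonincreasing, hence at least \<rho>(U) on the whole range.\<close>

definition int_eval :: "('a, 'b) ring_scheme \<Rightarrow> 'a \<Rightarrow> int poly \<Rightarrow> 'a" where
  "int_eval R a f = fold_coeffs (\<lambda>c v. add_pow R c \<one>\<^bsub>R\<^esub> \<oplus>\<^bsub>R\<^esub> a \<otimes>\<^bsub>R\<^esub> v) f \<zero>\<^bsub>R\<^esub>"

context cring
begin

lemma int_eval_0 [simp]: "int_eval R a 0 = \<zero>"
  by (simp add: int_eval_def)

lemma add_pow_int_0 [simp]: "add_pow R (0::int) x = \<zero>"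
  by (simp add: add_pow_def int_pow_def)

lemma int_eval_pCons [simp]:
  assumes "a \<in> carrier R"
  shows "int_eval R a (pCons c f) = add_pow R c \<one> \<oplus> a \<otimes> int_eval R a f"
proof (cases "f = 0 \<and> c = 0")
  case True
  then show ?thesis using assms by (simp add: int_eval_def)
next
  case False
  then show ?thesis by (auto simp add: int_eval_def)
qed

lemma int_eval_closed [simp, intro]:
  "a \<in> carrier R \<Longrightarrow> int_eval R a f \<in> carrier R"
  by (induction f) auto

lemma add_pow_int_add:
  "x \<in> carrier R \<Longrightarrow> add_pow R (c + d :: int) x = add_pow R c x \<oplus> add_pow R d x"
  using add.int_pow_mult[of x c d] by (simp add: add_pow_def)

lemma add_pow_int_one_mult:
  "add_pow R (c * d :: int) \<one> = add_pow R c \<one> \<otimes> add_pow R d \<one>"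
proof -
  have "add_pow R c \<one> \<otimes> add_pow R d \<one> = add_pow R c (\<one> \<otimes> add_pow R d \<one>)"
    by (rule add_pow_ldistr_int) auto
  also have "\<one> \<otimes> add_pow R d \<one> = add_pow R d \<one>" by simp
  also have "add_pow R c (add_pow R d \<one>) = add_pow R (d * c) \<one>"
    using add.int_pow_pow[of \<one> c d] by (simp add: add_pow_def)
  finally show ?thesis by (simp add: mult.commute)
qed

lemma int_eval_add:
  assumes "a \<in> carrier R"
  shows "int_eval R a (f + g) = int_eval R a f \<oplus> int_eval R a g"
proof (induction f g rule: poly_induct2)
  case (pCons c f d g)
  have "int_eval R a (pCons c f + pCons d g)
      = (add_pow R c \<one> \<oplus> add_pow R d \<one>) \<oplus> (a \<otimes> int_eval R a f \<oplus> a \<otimes> int_eval R a g)"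
    using assms pCons by (simp add: add_pow_int_add r_distr)
  also have "\<dots> = int_eval R a (pCons c f) \<oplus> int_eval R a (pCons d g)"
    using assms by (simp add: a_ac)
  finally show ?case .
qed simp

lemma int_eval_smult:
  assumes "a \<in> carrier R"
  shows "int_eval R a (smult c f) = add_pow R c \<one> \<otimes> int_eval R a f"
  by (induction f) (use assms in \<open>auto simp: add_pow_int_one_mult r_distr m_lcomm\<close>)

lemma int_eval_mult:
  assumes "a \<in> carrier R"
  shows "int_eval R a (f * g) = int_eval R a f \<otimes> int_eval R a g"
proof (induction f)
  case (pCons c f)
  have "int_eval R a (pCons c f * g)
      = add_pow R c \<one> \<otimes> int_eval R a g \<oplus> a \<otimes> (int_eval R a f \<otimes> int_eval R a g)"
    using assms pCons by (simp add: int_eval_add int_eval_smult)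
  then show ?case using assms by (simp add: l_distr m_assoc)
qed (use assms in auto)

lemma int_eval_1 [simp]: "a \<in> carrier R \<Longrightarrow> int_eval R a 1 = \<one>"
  by (simp add: one_pCons)

lemma int_eval_power:
  "a \<in> carrier R \<Longrightarrow> int_eval R a (f ^ n) = int_eval R a f [^] n"
  by (induction n) (auto simp: int_eval_mult nat_pow_Suc2 m_comm)

lemma int_eval_X: "a \<in> carrier R \<Longrightarrow> int_eval R a [:0, 1:] = a"
  by simp

lemma int_eval_uminus:
  assumes "a \<in> carrier R"
  shows "int_eval R a (- f) = \<ominus> int_eval R a f"
proof -
  have "int_eval R a (- f) \<oplus> int_eval R a f = \<zero>"
    using int_eval_add[OF assms, of "-f" f] by simp
  then show ?thesis using assms by (simp add: minus_equality)
qed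

lemma int_eval_diff:
  assumes "a \<in> carrier R"
  shows "int_eval R a (f - g) = int_eval R a f \<ominus> int_eval R a g"
  using int_eval_add[OF assms, of f "-g"] int_eval_uminus[OF assms] by (simp add: a_minus_def)

lemma int_eval_monom:
  assumes "a \<in> carrier R"
  shows "int_eval R a (Polynomial.monom c n) = add_pow R c \<one> \<otimes> a [^] n"
  using assms by (induction n) (auto simp: monom_0 monom_Suc m_ac nat_pow_Suc2)

lemma int_eval_smult_char:
  assumes "a \<in> carrier R" "add_pow R (int p) \<one> = \<zero>"
  shows "int_eval R a (smult (int p) f) = \<zero>"
  using assms by (simp add: int_eval_smult)

end

text \<open>Proved over the integers with an explicit multiple of p, so that evaluation by
  \<open>int_eval\<close> carries it to every commutative ring in which p times 1 vanishes.\<close>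

lemma one_plus_X_power_prime:
  assumes "prime (p::nat)"
  obtains G where "[:1, 1:] ^ p = (1 :: int poly) + [:0, 1:] ^ p + smult (int p) G"
proof -
  let ?X = "[:0, 1:] :: int poly"
  have p0: "p > 0" using assms prime_gt_0_nat by blast
  have "[:1, 1:] ^ p = (?X + 1) ^ p" by (simp add: one_pCons)
  also have "\<dots> = (\<Sum>k\<le>p. of_nat (p choose k) * ?X ^ k)"
    by (subst binomial_ring) simp
  also have "{..p} = insert 0 (insert p {0<..<p})" using p0 by auto
  also have "(\<Sum>k\<in>insert 0 (insert p {0<..<p}). of_nat (p choose k) * ?X ^ k)
      = 1 + ?X ^ p + (\<Sum>k\<in>{0<..<p}. of_nat (p choose k) * ?X ^ k)"
    using p0 by (simp add: add.assoc)
  also have "(\<Sum>k\<in>{0<..<p}. of_nat (p choose k) * ?X ^ k)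
      = smult (int p) (\<Sum>k\<in>{0<..<p}. of_nat ((p choose k) div p) * ?X ^ k)"
  proof -
    have "smult (int p) f = of_nat p * f" for f :: "int poly"
      by (simp add: of_nat_poly)
    moreover have "of_nat (p choose k) = (of_nat p * of_nat ((p choose k) div p) :: int poly)"
      if "k \<in> {0<..<p}" for k
    proof -
      have "p dvd (p choose k)"
        using that assms by (intro dvd_choose_prime) auto
      then show ?thesis by (metis dvd_mult_div_cancel of_nat_mult)
    qed
    ultimately show ?thesis by (simp add: sum_distrib_left mult.assoc)
  qed
  finally show ?thesis using that by blast
qed

text \<open>Homogeneity: for b nonzero, dividing by b reduces the claim to (1 + c)^p = 1 + c^p with
  c = a / b, which is the value at c of the identity in one variable.\<close>

lemma (in field) frobenius_add:
  assumes p: "prime (p::nat)" and char: "add_pow R (int p) \<one> = \<zero>"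
    and a: "a \<in> carrier R" and b: "b \<in> carrier R"
  shows "(a \<oplus> b) [^] p = a [^] p \<oplus> b [^] p"
proof (cases "b = \<zero>")
  case True
  then show ?thesis using a p prime_gt_0_nat[OF p] by (simp add: nat_pow_zero)
next
  case False
  then have bU: "b \<in> Units R" using b field_Units by auto
  define c where "c = a \<otimes> inv b"
  have c: "c \<in> carrier R" using a bU by (simp add: c_def)
  have ac: "a = b \<otimes> c" using a b bU by (simp add: c_def m_lcomm)
  obtain G where G: "[:1, 1:] ^ p = (1 :: int poly) + [:0, 1:] ^ p + smult (int p) G"
    using one_plus_X_power_prime[OF p] .
  have "int_eval R c ([:1, 1:] ^ p) = \<one> \<oplus> c [^] p"
    unfolding G using c char by (simp only: int_eval_add int_eval_1 int_eval_power int_eval_X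
        int_eval_smult_char) simp
  moreover have "int_eval R c [:1, 1:] = \<one> \<oplus> c"
    using c by simp
  ultimately have *: "(\<one> \<oplus> c) [^] p = \<one> \<oplus> c [^] p" using c by (simp add: int_eval_power)
  have "(a \<oplus> b) = b \<otimes> (\<one> \<oplus> c)" using b c unfolding ac by (simp add: r_distr a_comm)
  then have "(a \<oplus> b) [^] p = b [^] p \<otimes> (\<one> \<oplus> c [^] p)"
    using b c by (simp add: nat_pow_distrib *)
  also have "\<dots> = a [^] p \<oplus> b [^] p"
    using b c unfolding ac by (simp add: nat_pow_distrib r_distr a_comm)
  finally show ?thesis .
qed

lemma (in field) frobenius_add_iter:
  assumes "prime (p::nat)" "add_pow R (int p) \<one> = \<zero>"
    and a: "a \<in> carrier R" and b: "b \<in> carrier R"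
  shows "(a \<oplus> b) [^] (p ^ r) = a [^] (p ^ r) \<oplus> b [^] (p ^ r)"
proof (induction r)
  case (Suc r)
  have "(a \<oplus> b) [^] (p ^ Suc r) = ((a \<oplus> b) [^] (p ^ r)) [^] p"
    using a b by (simp add: nat_pow_pow mult.commute)
  also have "\<dots> = (a [^] (p ^ r)) [^] p \<oplus> (b [^] (p ^ r)) [^] p"
    unfolding Suc using a b by (intro frobenius_add assms) auto
  finally show ?case using a b by (simp add: nat_pow_pow mult.commute)
qed (use a b in auto)

text \<open>Powers of the variable divided by \<open>X - c\<close>; the value of the quotient at \<open>c\<close> plays the
  role of a derivative.\<close>

lemma (in domain) var_pow_split:
  assumes c: "c \<in> carrier R"
  defines "P \<equiv> poly_ring R"
  defines "l \<equiv> [\<one>, \<ominus> c]" and "b \<equiv> poly_of_const c"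
  shows "X = l \<oplus>\<^bsub>P\<^esub> b" "l \<in> carrier P" "b \<in> carrier P" "eval l c = \<zero>" "eval b c = c"
    "\<exists>g\<in>carrier P. X [^]\<^bsub>P\<^esub> Suc n = l \<otimes>\<^bsub>P\<^esub> g \<oplus>\<^bsub>P\<^esub> b [^]\<^bsub>P\<^esub> Suc n
        \<and> eval g c = add_pow R (int (Suc n)) (c [^] n)"
proof -
  interpret P: domain P unfolding P_def by (rule univ_poly_is_domain[OF carrier_is_subring])
  show l: "l \<in> carrier P"
    unfolding P_def l_def univ_poly_carrier[symmetric] polynomial_def using c by auto
  show b: "b \<in> carrier P"
    using canonical_embedding_is_hom[OF carrier_is_subring] c
    unfolding P_def b_def ring_hom_def by auto
  show "eval l c = \<zero>" using c by (simp add: l_def r_neg)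
  show bc: "eval b c = c" using c by (simp add: b_def poly_of_const_def)
  show X: "X = l \<oplus>\<^bsub>P\<^esub> b"
    using c unfolding P_def l_def b_def poly_of_const_def var_def univ_poly_add
    by (auto simp: l_neg)
  have Xc: "X \<in> carrier P" unfolding P_def using var_closed[OF carrier_is_subring] by simp
  have hom: "(\<lambda>p. eval p c) \<in> ring_hom P R"
    unfolding P_def by (rule eval_is_hom[OF carrier_is_subring c])
  have ep: "eval (b [^]\<^bsub>P\<^esub> m) c = c [^] m" for m :: nat
    using b by (induction m)
      (auto simp: ring_hom_mult[OF hom] bc ring_hom_one[OF hom])
  show "\<exists>g\<in>carrier P. X [^]\<^bsub>P\<^esub> Suc n = l \<otimes>\<^bsub>P\<^esub> g \<oplus>\<^bsub>P\<^esub> b [^]\<^bsub>P\<^esub> Suc n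
        \<and> eval g c = add_pow R (int (Suc n)) (c [^] n)"
  proof (induction n)
    case 0
    have "X [^]\<^bsub>P\<^esub> Suc 0 = l \<otimes>\<^bsub>P\<^esub> \<one>\<^bsub>P\<^esub> \<oplus>\<^bsub>P\<^esub> b [^]\<^bsub>P\<^esub> Suc 0"
      using l b Xc by (simp add: X)
    moreover have "eval \<one>\<^bsub>P\<^esub> c = add_pow R (int (Suc 0)) (c [^] (0::nat))"
      using ring_hom_one[OF hom] by simp
    ultimately show ?case by blast
  next
    case (Suc n)
    then obtain g where g: "g \<in> carrier P"
      and eq: "X [^]\<^bsub>P\<^esub> Suc n = l \<otimes>\<^bsub>P\<^esub> g \<oplus>\<^bsub>P\<^esub> b [^]\<^bsub>P\<^esub> Suc n"
      and ev: "eval g c = add_pow R (int (Suc n)) (c [^] n)" by blast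
    let ?g = "X \<otimes>\<^bsub>P\<^esub> g \<oplus>\<^bsub>P\<^esub> b [^]\<^bsub>P\<^esub> Suc n"
    have B: "b [^]\<^bsub>P\<^esub> Suc n \<in> carrier P" using b by blast
    have "X [^]\<^bsub>P\<^esub> Suc (Suc n) = X \<otimes>\<^bsub>P\<^esub> (l \<otimes>\<^bsub>P\<^esub> g \<oplus>\<^bsub>P\<^esub> b [^]\<^bsub>P\<^esub> Suc n)"
      unfolding eq[symmetric] using Xc P.nat_pow_Suc2 by blast
    also have "\<dots> = l \<otimes>\<^bsub>P\<^esub> (X \<otimes>\<^bsub>P\<^esub> g) \<oplus>\<^bsub>P\<^esub> X \<otimes>\<^bsub>P\<^esub> b [^]\<^bsub>P\<^esub> Suc n"
      using l g Xc B by (simp only: P.r_distr P.m_closed P.m_lcomm)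
    also have "X \<otimes>\<^bsub>P\<^esub> b [^]\<^bsub>P\<^esub> Suc n = l \<otimes>\<^bsub>P\<^esub> b [^]\<^bsub>P\<^esub> Suc n \<oplus>\<^bsub>P\<^esub> b \<otimes>\<^bsub>P\<^esub> b [^]\<^bsub>P\<^esub> Suc n"
      unfolding X using l b B by (rule P.l_distr)
    also have "b \<otimes>\<^bsub>P\<^esub> b [^]\<^bsub>P\<^esub> Suc n = b [^]\<^bsub>P\<^esub> Suc (Suc n)"
      using b P.nat_pow_Suc2 by metis
    finally have "X [^]\<^bsub>P\<^esub> Suc (Suc n) = l \<otimes>\<^bsub>P\<^esub> ?g \<oplus>\<^bsub>P\<^esub> b [^]\<^bsub>P\<^esub> Suc (Suc n)"
      using l g Xc B b by (simp only: P.r_distr P.m_closed P.a_assoc P.nat_pow_closed)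
    moreover have "eval ?g c = c \<otimes> eval g c \<oplus> c [^] Suc n"
      using ring_hom_add[OF hom] ring_hom_mult[OF hom] Xc g B ep eval_var[OF c] P.m_closed by metis
    moreover have "c \<otimes> eval g c = add_pow R (int (Suc n)) (c [^] Suc n)"
      unfolding ev using c by (subst add_pow_rdistr_int) (auto simp: m_comm)
    moreover have "add_pow R (int (Suc n)) (c [^] Suc n) \<oplus> c [^] Suc n
        = add_pow R (int (Suc (Suc n))) (c [^] Suc n)"
      using c add_pow_int_add[of "c [^] Suc n" "int (Suc n)" 1]
      by (simp add: add.commute)
    moreover have "?g \<in> carrier P" using Xc g B by blast
    ultimately show ?case by metis
  qed
qed

text \<open>X^q - X with q = p^r has coefficients in K, so it splits and has q roots counted with
  multiplicity; they are simple because its derivative q X^(q-1) - 1 is -1. In the application R is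
  an algebraic closure and K the image of the integers modulo p.\<close>

lemma (in field) card_roots_splitted_frobenius:
  assumes p: "prime (p::nat)" and r: "r \<ge> 1" and char: "add_pow R (int p) \<one> = \<zero>"
    and K: "subfield K R" and spl: "\<And>P. P \<in> carrier (K[X]) \<Longrightarrow> splitted P"
  shows "card {x \<in> carrier R. x [^] (p ^ r) = x} = p ^ r"
    and "finite {x \<in> carrier R. x [^] (p ^ r) = x}"
proof -
  define q where "q = p ^ r"
  have q2: "q \<ge> 2"
    using p r prime_ge_2_nat[OF p] self_le_power[of p r] unfolding q_def by linarith
  define P where "P = poly_ring R"
  interpret P: domain P unfolding P_def by (rule univ_poly_is_domain[OF carrier_is_subring])
  have Ksub: "subring K R" using K subfieldE(1) by blast
  have K1: "K \<subseteq> carrier R" "\<one> \<in> K" "\<ominus> \<one> \<in> K" "\<zero> \<in> K"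
    using subringE[OF Ksub] by auto
  define f where "f = poly_add (X [^]\<^bsub>P\<^esub> q) [\<ominus> \<one>, \<zero>]"
  have n1: "\<ominus> \<one> \<noteq> \<zero>" using one_not_zero by (metis add.inv_eq_1_iff one_closed)
  have Xq: "X [^]\<^bsub>P\<^esub> q = ring.monom R \<one> q" "X [^]\<^bsub>K[X]\<^esub> q = ring.monom R \<one> q"
    unfolding P_def using unitary_monom_eq_var_pow[OF carrier_is_subring, of q]
      unitary_monom_eq_var_pow[OF Ksub, of q] by auto
  have polK: "polynomial K (X [^]\<^bsub>P\<^esub> q)" "polynomial K [\<ominus> \<one>, \<zero>]"
  proof -
    have "X [^]\<^bsub>P\<^esub> q = X [^]\<^bsub>K[X]\<^esub> q" using Xq by simp
    then show "polynomial K (X [^]\<^bsub>P\<^esub> q)"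
      using var_pow_closed[OF Ksub, of q] univ_poly_carrier by metis
    show "polynomial K [\<ominus> \<one>, \<zero>]" using K1 n1 by (simp add: polynomial_def)
  qed
  have degX: "length (X [^]\<^bsub>P\<^esub> q) = q + 1" unfolding Xq by (simp add: monom_def)
  have fK: "f \<in> carrier (K[X])"
    unfolding f_def univ_poly_carrier[symmetric] using poly_add_closed[OF Ksub polK] .
  have "length f = max (length (X [^]\<^bsub>P\<^esub> q)) (length [\<ominus> \<one>, \<zero>])"
    unfolding f_def by (rule poly_add_length_eq[OF Ksub polK]) (use degX q2 in auto)
  then have len: "length f = q + 1" using degX q2 by simp
  then have fne: "f \<noteq> []" by auto
  have size: "size (roots f) = q" using spl[OF fK] len by (simp add: splitted_def)
  have fc: "f \<in> carrier P" unfolding P_def using fK carrier_polynomial_shell[OF Ksub] by auto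
  have Xc: "X \<in> carrier P" unfolding P_def using var_closed[OF carrier_is_subring] by simp
  have mXc: "[\<ominus> \<one>, \<zero>] \<in> carrier P"
    using n1 unfolding P_def univ_poly_carrier[symmetric] polynomial_def by auto
  have "[\<ominus> \<one>, \<zero>] \<oplus>\<^bsub>P\<^esub> X = \<zero>\<^bsub>P\<^esub>"
    unfolding P_def var_def univ_poly_add univ_poly_zero by (simp add: l_neg)
  then have mX: "[\<ominus> \<one>, \<zero>] = \<ominus>\<^bsub>P\<^esub> X" using P.minus_equality mXc Xc by metis
  have feq: "f = X [^]\<^bsub>P\<^esub> q \<oplus>\<^bsub>P\<^esub> \<ominus>\<^bsub>P\<^esub> X"
    unfolding f_def mX[symmetric] by (simp add: P_def univ_poly_add)
  have evf: "eval f c = c [^] q \<ominus> c" if c: "c \<in> carrier R" for c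
  proof -
    have hom: "ring_hom_ring P R (\<lambda>p. eval p c)"
      unfolding P_def using eval_ring_hom[OF carrier_is_subring c] .
    have "eval (X [^]\<^bsub>P\<^esub> q) c = c [^] q"
      using ring_hom_ring.hom_nat_pow[OF hom Xc] eval_var[OF c] by simp
    moreover have "eval (\<ominus>\<^bsub>P\<^esub> X) c = \<ominus> c"
      using c unfolding mX[symmetric] by (simp add: l_minus)
    ultimately show ?thesis
      unfolding feq using ring_hom_add[OF ring_hom_ring.homh[OF hom]] Xc
      by (simp add: a_minus_def)
  qed
  have root_iff: "c \<in># roots f \<longleftrightarrow> c \<in> carrier R \<and> c [^] q = c" for c
    using roots_mem_iff_is_root[of f] fc fne evf
    unfolding P_def is_root_def by (auto simp: r_right_minus_eq)
  have simple: "count (roots f) c \<le> 1" for c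
  proof (rule ccontr)
    assume "\<not> count (roots f) c \<le> 1"
    then have 2: "count (roots f) c \<ge> 2" by simp
    then have "c \<in># roots f" by (metis count_greater_zero_iff less_le_trans pos2)
    then have c: "c \<in> carrier R" and cq: "c [^] q = c" using root_iff by auto
    define l where "l = [\<one>, \<ominus> c]"
    define b where "b = poly_of_const c"
    note spl = var_pow_split[OF c, folded P_def l_def b_def]
    obtain g where g: "g \<in> carrier P" and eq: "X [^]\<^bsub>P\<^esub> Suc (q-1) = l \<otimes>\<^bsub>P\<^esub> g \<oplus>\<^bsub>P\<^esub> b [^]\<^bsub>P\<^esub> Suc (q-1)"
      and ev: "eval g c = add_pow R (int (Suc (q-1))) (c [^] (q-1))" using spl(6)[of "q-1"] by blast
    have hb: "ring_hom_ring R P poly_of_const"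
      unfolding P_def using canonical_embedding_ring_hom[OF carrier_is_subring] by simp
    have bq: "b [^]\<^bsub>P\<^esub> q = b"
      using ring_hom_ring.hom_nat_pow[OF hb c, of q] cq by (simp add: b_def)
    have "f = (l \<otimes>\<^bsub>P\<^esub> g \<oplus>\<^bsub>P\<^esub> b) \<oplus>\<^bsub>P\<^esub> \<ominus>\<^bsub>P\<^esub> (l \<oplus>\<^bsub>P\<^esub> b)"
      using eq q2 bq unfolding feq spl(1)[symmetric] by simp
    also have "\<dots> = l \<otimes>\<^bsub>P\<^esub> (g \<ominus>\<^bsub>P\<^esub> \<one>\<^bsub>P\<^esub>)"
          proof -
      have "(l \<otimes>\<^bsub>P\<^esub> g \<oplus>\<^bsub>P\<^esub> b) \<oplus>\<^bsub>P\<^esub> \<ominus>\<^bsub>P\<^esub> (l \<oplus>\<^bsub>P\<^esub> b)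
          = (l \<otimes>\<^bsub>P\<^esub> g \<oplus>\<^bsub>P\<^esub> \<ominus>\<^bsub>P\<^esub> l) \<oplus>\<^bsub>P\<^esub> (b \<oplus>\<^bsub>P\<^esub> \<ominus>\<^bsub>P\<^esub> b)"
        using g spl(2,3) by (simp only: P.minus_add P.a_ac P.m_closed P.a_inv_closed P.add.m_closed)
      also have "\<dots> = l \<otimes>\<^bsub>P\<^esub> (g \<ominus>\<^bsub>P\<^esub> \<one>\<^bsub>P\<^esub>)"
        using g spl(2,3) by (simp add: P.r_neg a_minus_def P.r_distr P.r_minus)
      finally show ?thesis .
    qed
    \<comment> \<open>At c the cofactor g - 1 takes the value q c^(q-1) - 1 = -1, whereas a double
      root would make it a multiple of X - c.\<close>
    finally have f1: "f = l \<otimes>\<^bsub>P\<^esub> (g \<ominus>\<^bsub>P\<^esub> \<one>\<^bsub>P\<^esub>)" .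
    have "2 \<le> alg_mult f c" using 2 alg_mult_eq_count_roots[of f] fc unfolding P_def by simp
    from le_alg_mult_imp_pdivides[OF c _ this] fc
    have "(l [^]\<^bsub>P\<^esub> (2::nat)) divides\<^bsub>P\<^esub> f" unfolding P_def l_def pdivides_def by simp
    then obtain h where h: "h \<in> carrier P" and "f = (l [^]\<^bsub>P\<^esub> (2::nat)) \<otimes>\<^bsub>P\<^esub> h"
      unfolding factor_def by blast
    then have "l \<otimes>\<^bsub>P\<^esub> (l \<otimes>\<^bsub>P\<^esub> h) = l \<otimes>\<^bsub>P\<^esub> (g \<ominus>\<^bsub>P\<^esub> \<one>\<^bsub>P\<^esub>)"
      using spl(2) f1 by (simp add: numeral_2_eq_2 P.m_assoc)
    moreover have "l \<noteq> \<zero>\<^bsub>P\<^esub>" by (simp add: l_def P_def univ_poly_zero)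
    ultimately have lh: "l \<otimes>\<^bsub>P\<^esub> h = g \<ominus>\<^bsub>P\<^esub> \<one>\<^bsub>P\<^esub>"
      using P.m_lcancel[of l] spl(2) h g by auto
    have hom: "ring_hom_ring P R (\<lambda>p. eval p c)"
      unfolding P_def using eval_ring_hom[OF carrier_is_subring c] .
    interpret ev: ring_hom_ring P R "\<lambda>p. eval p c" by (rule hom)
    have "eval (l \<otimes>\<^bsub>P\<^esub> h) c = \<zero>" using spl(2,4) h by simp
    moreover have "eval g c = \<zero>"
    proof -
      have "add_pow R (int q) \<one> = \<zero>"
      proof -
        have "int q = int p * int (p ^ (r - 1))" using r unfolding q_def
          by (cases r) auto
        then show ?thesis by (simp only: add_pow_int_one_mult char) simp
      qed
      moreover have "add_pow R (int q) (c [^] (q-1)) = add_pow R (int q) \<one> \<otimes> c [^] (q-1)"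
        using c by (subst add_pow_ldistr_int) auto
      ultimately show ?thesis using ev q2 c by simp
    qed
    moreover have "eval (g \<ominus>\<^bsub>P\<^esub> \<one>\<^bsub>P\<^esub>) c = eval g c \<ominus> \<one>"
      using g by (simp add: a_minus_def)
    ultimately have "\<ominus> \<one> = \<zero>" using lh by (simp add: a_minus_def)
    then show False using n1 by simp
  qed
  have S: "{x \<in> carrier R. x [^] q = x} = set_mset (roots f)" using root_iff by auto
  have "size (roots f) = card (set_mset (roots f))"
  proof -
    have "count (roots f) x = 1" if "x \<in># roots f" for x
      using simple[of x] that by (metis count_greater_zero_iff le_antisym less_eq_Suc_le One_nat_def)
    then show ?thesis by (simp add: size_multiset_overloaded_eq)
  qed
  then show "card {x \<in> carrier R. x [^] (p ^ r) = x} = p ^ r"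
    and "finite {x \<in> carrier R. x [^] (p ^ r) = x}"
    using S size unfolding q_def by auto
qed

lemma (in field) frobenius_fixed_subfield:
  assumes p: "prime (p::nat)" and char: "add_pow R (int p) \<one> = \<zero>"
  shows "subfield {x \<in> carrier R. x [^] (p ^ r) = x} R"
proof (rule subfieldI'[OF subringI])
  have p0: "p ^ r > 0" using prime_gt_0_nat[OF p] by simp
  fix x assume x: "x \<in> {x \<in> carrier R. x [^] (p ^ r) = x}"
  \<comment> \<open>Expanding 0 = (x + (-x))^q gives (-x)^q = -x without distinguishing p = 2 from
    odd p.\<close>
  have "\<zero> = (x \<oplus> \<ominus> x) [^] (p ^ r)" using x p0 by (simp add: r_neg nat_pow_zero)
  also have "\<dots> = x \<oplus> (\<ominus> x) [^] (p ^ r)" using x frobenius_add_iter[OF assms, of x "\<ominus> x" r] by simp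
  finally have "(\<ominus> x) [^] (p ^ r) = \<ominus> x" using x
    by (metis (no_types, lifting) a_inv_closed add.inv_equality a_comm mem_Collect_eq nat_pow_closed minus_minus)
  then show "\<ominus> x \<in> {x \<in> carrier R. x [^] (p ^ r) = x}" using x by simp
next
  fix x assume x: "x \<in> {x \<in> carrier R. x [^] (p ^ r) = x} - {\<zero>}"
  then have xU: "x \<in> Units R" using field_Units by auto
  have "(inv x) [^] (p ^ r) \<otimes> x [^] (p ^ r) = \<one>"
    using xU by (metis Units_closed Units_inv_closed Units_l_inv nat_pow_distrib nat_pow_one)
  then have "x \<otimes> (inv x) [^] (p ^ r) = \<one>" using x xU by (simp add: m_comm)
  then have "(inv x) [^] (p ^ r) = inv x" using x xU comm_inv_char[of x "(inv x) [^] (p ^ r)"] by simp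
  then show "inv x \<in> {x \<in> carrier R. x [^] (p ^ r) = x}" using xU by simp
qed (use frobenius_add_iter[OF assms] in \<open>auto simp: nat_pow_distrib\<close>)

text \<open>The field is the set of solutions of x^q = x in an algebraic closure of the integers
  modulo p. An injection of this finite set into the naturals moves the structure to the carrier
  type used in \<open>wedderburn_decomposition\<close>.\<close>

lemma exists_finite_field:
  assumes p: "prime (p::nat)" and r: "r \<ge> 1"
  shows "\<exists>F :: nat ring. field F \<and> finite (carrier F) \<and> card (carrier F) = p ^ r"
proof -
  let ?Z = "residue_ring (int p)"
  have rp: "residues_prime p" using p by (simp add: residues_prime_def)
  interpret Z: field ?Z using residues_prime.is_field[OF rp] .
  let ?L = "Z.alg_closure"
  have ac: "algebraic_closure ?L (Z.indexed_const ` carrier ?Z)"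
    and hom: "Z.indexed_const \<in> ring_hom ?Z ?L" using Z.alg_closureE by auto
  interpret L: algebraic_closure ?L "Z.indexed_const ` carrier ?Z" by (rule ac)
  interpret h: ring_hom_ring ?Z ?L Z.indexed_const
    by (rule ring_hom_ringI2[OF Z.ring_axioms L.ring_axioms hom])
  have pos: "int p > 1" using prime_gt_1_nat[OF p] by simp
  have zn: "add_pow ?Z n \<one>\<^bsub>?Z\<^esub> = int n mod int p" for n :: nat
    using pos by (induction n) (auto simp: Z.add.nat_pow_0 add_pow_def residue_ring_def mod_simps add.commute)
  have hn: "Z.indexed_const (add_pow ?Z n \<one>\<^bsub>?Z\<^esub>) = add_pow ?L n \<one>\<^bsub>?L\<^esub>" for n :: nat
    by (induction n) (auto simp: Z.add.nat_pow_Suc L.add.nat_pow_Suc Z.add.nat_pow_0 L.add.nat_pow_0)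
  have "add_pow ?L p \<one>\<^bsub>?L\<^esub> = \<zero>\<^bsub>?L\<^esub>"
    using hn[of p] zn[of p] h.hom_zero by (simp add: residue_ring_def)
  then have char: "add_pow ?L (int p) \<one>\<^bsub>?L\<^esub> = \<zero>\<^bsub>?L\<^esub>" by (simp add: add_pow_int_ge)
  let ?S = "{x \<in> carrier ?L. x [^]\<^bsub>?L\<^esub> (p ^ r) = x}"
  have card: "card ?S = p ^ r" "finite ?S"
    using L.card_roots_splitted_frobenius[OF p r char L.subfield_axioms L.roots_over_subfield] by auto
  have "subfield ?S ?L" by (rule L.frobenius_fixed_subfield[OF p char])
  then have S: "field (?L\<lparr>carrier := ?S\<rparr>)" by (rule L.subfield_iff(2))
  obtain e :: "_ \<Rightarrow> nat" and n where e: "inj_on e ?S"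
    using finite_imp_inj_to_nat_seg[OF card(2)] by blast
  let ?F = "image_ring e (?L\<lparr>carrier := ?S\<rparr>)"
  have "field ?F" using field.inj_imp_image_ring_is_field[OF S] e by simp
  moreover have cF: "carrier ?F = e ` ?S" by (simp add: image_ring_carrier)
  moreover have "finite (carrier ?F)" "card (carrier ?F) = p ^ r"
    unfolding cF using card card_image[OF e] by auto
  ultimately show ?thesis by blast
qed

text \<open>By Lagrange the order q kills 1 in the additive group, and in a domain some prime factor
  p of q must then do so. If another prime l divided q, a subgroup of order l would contain x
  \<noteq> 0 with l x = 0, so l would kill 1 as well, and a Bezout combination of l and p would give
  1 = 0.\<close>

lemma (in field) finite_field_order:
  assumes fin: "finite (carrier R)"
  obtains p r where "prime (p::nat)" "r \<ge> 1" "card (carrier R) = p ^ r" "add_pow R (int p) \<one> = \<zero>"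
proof -
  let ?q = "card (carrier R)"
  have "card {\<zero>, \<one>} \<le> ?q" using fin by (intro card_mono) auto
  then have q2: "?q \<ge> 2" by simp
  have prod0: "\<exists>p\<in>#A. add_pow R (int p) \<one> = \<zero>" if "add_pow R (int (prod_mset A)) \<one> = \<zero>" for A
    using that
  proof (induction A)
    case (add x A)
    then show ?case by (auto simp: add_pow_int_one_mult integral_iff)
  qed auto
  interpret A: group "add_monoid R" by (rule add.is_group)
  have killed: "add_pow R (int n) x = \<zero>" if "subgroup H (add_monoid R)" "card H = n" "x \<in> H" "finite H" for H n x
  proof -
    interpret H: group "(add_monoid R)\<lparr>carrier := H\<rparr>" using subgroup.subgroup_is_group[OF that(1) add.is_group] .
    have "x [^]\<^bsub>(add_monoid R)\<lparr>carrier := H\<rparr>\<^esub> Coset.order ((add_monoid R)\<lparr>carrier := H\<rparr>) = \<one>\<^bsub>(add_monoid R)\<lparr>carrier := H\<rparr>\<^esub>"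
      by (rule H.pow_order_eq_1) (use that in auto)
    then have "x [^]\<^bsub>add_monoid R\<^esub> n = \<zero>"
      using that by (simp add: Coset.order_def nat_pow_def)
    then show ?thesis by (simp add: add_pow_def int_pow_int)
  qed
  have "add_pow R (int ?q) \<one> = \<zero>"
    using killed[of "carrier R" ?q \<one>] group.subgroup_self[OF add.is_group] fin by simp
  then have "add_pow R (int (prod_mset (prime_factorization ?q))) \<one> = \<zero>"
    using q2 by (simp add: prod_mset_prime_factorization_nat)
  then obtain p where "p \<in># prime_factorization ?q" and char: "add_pow R (int p) \<one> = \<zero>"
    using prod0 by blast
  then have p: "prime p" "p dvd ?q" by auto
  have only: "l = p" if l: "prime l" "l dvd ?q" for l
  proof (rule ccontr)
    assume ne: "l \<noteq> p"
    obtain m where "?q = l ^ 1 * m" using l by (auto elim: dvdE)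
    then obtain H where H: "subgroup H (add_monoid R)" "card H = l ^ 1"
      using sylow_thm[OF l(1) add.is_group, of 1 m] fin by (auto simp: Coset.order_def)
    have Hs: "H \<subseteq> carrier R" using subgroup.subset[OF H(1)] by simp
    have "\<exists>x\<in>H. x \<noteq> \<zero>"
    proof (rule ccontr)
      assume "\<not> ?thesis"
      then have "H \<subseteq> {\<zero>}" by auto
      then have "card H \<le> 1" using card_mono[of "{\<zero>}" H] by simp
      then show False using H(2) prime_gt_1_nat[OF l(1)] by simp
    qed
    then obtain x where x: "x \<in> H" "x \<noteq> \<zero>" by blast
    have xc: "x \<in> carrier R" using x Hs by auto
    have "add_pow R (int l) x = \<zero>" using killed[OF H(1) _ x(1)] H(2) finite_subset[OF Hs fin] by simp
    moreover have "add_pow R (int l) x = add_pow R (int l) \<one> \<otimes> x"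
      using xc by (subst add_pow_ldistr_int) auto
    ultimately have l0: "add_pow R (int l) \<one> = \<zero>" using x(2) xc integral by (metis add_pow_def add.int_pow_closed one_closed)
    have "coprime (int l) (int p)" using ne l(1) p(1) primes_coprime by (simp add: coprime_int_iff)
    then obtain u v where "u * int l + v * int p = 1" using bezout_int[of "int l" "int p"] by auto
    then have "\<one> = add_pow R (u * int l + v * int p) \<one>" by simp
    also have "\<dots> = \<zero>" using l0 char
      by (simp add: add_pow_int_add add_pow_int_one_mult)
    finally show False by simp
  qed
  have "prime_factorization ?q = replicate_mset (multiplicity p ?q) p"
  proof -
    have "set_mset (prime_factorization ?q) \<subseteq> {p}" using only by auto
    then show ?thesis using p q2
      by (metis count_prime_factorization_prime set_mset_subset_singletonD count_replicate_mset)
  qed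
  then have "?q = p ^ multiplicity p ?q"
    using q2 prod_mset_prime_factorization_nat[of ?q] by (metis prod_mset_replicate_mset not_numeral_le_zero gr0I)
  moreover have "multiplicity p ?q \<ge> 1"
    using p q2 using prime_multiplicity_gt_zero_iff[of p "card (carrier R)"] by auto
  ultimately show ?thesis using that p char by blast
qed

section \<open>Uniqueness of the finite field of given order\<close>

lemma (in field) finite_field_pow_card:
  assumes fin: "finite (carrier R)" and x: "x \<in> carrier R"
  shows "x [^] card (carrier R) = x"
proof (cases "x = \<zero>")
  case True
  have "card (carrier R) > 0" using fin x card_gt_0_iff by blast
  then show ?thesis using True by (simp add: nat_pow_zero)
next
  case False
  interpret G: group "Multiplicative_Group.mult_of R" by (rule field_mult_group)
  have "x [^]\<^bsub>Multiplicative_Group.mult_of R\<^esub> Coset.order (Multiplicative_Group.mult_of R) = \<one>\<^bsub>Multiplicative_Group.mult_of R\<^esub>"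
    by (rule G.pow_order_eq_1) (use fin x False in auto)
  then have "x [^] (card (carrier R) - 1) = \<one>"
    using fin by (simp add: Coset.order_def nat_pow_def)
  then have "x [^] Suc (card (carrier R) - 1) = x" using x by simp
  moreover have "card (carrier R) > 0" using fin x card_gt_0_iff by blast
  ultimately show ?thesis by simp
qed

text \<open>A monic polynomial keeps its degree when its coefficients are mapped into R, so the
  usual bound for the number of roots applies. \<open>L\<close> rewrites an integer polynomial as
  the coefficient list, leading coefficient first, that represents a polynomial over R.\<close>

lemma (in field) monic_int_poly_roots:
  assumes fin: "finite (carrier R)" and monic: "Polynomial.coeff h (Polynomial.degree h) = 1"
    and all: "\<And>b. b \<in> carrier R \<Longrightarrow> int_eval R b h = \<zero>"
  shows "card (carrier R) \<le> Polynomial.degree h"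
proof -
  define L where "L = (\<lambda>h :: int poly. map (\<lambda>c. add_pow R c \<one>) (rev (coeffs h)))"
  have setL: "set (L h) \<subseteq> carrier R" for h by (auto simp: L_def)
  have ev: "eval (L g) b = int_eval R b g" if b: "b \<in> carrier R" for g b
  proof (induction g)
    case 0
    show ?case by (simp add: L_def)
  next
    case (pCons c g)
    have "L (pCons c g) = L g @ [add_pow R c \<one>]"
      using pCons(1) by (auto simp: L_def cCons_def)
    then show ?case using pCons b setL[of g] eval_append_aux[OF setL[of g], of "add_pow R c \<one>" b]
      by (simp add: m_comm a_comm)
  qed
  have h0: "h \<noteq> 0" using monic by auto
  have len: "length (L h) = Polynomial.degree h + 1" using h0 by (simp add: L_def length_coeffs)
  have "hd (L h) = \<one>"
  proof -
    have "rev (coeffs h) \<noteq> []" using h0 by simp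
    then have "hd (L h) = add_pow R (hd (rev (coeffs h))) \<one>" by (simp add: L_def hd_map)
    also have "hd (rev (coeffs h)) = 1" using h0 monic by (simp add: hd_rev last_coeffs_eq_coeff_degree)
    finally show ?thesis by simp
  qed
  then have c: "L h \<in> carrier (poly_ring R)"
    using setL len unfolding univ_poly_carrier[symmetric] polynomial_def by auto
  have ne: "L h \<noteq> []" using len by auto
  have "carrier R \<subseteq> set_mset (roots (L h))"
    using roots_mem_iff_is_root[OF c] ev all ne by (auto simp: is_root_def)
  then have "card (carrier R) \<le> card (set_mset (roots (L h)))" by (intro card_mono) auto
  also have "\<dots> \<le> size (roots (L h))"
    by (metis size_multiset_overloaded_eq card_eq_sum sum_mono count_greater_eq_one_iff)
  also have "\<dots> \<le> Polynomial.degree h" using size_roots_le_degree[OF c] len by simp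
  finally show ?thesis .
qed

text \<open>A monic integer polynomial \<open>m\<close> of least degree that vanishes at \<open>a\<close> serves as the minimal
  polynomial of \<open>a\<close>. Modulo \<open>p\<close> it divides \<open>X\<^sup>q - X\<close>, and the cofactor, of degree less than \<open>q\<close>,
  cannot vanish on all of \<open>K\<close>; hence \<open>m\<close> has a root in \<open>K\<close>.\<close>

lemma finite_field_embedding_root:
  fixes F :: "('a, 'm) ring_scheme" and K :: "('b, 'n) ring_scheme"
  assumes F: "field F" "finite (carrier F)" and K: "field K" "finite (carrier K)"
    and card: "card (carrier F) = card (carrier K)" and p: "prime (p::nat)"
    and charF: "add_pow F (int p) \<one>\<^bsub>F\<^esub> = \<zero>\<^bsub>F\<^esub>" and charK: "add_pow K (int p) \<one>\<^bsub>K\<^esub> = \<zero>\<^bsub>K\<^esub>"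
    and a: "a \<in> carrier F"
  obtains b where "b \<in> carrier K"
    "\<And>f. int_eval F a f = \<zero>\<^bsub>F\<^esub> \<Longrightarrow> int_eval K b f = \<zero>\<^bsub>K\<^esub>"
proof -
  interpret F: field F by (rule F)
  interpret K: field K by (rule K)
  define q where "q = card (carrier F)"
  have "card {\<zero>\<^bsub>F\<^esub>, \<one>\<^bsub>F\<^esub>} \<le> q" unfolding q_def using F by (intro card_mono) auto
  then have q2: "q \<ge> 2" by simp
  define I where "I = {f. int_eval F a f = \<zero>\<^bsub>F\<^esub>}"
  define P :: "int poly" where "P = Polynomial.monom 1 q - Polynomial.monom 1 1"
  have ev0: "int_eval K b P = \<zero>\<^bsub>K\<^esub>" if "b \<in> carrier K" for b
    using that K.finite_field_pow_card[OF K(2) that] card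
    by (simp add: P_def K.int_eval_diff K.int_eval_monom q_def K.r_right_minus_eq)
  have PI: "P \<in> I"
    using a F.finite_field_pow_card[OF F(2) a]
    by (simp add: I_def P_def F.int_eval_diff F.int_eval_monom q_def F.r_right_minus_eq)
  have coP: "Polynomial.coeff P q = 1" using q2 by (simp add: P_def)
  have degP: "Polynomial.degree P = q"
    using coP q2 unfolding P_def
    by (intro antisym degree_diff_le le_degree) (auto simp: degree_monom_le intro: order.trans[OF degree_monom_le])
  define M where "M = {f \<in> I. Polynomial.coeff f (Polynomial.degree f) = 1}"
  have PM: "P \<in> M" using PI coP degP by (simp add: M_def)
  obtain m where m: "m \<in> M" and min: "\<And>f. f \<in> M \<Longrightarrow> Polynomial.degree m \<le> Polynomial.degree f"
    using ex_has_least_nat[of "\<lambda>f. f \<in> M" P Polynomial.degree] PM by blast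
  define d where "d = Polynomial.degree m"
  have mI: "int_eval F a m = \<zero>\<^bsub>F\<^esub>" and mm: "Polynomial.coeff m d = 1"
    using m by (auto simp: M_def I_def d_def)
  have m0: "m \<noteq> 0" using mm by auto
  have d0: "d > 0"
  proof (rule ccontr)
    assume "\<not> d > 0"
    then have "m = 1" using mm unfolding d_def
      by (metis degree_eq_zeroE degree_pCons_0 coeff_pCons_0 not_gr0 one_pCons)
    then show False using mI a by simp
  qed
  \<comment> \<open>Below degree d the ideal \<open>I\<close> contains only multiples of p: a top
    coefficient prime to p could be changed to 1 by Bezout, since multiples of p lie in
    \<open>I\<close>, and this would contradict the choice of m.\<close>
  have small: "\<exists>g. f = Polynomial.smult (int p) g"
    if "n \<le> d" "f \<in> I" "\<And>i. i \<ge> n \<Longrightarrow> Polynomial.coeff f i = 0" for n f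
    using that
  proof (induction n arbitrary: f)
    case 0
    then have "f = 0" by (intro poly_eqI) auto
    then show ?case by (intro exI[of _ 0]) auto
  next
    case (Suc n)
    let ?c = "Polynomial.coeff f n"
    show ?case
    proof (cases "int p dvd ?c")
      case True
      then obtain e where e: "?c = int p * e" by blast
      let ?f = "f - Polynomial.smult (int p) (Polynomial.monom e n)"
      have "?f \<in> I" using Suc.prems(2) a charF
        by (simp add: I_def F.int_eval_diff F.int_eval_smult_char a_minus_def)
      moreover have "Polynomial.coeff ?f i = 0" if "i \<ge> n" for i
        using Suc.prems(3)[of i] that e by (cases "i = n") auto
      ultimately obtain g where "?f = Polynomial.smult (int p) g" using Suc.IH[of ?f] Suc.prems(1) by auto
      then have "f = Polynomial.smult (int p) (g + Polynomial.monom e n)"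
        by (simp add: smult_add_right algebra_simps)
      then show ?thesis by blast
    next
      case False
      then have "coprime ?c (int p)"
        using p by (metis coprime_commute prime_imp_coprime prime_int_nat_transfer prime_nat_int_transfer)
      then obtain u v where uv: "u * ?c + v * int p = 1" using bezout_int[of ?c "int p"] by auto
      let ?f = "Polynomial.smult u f + Polynomial.smult (int p) (Polynomial.monom v n)"
      have fI: "?f \<in> I" using Suc.prems(2) a charF
        by (simp add: I_def F.int_eval_add F.int_eval_smult_char F.int_eval_smult)
      have c1: "Polynomial.coeff ?f n = 1" using uv by (simp add: mult.commute)
      have "Polynomial.degree ?f \<le> n"
        using Suc.prems(3) by (intro degree_le) auto
      then have "Polynomial.degree ?f = n" using c1 le_degree[of ?f n] by simp
      then have "d \<le> n" using min[of ?f] fI c1 by (simp add: M_def d_def)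
      then show ?thesis using Suc.prems(1) by simp
    qed
  qed
  \<comment> \<open>As m is monic, pseudo-division is true division over the integers; the remainder
    lies in \<open>I\<close> below degree d and is thus a multiple of p.\<close>
  have divm: "\<exists>h s. f = m * h + Polynomial.smult (int p) s \<and> (\<forall>i\<ge>d. Polynomial.coeff (Polynomial.smult (int p) s) i = 0)"
    if f: "f \<in> I" for f
  proof -
    obtain h r where hr: "pseudo_divmod f m = (h, r)" by (cases "pseudo_divmod f m")
    have eq: "f = m * h + r" and r: "r = 0 \<or> Polynomial.degree r < d"
      using pseudo_divmod[OF m0 hr] mm by (auto simp: d_def)
    have "r = f - m * h" using eq by simp
    then have "r \<in> I" using f mI a by (simp add: I_def F.int_eval_diff F.int_eval_mult a_minus_def)
    moreover have "Polynomial.coeff r i = 0" if "i \<ge> d" for i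
      using r that by (auto simp: coeff_eq_0)
    ultimately show ?thesis using small[of d r] eq by blast
  qed
  obtain h s where hs: "P = m * h + Polynomial.smult (int p) s"
    and s: "\<forall>i\<ge>d. Polynomial.coeff (Polynomial.smult (int p) s) i = 0" using divm[OF PI] by blast
  have dq: "d \<le> q" using min[OF PM] degP by (simp add: d_def)
  have mh: "m * h = P - Polynomial.smult (int p) s" using hs by simp
  have cmh: "Polynomial.coeff (m * h) q = 1" using coP s dq unfolding mh by simp
  have "Polynomial.degree (m * h) \<le> q"
    using s dq degP unfolding mh by (intro degree_le) (auto simp: coeff_eq_0)
  then have dmh: "Polynomial.degree (m * h) = q" using cmh le_degree[of "m * h" q] by simp
  have h0: "h \<noteq> 0" using cmh by auto
  have dh: "d + Polynomial.degree h = q" using dmh m0 h0 by (simp add: degree_mult_eq d_def)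
  have "Polynomial.coeff h (Polynomial.degree h) = 1"
    using cmh coeff_mult_degree_sum[of m h] mm dh unfolding d_def by (metis mult_1)
  then have "\<not> (\<forall>b\<in>carrier K. int_eval K b h = \<zero>\<^bsub>K\<^esub>)"
    using K.monic_int_poly_roots[OF K(2), of h] dh d0 card unfolding q_def by auto
  then obtain b where b: "b \<in> carrier K" and hb: "int_eval K b h \<noteq> \<zero>\<^bsub>K\<^esub>" by blast
  have "\<zero>\<^bsub>K\<^esub> = int_eval K b m \<otimes>\<^bsub>K\<^esub> int_eval K b h"
    using ev0[OF b] b charK unfolding hs by (simp add: K.int_eval_add K.int_eval_mult K.int_eval_smult_char)
  then have mb: "int_eval K b m = \<zero>\<^bsub>K\<^esub>" using hb b K.integral by (metis K.int_eval_closed)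
  show ?thesis
  proof (rule that[OF b])
    fix f assume "int_eval F a f = \<zero>\<^bsub>F\<^esub>"
    then obtain h s where "f = m * h + Polynomial.smult (int p) s" using divm[of f] by (auto simp: I_def)
    then show "int_eval K b f = \<zero>\<^bsub>K\<^esub>" using b mb charK
      by (simp add: K.int_eval_add K.int_eval_mult K.int_eval_smult_char)
  qed
qed

text \<open>A generator a of the multiplicative group makes every element of F a value f(a) of an
  integer polynomial. By the choice of b, sending f(a) to f(b) is well defined and a homomorphism;
  it is injective because F is a field, and bijective because the orders agree.\<close>

lemma finite_field_unique:
  fixes F :: "('a, 'm) ring_scheme" and K :: "('b, 'n) ring_scheme"
  assumes F: "field F" "finite (carrier F)" and K: "field K" "finite (carrier K)"
    and card: "card (carrier F) = card (carrier K)" and p: "prime (p::nat)"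
    and charF: "add_pow F (int p) \<one>\<^bsub>F\<^esub> = \<zero>\<^bsub>F\<^esub>" and charK: "add_pow K (int p) \<one>\<^bsub>K\<^esub> = \<zero>\<^bsub>K\<^esub>"
  shows "F \<simeq> K"
proof -
  interpret F: field F by (rule F)
  interpret K: field K by (rule K)
  obtain a where "a \<in> carrier (Multiplicative_Group.mult_of F)"
    and gen: "carrier (Multiplicative_Group.mult_of F) = {a [^]\<^bsub>F\<^esub> i | i::nat. i \<in> UNIV}"
    using F.finite_field_mult_group_has_gen[OF F(2)] by blast
  then have a: "a \<in> carrier F" by simp
  obtain b where b: "b \<in> carrier K"
    and ker: "\<And>f. int_eval F a f = \<zero>\<^bsub>F\<^esub> \<Longrightarrow> int_eval K b f = \<zero>\<^bsub>K\<^esub>"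
    using finite_field_embedding_root[OF F K card p charF charK a] by blast
  have surj: "\<exists>f. x = int_eval F a f" if x: "x \<in> carrier F" for x
  proof (cases "x = \<zero>\<^bsub>F\<^esub>")
    case True
    then show ?thesis by (intro exI[of _ 0]) simp
  next
    case False
    then have "x \<in> carrier (Multiplicative_Group.mult_of F)" using x by simp
    then obtain i :: nat where "x = a [^]\<^bsub>F\<^esub> i" unfolding gen by blast
    then have "x = int_eval F a ([:0, 1:] ^ i)" using a F.int_eval_X[OF a] F.int_eval_power[OF a, of "[:0,1:]" i] by simp
    then show ?thesis by blast
  qed
  define \<phi> where "\<phi> = (\<lambda>x. int_eval K b (SOME f. x = int_eval F a f))"
  have phi: "\<phi> (int_eval F a f) = int_eval K b f" for f
  proof -
    define g where "g = (SOME g. int_eval F a f = int_eval F a g)"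
    have "int_eval F a f = int_eval F a g" unfolding g_def by (rule someI[of _ f]) simp
    then have "int_eval F a (g - f) = \<zero>\<^bsub>F\<^esub>" using a by (simp add: F.int_eval_diff)
    from ker[OF this] have "int_eval K b g = int_eval K b f"
      using b by (simp add: K.int_eval_diff)
    then show ?thesis by (simp add: \<phi>_def g_def)
  qed
  have hom: "\<phi> \<in> ring_hom F K"
  proof (rule ring_hom_memI)
    fix x y assume x: "x \<in> carrier F" and y: "y \<in> carrier F"
    then obtain f g where fg: "x = int_eval F a f" "y = int_eval F a g" using surj by metis
    show "\<phi> x \<in> carrier K" using fg phi b by simp
    have "\<phi> (int_eval F a (f * g)) = int_eval K b (f * g)" by (rule phi)
    then show "\<phi> (x \<otimes>\<^bsub>F\<^esub> y) = \<phi> x \<otimes>\<^bsub>K\<^esub> \<phi> y"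
      using a b fg phi by (simp add: F.int_eval_mult K.int_eval_mult)
    have "\<phi> (int_eval F a (f + g)) = int_eval K b (f + g)" by (rule phi)
    then show "\<phi> (x \<oplus>\<^bsub>F\<^esub> y) = \<phi> x \<oplus>\<^bsub>K\<^esub> \<phi> y"
      using a b fg phi by (simp add: F.int_eval_add K.int_eval_add)
  next
    show "\<phi> \<one>\<^bsub>F\<^esub> = \<one>\<^bsub>K\<^esub>" using phi[of 1] a b by simp
  qed
  interpret h: ring_hom_ring F K \<phi> by (rule ring_hom_ringI2[OF F.ring_axioms K.ring_axioms hom])
  have inj: "inj_on \<phi> (carrier F)"
  proof (rule inj_onI)
    fix x y assume x: "x \<in> carrier F" and y: "y \<in> carrier F" and eq: "\<phi> x = \<phi> y"
    show "x = y"
    proof (rule ccontr)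
      assume "x \<noteq> y"
      define z where "z = x \<ominus>\<^bsub>F\<^esub> y"
      have z: "z \<in> carrier F" "z \<noteq> \<zero>\<^bsub>F\<^esub>" using x y \<open>x \<noteq> y\<close> by (auto simp: z_def)
      have "\<phi> z = \<zero>\<^bsub>K\<^esub>" using x y eq by (simp add: z_def a_minus_def K.r_neg)
      have U: "z \<in> Units F" using z F.field_Units by auto
      have "\<phi> (z \<otimes>\<^bsub>F\<^esub> inv\<^bsub>F\<^esub> z) = \<zero>\<^bsub>K\<^esub>" using z U \<open>\<phi> z = \<zero>\<^bsub>K\<^esub>\<close> by (simp del: F.Units_r_inv)
      then show False using U by simp
    qed
  qed
  have "\<phi> ` carrier F = carrier K"
  proof (rule card_subset_eq[OF K(2)])
    show "\<phi> ` carrier F \<subseteq> carrier K" by auto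
  qed (use card card_image[OF inj] in simp)
  then have "\<phi> \<in> ring_iso F K" using hom inj by (simp add: ring_iso_def bij_betw_def)
  then show ?thesis by (auto simp: is_ring_iso_def)
qed

lemma finite_fields_iso_iff_card:
  fixes F :: "('a, 'm) ring_scheme" and K :: "('b, 'n) ring_scheme"
  assumes F: "field F" "finite (carrier F)" and K: "field K" "finite (carrier K)"
    and card: "card (carrier F) = card (carrier K)"
  shows "F \<simeq> K"
proof -
  obtain p r where p: "prime (p::nat)" "r \<ge> 1" "card (carrier F) = p ^ r"
    and chF: "add_pow F (int p) \<one>\<^bsub>F\<^esub> = \<zero>\<^bsub>F\<^esub>"
    using field.finite_field_order[OF F] by metis
  obtain p' r' where p': "prime (p'::nat)" "r' \<ge> 1" "card (carrier K) = p' ^ r'"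
    and chK: "add_pow K (int p') \<one>\<^bsub>K\<^esub> = \<zero>\<^bsub>K\<^esub>"
    using field.finite_field_order[OF K] by metis
  have "p dvd p' ^ r'" using p p' card by (metis dvd_power not_one_le_zero gr0I)
  then have "p = p'" using p(1) p'(1) prime_dvd_power primes_dvd_imp_eq by metis
  then show ?thesis using finite_field_unique[OF F K card p(1) chF] chK by simp
qed

section \<open>Matrix rings\<close>

lemma (in abelian_monoid) finsum_swap:
  assumes "finite A" "finite B" "\<And>i j. i \<in> A \<Longrightarrow> j \<in> B \<Longrightarrow> f i j \<in> carrier G"
  shows "(\<Oplus>i\<in>A. \<Oplus>j\<in>B. f i j) = (\<Oplus>j\<in>B. \<Oplus>i\<in>A. f i j)"
  using assms(1,3)
proof (induction A rule: finite_induct)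
  case empty
  then show ?case by simp
next
  case (insert a A)
  have "(\<Oplus>j\<in>B. \<Oplus>i\<in>insert a A. f i j) = (\<Oplus>j\<in>B. f a j \<oplus> (\<Oplus>i\<in>A. f i j))"
    using insert by (intro finsum_cong') (auto intro!: finsum_closed)
  also have "\<dots> = (\<Oplus>j\<in>B. f a j) \<oplus> (\<Oplus>j\<in>B. \<Oplus>i\<in>A. f i j)"
    using insert by (intro finsum_addf) (auto intro!: finsum_closed)
  also have "\<dots> = (\<Oplus>i\<in>insert a A. \<Oplus>j\<in>B. f i j)"
    using insert by (subst finsum_insert) (auto intro!: finsum_closed)
  finally show ?case ..
qed

context ring
begin

abbreviation "Mat n \<equiv> mat_ring R n"

lemma mat_carrier: "carrier (Mat n) = ({..<n} \<times> {..<n}) \<rightarrow>\<^sub>E carrier R"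
  by (simp add: mat_ring_def)

lemma mat_entry [simp]: "A \<in> carrier (Mat n) \<Longrightarrow> i < n \<Longrightarrow> j < n \<Longrightarrow> A (i, j) \<in> carrier R"
  by (auto simp: mat_carrier)

lemma mat_eqI:
  assumes "A \<in> carrier (Mat n)" "B \<in> carrier (Mat n)"
    and "\<And>i j. i < n \<Longrightarrow> j < n \<Longrightarrow> A (i, j) = B (i, j)"
  shows "A = B"
  using assms(1,2) unfolding mat_carrier by (rule PiE_ext) (use assms(3) in auto)

lemma mat_add_entry [simp]: "i < n \<Longrightarrow> j < n \<Longrightarrow> (A \<oplus>\<^bsub>Mat n\<^esub> B) (i, j) = A (i, j) \<oplus> B (i, j)"
  by (simp add: mat_ring_def)

lemma mat_mult_entry [simp]:
  "i < n \<Longrightarrow> j < n \<Longrightarrow> (A \<otimes>\<^bsub>Mat n\<^esub> B) (i, j) = (\<Oplus>k\<in>{..<n}. A (i, k) \<otimes> B (k, j))"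
  by (simp add: mat_ring_def)

lemma mat_zero_entry [simp]: "i < n \<Longrightarrow> j < n \<Longrightarrow> \<zero>\<^bsub>Mat n\<^esub> (i, j) = \<zero>"
  by (simp add: mat_ring_def)

lemma mat_one_entry [simp]: "i < n \<Longrightarrow> j < n \<Longrightarrow> \<one>\<^bsub>Mat n\<^esub> (i, j) = (if i = j then \<one> else \<zero>)"
  by (simp add: mat_ring_def)

lemma mat_closed [simp]:
  "A \<in> carrier (Mat n) \<Longrightarrow> B \<in> carrier (Mat n) \<Longrightarrow> A \<oplus>\<^bsub>Mat n\<^esub> B \<in> carrier (Mat n)"
  "A \<in> carrier (Mat n) \<Longrightarrow> B \<in> carrier (Mat n) \<Longrightarrow> A \<otimes>\<^bsub>Mat n\<^esub> B \<in> carrier (Mat n)"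
  "\<zero>\<^bsub>Mat n\<^esub> \<in> carrier (Mat n)" "\<one>\<^bsub>Mat n\<^esub> \<in> carrier (Mat n)"
  by (auto simp: mat_ring_def intro!: finsum_closed)

text \<open>The restriction makes the function undefined outside the index square, as the
  extensional function space in \<open>mat_ring\<close> requires; matrices are then equal as soon as
  their entries are.\<close>

definition mat_of :: "nat \<Rightarrow> (nat \<Rightarrow> nat \<Rightarrow> 'a) \<Rightarrow> nat \<times> nat \<Rightarrow> 'a" where
  "mat_of n f = (\<lambda>(i, j)\<in>{..<n} \<times> {..<n}. f i j)"

lemma mat_of_entry [simp]: "i < n \<Longrightarrow> j < n \<Longrightarrow> mat_of n f (i, j) = f i j"
  by (simp add: mat_of_def)

lemma mat_of_closed: "(\<And>i j. i < n \<Longrightarrow> j < n \<Longrightarrow> f i j \<in> carrier R) \<Longrightarrow> mat_of n f \<in> carrier (Mat n)"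
  by (auto simp: mat_of_def mat_carrier)

lemma finsum_delta:
  assumes "k \<in> A" "finite A" "\<And>l. l \<in> A \<Longrightarrow> l \<noteq> k \<Longrightarrow> f l = \<zero>" "f k \<in> carrier R"
  shows "(\<Oplus>l\<in>A. f l) = f k"
proof -
  have "(\<Oplus>l\<in>A. f l) = (\<Oplus>l\<in>A. if k = l then f l else \<zero>)"
    using assms by (intro finsum_cong') auto
  also have "\<dots> = f k"
  proof -
    have "(\<Oplus>l\<in>A. if k = l then f l else \<zero>) = (\<Oplus>l\<in>A. if k = l then (\<lambda>_. f k) l else \<zero>)"
      using assms by (intro finsum_cong') auto
    also have "\<dots> = f k" using assms by (subst finsum_singleton) auto
    finally show ?thesis .
  qed
  finally show ?thesis .
qed

lemma mat_is_ring: "ring (Mat n)"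
proof (rule ringI)
  show "abelian_group (Mat n)"
  proof (rule abelian_groupI)
    fix A assume A: "A \<in> carrier (Mat n)"
    have "mat_of n (\<lambda>i j. \<ominus> A (i, j)) \<oplus>\<^bsub>Mat n\<^esub> A = \<zero>\<^bsub>Mat n\<^esub>"
      by (rule mat_eqI[where n = n]) (use A in \<open>auto simp: l_neg intro!: mat_of_closed mat_closed\<close>)
    then show "\<exists>B\<in>carrier (Mat n). B \<oplus>\<^bsub>Mat n\<^esub> A = \<zero>\<^bsub>Mat n\<^esub>"
      using A by (intro bexI[of _ "mat_of n (\<lambda>i j. \<ominus> A (i, j))"]) (auto intro!: mat_of_closed)
  qed (auto intro!: mat_eqI[where n = n] simp: a_ac)
  show "monoid (Mat n)"
  proof (rule monoidI)
    fix A B C assume A: "A \<in> carrier (Mat n)" and B: "B \<in> carrier (Mat n)" and C: "C \<in> carrier (Mat n)"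
    show "A \<otimes>\<^bsub>Mat n\<^esub> B \<otimes>\<^bsub>Mat n\<^esub> C = A \<otimes>\<^bsub>Mat n\<^esub> (B \<otimes>\<^bsub>Mat n\<^esub> C)"
    proof (rule mat_eqI[where n = n])
      fix i j assume ij: "i < n" "j < n"
      have "(A \<otimes>\<^bsub>Mat n\<^esub> B \<otimes>\<^bsub>Mat n\<^esub> C) (i, j)
          = (\<Oplus>k\<in>{..<n}. (\<Oplus>l\<in>{..<n}. A (i, l) \<otimes> B (l, k)) \<otimes> C (k, j))"
        using ij A B C by (subst mat_mult_entry) (auto intro!: finsum_cong' finsum_closed)
      also have "\<dots> = (\<Oplus>k\<in>{..<n}. \<Oplus>l\<in>{..<n}. A (i, l) \<otimes> B (l, k) \<otimes> C (k, j))"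
        using ij A B C by (intro finsum_cong' refl) (auto intro!: finsum_closed simp: finsum_ldistr)
      also have "\<dots> = (\<Oplus>l\<in>{..<n}. \<Oplus>k\<in>{..<n}. A (i, l) \<otimes> B (l, k) \<otimes> C (k, j))"
        using ij A B C by (intro finsum_swap) auto
      also have "\<dots> = (\<Oplus>l\<in>{..<n}. A (i, l) \<otimes> (\<Oplus>k\<in>{..<n}. B (l, k) \<otimes> C (k, j)))"
        using ij A B C
      proof (intro finsum_cong' refl)
        fix l assume "l \<in> {..<n}"
        then have l: "l < n" by simp
        show "(\<Oplus>k\<in>{..<n}. A (i, l) \<otimes> B (l, k) \<otimes> C (k, j)) = A (i, l) \<otimes> (\<Oplus>k\<in>{..<n}. B (l, k) \<otimes> C (k, j))"
          using ij A B C l by (subst finsum_rdistr) (auto intro!: finsum_cong' simp: m_assoc)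
      qed (use ij A B C in \<open>auto intro!: finsum_closed\<close>)
      also have "\<dots> = (A \<otimes>\<^bsub>Mat n\<^esub> (B \<otimes>\<^bsub>Mat n\<^esub> C)) (i, j)"
        using ij A B C by (subst mat_mult_entry) (auto intro!: finsum_cong' finsum_closed)
      finally show "(A \<otimes>\<^bsub>Mat n\<^esub> B \<otimes>\<^bsub>Mat n\<^esub> C) (i, j) = (A \<otimes>\<^bsub>Mat n\<^esub> (B \<otimes>\<^bsub>Mat n\<^esub> C)) (i, j)" .
    qed (use A B C in auto)
  next
    fix A assume A: "A \<in> carrier (Mat n)"
    show "\<one>\<^bsub>Mat n\<^esub> \<otimes>\<^bsub>Mat n\<^esub> A = A"
    proof (rule mat_eqI[where n = n])
      fix i j assume ij: "i < n" "j < n"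
      have "(\<Oplus>k\<in>{..<n}. \<one>\<^bsub>Mat n\<^esub> (i, k) \<otimes> A (k, j)) = \<one>\<^bsub>Mat n\<^esub> (i, i) \<otimes> A (i, j)"
        by (rule finsum_delta) (use ij A in auto)
      then show "(\<one>\<^bsub>Mat n\<^esub> \<otimes>\<^bsub>Mat n\<^esub> A) (i, j) = A (i, j)" using ij A by simp
    qed (use A in auto)
    show "A \<otimes>\<^bsub>Mat n\<^esub> \<one>\<^bsub>Mat n\<^esub> = A"
    proof (rule mat_eqI[where n = n])
      fix i j assume ij: "i < n" "j < n"
      have "(\<Oplus>k\<in>{..<n}. A (i, k) \<otimes> \<one>\<^bsub>Mat n\<^esub> (k, j)) = A (i, j) \<otimes> \<one>\<^bsub>Mat n\<^esub> (j, j)"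
        by (rule finsum_delta) (use ij A in auto)
      then show "(A \<otimes>\<^bsub>Mat n\<^esub> \<one>\<^bsub>Mat n\<^esub>) (i, j) = A (i, j)" using ij A by simp
    qed (use A in auto)
  qed auto
next
  fix A B C assume A: "A \<in> carrier (Mat n)" and B: "B \<in> carrier (Mat n)" and C: "C \<in> carrier (Mat n)"
  show "(A \<oplus>\<^bsub>Mat n\<^esub> B) \<otimes>\<^bsub>Mat n\<^esub> C = A \<otimes>\<^bsub>Mat n\<^esub> C \<oplus>\<^bsub>Mat n\<^esub> B \<otimes>\<^bsub>Mat n\<^esub> C"
  proof (rule mat_eqI[where n = n])
    fix i j assume ij: "i < n" "j < n"
    have "(\<Oplus>k\<in>{..<n}. (A \<oplus>\<^bsub>Mat n\<^esub> B) (i, k) \<otimes> C (k, j))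
        = (\<Oplus>k\<in>{..<n}. A (i, k) \<otimes> C (k, j) \<oplus> B (i, k) \<otimes> C (k, j))"
      using ij A B C by (intro finsum_cong') (auto simp: l_distr)
    also have "\<dots> = (\<Oplus>k\<in>{..<n}. A (i, k) \<otimes> C (k, j)) \<oplus> (\<Oplus>k\<in>{..<n}. B (i, k) \<otimes> C (k, j))"
      using ij A B C by (intro finsum_addf) auto
    finally show "((A \<oplus>\<^bsub>Mat n\<^esub> B) \<otimes>\<^bsub>Mat n\<^esub> C) (i, j) = (A \<otimes>\<^bsub>Mat n\<^esub> C \<oplus>\<^bsub>Mat n\<^esub> B \<otimes>\<^bsub>Mat n\<^esub> C) (i, j)"
      using ij by simp
  qed (use A B C in auto)
  show "C \<otimes>\<^bsub>Mat n\<^esub> (A \<oplus>\<^bsub>Mat n\<^esub> B) = C \<otimes>\<^bsub>Mat n\<^esub> A \<oplus>\<^bsub>Mat n\<^esub> C \<otimes>\<^bsub>Mat n\<^esub> B"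
  proof (rule mat_eqI[where n = n])
    fix i j assume ij: "i < n" "j < n"
    have "(\<Oplus>k\<in>{..<n}. C (i, k) \<otimes> (A \<oplus>\<^bsub>Mat n\<^esub> B) (k, j))
        = (\<Oplus>k\<in>{..<n}. C (i, k) \<otimes> A (k, j) \<oplus> C (i, k) \<otimes> B (k, j))"
      using ij A B C by (intro finsum_cong') (auto simp: r_distr)
    also have "\<dots> = (\<Oplus>k\<in>{..<n}. C (i, k) \<otimes> A (k, j)) \<oplus> (\<Oplus>k\<in>{..<n}. C (i, k) \<otimes> B (k, j))"
      using ij A B C by (intro finsum_addf) auto
    finally show "(C \<otimes>\<^bsub>Mat n\<^esub> (A \<oplus>\<^bsub>Mat n\<^esub> B)) (i, j) = (C \<otimes>\<^bsub>Mat n\<^esub> A \<oplus>\<^bsub>Mat n\<^esub> C \<otimes>\<^bsub>Mat n\<^esub> B) (i, j)"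
      using ij by simp
  qed (use A B C in auto)
qed

lemma card_mat: "card (carrier (Mat n)) = card (carrier R) ^ n\<^sup>2"
  unfolding mat_carrier by (subst card_PiE) (auto simp: power2_eq_square card_cartesian_product)

lemma finite_mat: "finite (carrier R) \<Longrightarrow> finite (carrier (Mat n))"
  unfolding mat_carrier by (intro finite_PiE) auto

definition mat_unit :: "nat \<Rightarrow> nat \<Rightarrow> nat \<Rightarrow> 'a \<Rightarrow> nat \<times> nat \<Rightarrow> 'a" where
  "mat_unit n k l c = mat_of n (\<lambda>i j. if i = k \<and> j = l then c else \<zero>)"

lemma mat_unit_closed [simp]: "c \<in> carrier R \<Longrightarrow> mat_unit n k l c \<in> carrier (Mat n)"
  by (auto simp: mat_unit_def intro!: mat_of_closed)

lemma mult_mat_unit_right: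
  assumes "A \<in> carrier (Mat n)" "c \<in> carrier R" "k < n" "i < n" "j < n"
  shows "(A \<otimes>\<^bsub>Mat n\<^esub> mat_unit n k l c) (i, j) = (if j = l then A (i, k) \<otimes> c else \<zero>)"
proof -
  have "(\<Oplus>m\<in>{..<n}. A (i, m) \<otimes> mat_unit n k l c (m, j)) = A (i, k) \<otimes> mat_unit n k l c (k, j)"
    by (rule finsum_delta) (use assms in \<open>auto simp: mat_unit_def\<close>)
  then show ?thesis using assms by (simp add: mat_unit_def)
qed

lemma mult_mat_unit_left:
  assumes "A \<in> carrier (Mat n)" "c \<in> carrier R" "l < n" "i < n" "j < n"
  shows "(mat_unit n k l c \<otimes>\<^bsub>Mat n\<^esub> A) (i, j) = (if i = k then c \<otimes> A (l, j) else \<zero>)"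
proof -
  have "(\<Oplus>m\<in>{..<n}. mat_unit n k l c (i, m) \<otimes> A (m, j)) = mat_unit n k l c (i, l) \<otimes> A (l, j)"
    by (rule finsum_delta) (use assms in \<open>auto simp: mat_unit_def\<close>)
  then show ?thesis using assms by (simp add: mat_unit_def)
qed

end

definition ring_center :: "('a, 'b) ring_scheme \<Rightarrow> 'a set" where
  "ring_center R = {z \<in> carrier R. \<forall>r\<in>carrier R. z \<otimes>\<^bsub>R\<^esub> r = r \<otimes>\<^bsub>R\<^esub> z}"

text \<open>Commuting with the matrix units already forces a scalar matrix. The case n = 0 stands
  apart because there is no entry (0, 0) from which to read off the scalar.\<close>

lemma (in cring) mat_center:
  "ring_center (Mat n) = (\<lambda>c. mat_of n (\<lambda>i j. if i = j then c else \<zero>)) ` carrier R"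
proof (cases "n = 0")
  case True
  have "\<one> \<in> carrier R" by simp
  then show ?thesis unfolding True ring_center_def mat_carrier mat_of_def mat_ring_def
    by (auto intro!: image_eqI[of _ _ "\<one>"])
next
  case n0: False
  show ?thesis
  proof (intro equalityI subsetI)
    fix A assume "A \<in> ring_center (Mat n)"
    then have A: "A \<in> carrier (Mat n)"
      and comm: "\<And>B. B \<in> carrier (Mat n) \<Longrightarrow> A \<otimes>\<^bsub>Mat n\<^esub> B = B \<otimes>\<^bsub>Mat n\<^esub> A"
      by (auto simp: ring_center_def)
    have "A = mat_of n (\<lambda>i j. if i = j then A (0, 0) else \<zero>)"
    proof (rule mat_eqI[where n = n])
      fix i j assume ij: "i < n" "j < n"
      have *: "(if j' = l then A (i', k) \<otimes> \<one> else \<zero>) = (if i' = k then \<one> \<otimes> A (l, j') else \<zero>)"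
        if "i' < n" "j' < n" "k < n" "l < n" for i' j' k l
        using comm[of "mat_unit n k l \<one>"] mult_mat_unit_right[OF A, of \<one> k i' j' l]
          mult_mat_unit_left[OF A, of \<one> l i' j' k] that by simp
      \<comment> \<open>Commuting with \<open>mat_unit n j j \<one>\<close> gives A(i, j) = 0 for i
        \<noteq> j, and commuting with \<open>mat_unit n i 0 \<one>\<close> gives A(i, i) = A(0,
        0).\<close>
      show "A (i, j) = mat_of n (\<lambda>i j. if i = j then A (0, 0) else \<zero>) (i, j)"
        using *[of i j j j] *[of i 0 i 0] *[of 0 0 0 0] *[of i i 0 i] *[of i i i i] *[of 0 i 0 i] ij A n0
        by (auto split: if_splits)
    qed (use A n0 in \<open>auto intro!: mat_of_closed\<close>)
    then show "A \<in> (\<lambda>c. mat_of n (\<lambda>i j. if i = j then c else \<zero>)) ` carrier R" using A n0 by auto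
  next
    fix A assume "A \<in> (\<lambda>c. mat_of n (\<lambda>i j. if i = j then c else \<zero>)) ` carrier R"
    then obtain c where c: "c \<in> carrier R" and Ac: "A = mat_of n (\<lambda>i j. if i = j then c else \<zero>)" by blast
    have A: "A \<in> carrier (Mat n)" unfolding Ac using c by (auto intro!: mat_of_closed)
    have "A \<otimes>\<^bsub>Mat n\<^esub> B = B \<otimes>\<^bsub>Mat n\<^esub> A" if B: "B \<in> carrier (Mat n)" for B
    proof (rule mat_eqI[where n = n])
      fix i j assume ij: "i < n" "j < n"
      have "(\<Oplus>m\<in>{..<n}. A (i, m) \<otimes> B (m, j)) = A (i, i) \<otimes> B (i, j)"
        by (rule finsum_delta) (use ij A B c in \<open>auto simp: Ac\<close>)
      moreover have "(\<Oplus>m\<in>{..<n}. B (i, m) \<otimes> A (m, j)) = B (i, j) \<otimes> A (j, j)"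
        by (rule finsum_delta) (use ij A B c in \<open>auto simp: Ac\<close>)
      ultimately show "(A \<otimes>\<^bsub>Mat n\<^esub> B) (i, j) = (B \<otimes>\<^bsub>Mat n\<^esub> A) (i, j)"
        using ij A B c by (simp add: Ac m_comm)
    qed (use A B in auto)
    then show "A \<in> ring_center (Mat n)" using A by (auto simp: ring_center_def)
  qed
qed

text \<open>The order of the coefficient ring is thus visible in the matrix ring itself; over a
  field it determines n, together with the order of the matrix ring. For n = 0 all scalars give the
  same matrix.\<close>

lemma (in cring) card_mat_center:
  assumes "n \<ge> 1"
  shows "card (ring_center (Mat n)) = card (carrier R)"
  unfolding mat_center
proof (rule card_image, rule inj_onI)
  fix c d assume "mat_of n (\<lambda>i j. if i = j then c else \<zero>) = mat_of n (\<lambda>i j. if i = j then d else \<zero>)"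
  then have "mat_of n (\<lambda>i j. if i = j then c else \<zero>) (0, 0) = mat_of n (\<lambda>i j. if i = j then d else \<zero>) (0, 0)"
    by simp
  then show "c = d" using assms by simp
qed

text \<open>A central idempotent is a scalar c with c^2 = c in a field. For n \<ge> 1 the matrix
  ring therefore has exactly one simple component.\<close>

lemma (in field) mat_central_idempotent:
  assumes "e \<in> ring_center (Mat n)" "e \<otimes>\<^bsub>Mat n\<^esub> e = e"
  shows "e = \<zero>\<^bsub>Mat n\<^esub> \<or> e = \<one>\<^bsub>Mat n\<^esub>"
proof (cases "n = 0")
  case True
  then show ?thesis using assms by (auto simp: ring_center_def mat_ring_def)
next
  case n0: False
  obtain c where c: "c \<in> carrier R" and e: "e = mat_of n (\<lambda>i j. if i = j then c else \<zero>)"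
    using assms(1) unfolding mat_center by blast
  have "(e \<otimes>\<^bsub>Mat n\<^esub> e) (0, 0) = (\<Oplus>m\<in>{..<n}. e (0, m) \<otimes> e (m, 0))" using n0 by simp
  also have "\<dots> = e (0, 0) \<otimes> e (0, 0)" by (rule finsum_delta) (use n0 c in \<open>auto simp: e\<close>)
  finally have "e (0, 0) \<otimes> e (0, 0) = e (0, 0)" unfolding assms(2) ..
  then have "c \<otimes> c = c \<otimes> \<one>" using n0 c by (simp add: e)
  then have "c = \<zero> \<or> c = \<one>" using c m_lcancel[of c c \<one>] by auto
  moreover have "e = \<zero>\<^bsub>Mat n\<^esub>" if "c = \<zero>"
    by (rule mat_eqI[where n = n]) (use that c in \<open>auto simp: e intro!: mat_of_closed\<close>)
  moreover have "e = \<one>\<^bsub>Mat n\<^esub>" if "c = \<one>"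
    by (rule mat_eqI[where n = n]) (use that c in \<open>auto simp: e intro!: mat_of_closed\<close>)
  ultimately show ?thesis by blast
qed

lemma (in ring) mat_one_not_zero:
  assumes "\<one> \<noteq> \<zero>" "n \<ge> 1"
  shows "\<one>\<^bsub>Mat n\<^esub> \<noteq> \<zero>\<^bsub>Mat n\<^esub>"
proof
  assume "\<one>\<^bsub>Mat n\<^esub> = \<zero>\<^bsub>Mat n\<^esub>"
  then have "\<one>\<^bsub>Mat n\<^esub> (0, 0) = \<zero>\<^bsub>Mat n\<^esub> (0, 0)" by simp
  then show False using assms by simp
qed

lemma mat_ring_iso:
  fixes F :: "('a, 'm) ring_scheme" and K :: "('b, 'n) ring_scheme"
  assumes F: "ring F" and K: "ring K" and iso: "F \<simeq> K"
  shows "mat_ring F n \<simeq> mat_ring K n"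
proof -
  interpret F: ring F by (rule F)
  interpret K: ring K by (rule K)
  obtain h where h: "h \<in> ring_iso F K" using iso by (auto simp: is_ring_iso_def)
  then have hom: "h \<in> ring_hom F K" and bij: "bij_betw h (carrier F) (carrier K)"
    by (auto simp: ring_iso_def)
  interpret h: ring_hom_ring F K h by (rule ring_hom_ringI2[OF F K hom])
  define H where "H = (\<lambda>A. K.mat_of n (\<lambda>i j. h (A (i, j))))"
  have H: "H A \<in> carrier (mat_ring K n)" if "A \<in> carrier (mat_ring F n)" for A
    unfolding H_def using that by (auto intro!: K.mat_of_closed)
  have He [simp]: "H A (i, j) = h (A (i, j))" if "i < n" "j < n" for A i j
    using that by (simp add: H_def)
  have "H \<in> ring_iso (mat_ring F n) (mat_ring K n)"
  proof (rule ring_iso_memI)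
    fix A B assume A: "A \<in> carrier (mat_ring F n)" and B: "B \<in> carrier (mat_ring F n)"
    show "H (A \<otimes>\<^bsub>mat_ring F n\<^esub> B) = H A \<otimes>\<^bsub>mat_ring K n\<^esub> H B"
    proof (rule K.mat_eqI[where n = n])
      fix i j assume ij: "i < n" "j < n"
      have "h (\<Oplus>\<^bsub>F\<^esub>k\<in>{..<n}. A (i, k) \<otimes>\<^bsub>F\<^esub> B (k, j)) = (\<Oplus>\<^bsub>K\<^esub>k\<in>{..<n}. h (A (i, k) \<otimes>\<^bsub>F\<^esub> B (k, j)))"
        using ij A B by (subst h.hom_finsum) (auto simp: comp_def)
      also have "\<dots> = (\<Oplus>\<^bsub>K\<^esub>k\<in>{..<n}. H A (i, k) \<otimes>\<^bsub>K\<^esub> H B (k, j))"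
        using ij A B by (intro K.finsum_cong') auto
      finally show "H (A \<otimes>\<^bsub>mat_ring F n\<^esub> B) (i, j) = (H A \<otimes>\<^bsub>mat_ring K n\<^esub> H B) (i, j)"
        using ij A B by simp
    qed (use A B H in auto)
    show "H (A \<oplus>\<^bsub>mat_ring F n\<^esub> B) = H A \<oplus>\<^bsub>mat_ring K n\<^esub> H B"
      by (rule K.mat_eqI[where n = n]) (use A B H in auto)
  next
    show "H \<one>\<^bsub>mat_ring F n\<^esub> = \<one>\<^bsub>mat_ring K n\<^esub>"
      by (rule K.mat_eqI[where n = n]) (use H in auto)
    show "bij_betw H (carrier (mat_ring F n)) (carrier (mat_ring K n))"
    proof (rule bij_betw_byWitness[where f' = "\<lambda>B. F.mat_of n (\<lambda>i j. inv_into (carrier F) h (B (i, j)))"])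
      show "\<forall>A\<in>carrier (mat_ring F n). F.mat_of n (\<lambda>i j. inv_into (carrier F) h (H A (i, j))) = A"
        using bij by (auto intro!: F.mat_eqI[where n = n] F.mat_of_closed simp: bij_betw_def)
      have inv: "inv_into (carrier F) h y \<in> carrier F" "h (inv_into (carrier F) h y) = y" if "y \<in> carrier K" for y
        using that bij by (auto simp: bij_betw_def inv_into_into f_inv_into_f)
      then show "\<forall>B\<in>carrier (mat_ring K n). H (F.mat_of n (\<lambda>i j. inv_into (carrier F) h (B (i, j)))) = B"
        by (auto intro!: K.mat_eqI[where n = n] H F.mat_of_closed)
      show "(\<lambda>B. F.mat_of n (\<lambda>i j. inv_into (carrier F) h (B (i, j)))) ` carrier (mat_ring K n) \<subseteq> carrier (mat_ring F n)"
        using inv by (auto intro!: F.mat_of_closed)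
    qed (use H in auto)
  qed (use H in auto)
  then show ?thesis by (auto simp: is_ring_iso_def)
qed

section \<open>Semisimplicity\<close>

text \<open>Closure under negation comes from multiplication by -1, so the subgroup condition
  reduces to sums and zero.\<close>

lemma (in ring) left_ideal_iff:
  "left_ideal L R \<longleftrightarrow> L \<subseteq> carrier R \<and> \<zero> \<in> L \<and> (\<forall>a\<in>L. \<forall>b\<in>L. a \<oplus> b \<in> L) \<and>
     (\<forall>r\<in>carrier R. \<forall>a\<in>L. r \<otimes> a \<in> L)" (is "?l \<longleftrightarrow> ?r")
proof
  assume ?l
  then have add: "additive_subgroup L R" and m: "\<forall>r\<in>carrier R. \<forall>a\<in>L. r \<otimes> a \<in> L"
    by (auto simp: left_ideal_def)
  interpret additive_subgroup L R by (rule add)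
  show ?r using m a_subset by auto
next
  assume r: ?r
  have "subgroup L (add_monoid R)"
  proof (rule add.subgroupI)
    fix a assume a: "a \<in> L"
    then have "(\<ominus> \<one>) \<otimes> a \<in> L" "a \<in> carrier R" using r by auto
    then show "\<ominus> a \<in> L" by (simp add: l_minus)
  qed (use r in auto)
  then show ?l using r by (auto simp: left_ideal_def intro: additive_subgroupI)
qed

lemma set_add_memI: "a \<in> A \<Longrightarrow> b \<in> B \<Longrightarrow> a \<oplus>\<^bsub>R\<^esub> b \<in> A <+>\<^bsub>R\<^esub> B"
  unfolding set_add_def' by blast

text \<open>Left ideals of S are pulled back along the isomorphism, complemented in R, and the
  complement is mapped forward.\<close>

lemma semisimple_ring_iso:
  assumes R: "semisimple_ring R" and S: "ring S" and iso: "R \<simeq> S"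
  shows "semisimple_ring S"
proof -
  interpret S: ring S by (rule S)
  have rR: "ring R" using R by (simp add: semisimple_ring_def)
  interpret R: ring R by (rule rR)
  obtain h where h: "h \<in> ring_iso R S" using iso by (auto simp: is_ring_iso_def)
  then have hom: "h \<in> ring_hom R S" and inj: "inj_on h (carrier R)" and im: "h ` carrier R = carrier S"
    by (auto simp: ring_iso_def bij_betw_def)
  interpret h: ring_hom_ring R S h by (rule ring_hom_ringI2[OF rR S hom])
  show ?thesis unfolding semisimple_ring_def
  proof (intro conjI allI impI S)
    fix L assume L: "left_ideal L S"
    then have L': "L \<subseteq> carrier S" "\<zero>\<^bsub>S\<^esub> \<in> L" "\<And>a b. a \<in> L \<Longrightarrow> b \<in> L \<Longrightarrow> a \<oplus>\<^bsub>S\<^esub> b \<in> L"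
      "\<And>r a. r \<in> carrier S \<Longrightarrow> a \<in> L \<Longrightarrow> r \<otimes>\<^bsub>S\<^esub> a \<in> L"
      unfolding S.left_ideal_iff by auto
    have "left_ideal {a \<in> carrier R. h a \<in> L} R"
      unfolding R.left_ideal_iff using L' by auto
    then obtain M where M: "left_ideal M R" and sum: "{a \<in> carrier R. h a \<in> L} <+>\<^bsub>R\<^esub> M = carrier R"
      and int: "{a \<in> carrier R. h a \<in> L} \<inter> M = {\<zero>\<^bsub>R\<^esub>}"
      using R unfolding semisimple_ring_def by blast
    have M': "M \<subseteq> carrier R" "\<zero>\<^bsub>R\<^esub> \<in> M" "\<And>a b. a \<in> M \<Longrightarrow> b \<in> M \<Longrightarrow> a \<oplus>\<^bsub>R\<^esub> b \<in> M"
      "\<And>r a. r \<in> carrier R \<Longrightarrow> a \<in> M \<Longrightarrow> r \<otimes>\<^bsub>R\<^esub> a \<in> M"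
      using M unfolding R.left_ideal_iff by auto
    have "left_ideal (h ` M) S" unfolding S.left_ideal_iff
    proof (intro conjI ballI)
      show "h ` M \<subseteq> carrier S" using M'(1) by auto
      show "\<zero>\<^bsub>S\<^esub> \<in> h ` M" using M'(2) h.hom_zero by (metis imageI)
    next
      fix x y assume "x \<in> h ` M" "y \<in> h ` M"
      then obtain a b where ab: "a \<in> M" "b \<in> M" "x = h a" "y = h b" by blast
      then have "x \<oplus>\<^bsub>S\<^esub> y = h (a \<oplus>\<^bsub>R\<^esub> b)" using M'(1) by (simp add: subset_iff)
      then show "x \<oplus>\<^bsub>S\<^esub> y \<in> h ` M" using M'(3)[OF ab(1,2)] by simp
    next
      fix r x assume r: "r \<in> carrier S" and "x \<in> h ` M"
      then obtain a where a: "a \<in> M" "x = h a" by blast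
      obtain s where s: "s \<in> carrier R" "r = h s" using r im by blast
      have "r \<otimes>\<^bsub>S\<^esub> x = h (s \<otimes>\<^bsub>R\<^esub> a)" using a s M'(1) by (simp add: subset_iff)
      then show "r \<otimes>\<^bsub>S\<^esub> x \<in> h ` M" using M'(4)[OF s(1) a(1)] by simp
    qed
    moreover have "L <+>\<^bsub>S\<^esub> h ` M = carrier S"
    proof (intro equalityI subsetI)
      fix x assume "x \<in> L <+>\<^bsub>S\<^esub> h ` M"
      then show "x \<in> carrier S" using L'(1) M'(1) unfolding set_add_def' by (auto simp: subset_iff)
    next
      fix x assume "x \<in> carrier S"
      then obtain a where a: "a \<in> carrier R" "x = h a" using im by blast
      then obtain l m where lm: "l \<in> carrier R" "h l \<in> L" "m \<in> M" "a = l \<oplus>\<^bsub>R\<^esub> m"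
        using sum unfolding set_add_def' by blast
      then have "x = h l \<oplus>\<^bsub>S\<^esub> h m" using a M'(1) by (simp add: subset_iff)
      then show "x \<in> L <+>\<^bsub>S\<^esub> h ` M" using lm unfolding set_add_def' by blast
    qed
    moreover have "L \<inter> h ` M = {\<zero>\<^bsub>S\<^esub>}"
    proof -
      have "x = \<zero>\<^bsub>S\<^esub>" if "x \<in> L" "x \<in> h ` M" for x
      proof -
        obtain m where m: "m \<in> M" "x = h m" using \<open>x \<in> h ` M\<close> by blast
        then have "m \<in> {a \<in> carrier R. h a \<in> L} \<inter> M" using that M'(1) by auto
        then have "m = \<zero>\<^bsub>R\<^esub>" using int by blast
        then show ?thesis using m by simp
      qed
      then show ?thesis using L'(2) calculation(1) unfolding S.left_ideal_iff by blast
    qed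
    ultimately show "\<exists>L'. left_ideal L' S \<and> L <+>\<^bsub>S\<^esub> L' = carrier S \<and> L \<inter> L' = {\<zero>\<^bsub>S\<^esub>}" by blast
  qed
qed

lemma RDirProd_simps [simp]:
  "carrier (RDirProd R S) = carrier R \<times> carrier S"
  "(a, b) \<otimes>\<^bsub>RDirProd R S\<^esub> (c, d) = (a \<otimes>\<^bsub>R\<^esub> c, b \<otimes>\<^bsub>S\<^esub> d)"
  "(a, b) \<oplus>\<^bsub>RDirProd R S\<^esub> (c, d) = (a \<oplus>\<^bsub>R\<^esub> c, b \<oplus>\<^bsub>S\<^esub> d)"
  "\<zero>\<^bsub>RDirProd R S\<^esub> = (\<zero>\<^bsub>R\<^esub>, \<zero>\<^bsub>S\<^esub>)" "\<one>\<^bsub>RDirProd R S\<^esub> = (\<one>\<^bsub>R\<^esub>, \<one>\<^bsub>S\<^esub>)"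
  by (auto simp: RDirProd_def DirProd_def monoid.defs)

text \<open>Multiplication by (1, 0) and (0, 1) shows that every left ideal of the product is itself
  a product of left ideals A and B, so complements can be taken in each factor.\<close>

lemma semisimple_RDirProd:
  assumes R: "semisimple_ring R" and S: "semisimple_ring S"
  shows "semisimple_ring (RDirProd R S)"
proof -
  have rR: "ring R" and rS: "ring S" using R S by (auto simp: semisimple_ring_def)
  interpret R: ring R by (rule rR)
  interpret S: ring S by (rule rS)
  interpret P: ring "RDirProd R S" by (rule RDirProd_ring[OF rR rS])
  show ?thesis unfolding semisimple_ring_def
  proof (intro conjI allI impI P.ring_axioms)
    fix L assume L0: "left_ideal L (RDirProd R S)"
    have L: "L \<subseteq> carrier R \<times> carrier S" "(\<zero>\<^bsub>R\<^esub>, \<zero>\<^bsub>S\<^esub>) \<in> L"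
      "\<And>a b. a \<in> L \<Longrightarrow> b \<in> L \<Longrightarrow> a \<oplus>\<^bsub>RDirProd R S\<^esub> b \<in> L"
      "\<And>r a. r \<in> carrier R \<times> carrier S \<Longrightarrow> a \<in> L \<Longrightarrow> r \<otimes>\<^bsub>RDirProd R S\<^esub> a \<in> L"
      using L0[unfolded P.left_ideal_iff RDirProd_simps] by blast+
    define A where "A = fst ` L"
    define B where "B = snd ` L"
    have A1: "(a, \<zero>\<^bsub>S\<^esub>) \<in> L" "a \<in> carrier R" if "a \<in> A" for a
    proof -
      obtain b where ab: "(a, b) \<in> L" using \<open>a \<in> A\<close> by (force simp: A_def)
      then show "a \<in> carrier R" using L(1) by auto
      show "(a, \<zero>\<^bsub>S\<^esub>) \<in> L" using L(4)[of "(\<one>\<^bsub>R\<^esub>, \<zero>\<^bsub>S\<^esub>)", OF _ ab] ab L(1) by auto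
    qed
    have B1: "(\<zero>\<^bsub>R\<^esub>, b) \<in> L" "b \<in> carrier S" if "b \<in> B" for b
    proof -
      obtain a where ab: "(a, b) \<in> L" using \<open>b \<in> B\<close> by (force simp: B_def)
      then show "b \<in> carrier S" using L(1) by auto
      show "(\<zero>\<^bsub>R\<^esub>, b) \<in> L" using L(4)[of "(\<zero>\<^bsub>R\<^esub>, \<one>\<^bsub>S\<^esub>)", OF _ ab] ab L(1) by auto
    qed
    have LAB: "L = A \<times> B"
    proof (intro equalityI subsetI)
      fix x assume "x \<in> L" then show "x \<in> A \<times> B" by (auto simp: A_def B_def mem_Times_iff)
    next
      fix x assume "x \<in> A \<times> B"
      then obtain a b where x: "x = (a, b)" "a \<in> A" "b \<in> B" by auto
      then show "x \<in> L" using L(3)[OF A1(1)[OF x(2)] B1(1)[OF x(3)]] A1(2)[OF x(2)] B1(2)[OF x(3)] by simp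
    qed
    have "left_ideal A R" unfolding R.left_ideal_iff
    proof (intro conjI ballI)
      show "\<zero>\<^bsub>R\<^esub> \<in> A" using L(2) by (force simp: A_def)
      fix a b assume "a \<in> A" "b \<in> A"
      then have "(a \<oplus>\<^bsub>R\<^esub> b, \<zero>\<^bsub>S\<^esub> \<oplus>\<^bsub>S\<^esub> \<zero>\<^bsub>S\<^esub>) \<in> L" using L(3)[OF A1(1) A1(1)] by simp
      then show "a \<oplus>\<^bsub>R\<^esub> b \<in> A" by (force simp: A_def)
    next
      fix r a assume "r \<in> carrier R" "a \<in> A"
      then have "(r \<otimes>\<^bsub>R\<^esub> a, \<zero>\<^bsub>S\<^esub> \<otimes>\<^bsub>S\<^esub> \<zero>\<^bsub>S\<^esub>) \<in> L" using L(4)[of "(r, \<zero>\<^bsub>S\<^esub>)", OF _ A1(1)] by simp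
      then show "r \<otimes>\<^bsub>R\<^esub> a \<in> A" by (force simp: A_def)
    qed (use A1 in auto)
    then obtain A' where A': "left_ideal A' R" "A <+>\<^bsub>R\<^esub> A' = carrier R" "A \<inter> A' = {\<zero>\<^bsub>R\<^esub>}"
      using R unfolding semisimple_ring_def by blast
    have "left_ideal B S" unfolding S.left_ideal_iff
    proof (intro conjI ballI)
      show "\<zero>\<^bsub>S\<^esub> \<in> B" using L(2) by (force simp: B_def)
      fix a b assume "a \<in> B" "b \<in> B"
      then have "(\<zero>\<^bsub>R\<^esub> \<oplus>\<^bsub>R\<^esub> \<zero>\<^bsub>R\<^esub>, a \<oplus>\<^bsub>S\<^esub> b) \<in> L" using L(3)[OF B1(1) B1(1)] by simp
      then show "a \<oplus>\<^bsub>S\<^esub> b \<in> B" by (force simp: B_def)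
    next
      fix r a assume "r \<in> carrier S" "a \<in> B"
      then have "(\<zero>\<^bsub>R\<^esub> \<otimes>\<^bsub>R\<^esub> \<zero>\<^bsub>R\<^esub>, r \<otimes>\<^bsub>S\<^esub> a) \<in> L" using L(4)[of "(\<zero>\<^bsub>R\<^esub>, r)", OF _ B1(1)] by simp
      then show "r \<otimes>\<^bsub>S\<^esub> a \<in> B" by (force simp: B_def)
    qed (use B1 in auto)
    then obtain B' where B': "left_ideal B' S" "B <+>\<^bsub>S\<^esub> B' = carrier S" "B \<inter> B' = {\<zero>\<^bsub>S\<^esub>}"
      using S unfolding semisimple_ring_def by blast
    have "left_ideal (A' \<times> B') (RDirProd R S)"
      using A'(1) B'(1) unfolding P.left_ideal_iff R.left_ideal_iff S.left_ideal_iff by auto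
    moreover have "L <+>\<^bsub>RDirProd R S\<^esub> (A' \<times> B') = carrier (RDirProd R S)"
    proof -
      have "L <+>\<^bsub>RDirProd R S\<^esub> (A' \<times> B') = (A <+>\<^bsub>R\<^esub> A') \<times> (B <+>\<^bsub>S\<^esub> B')"
      proof (intro equalityI subsetI)
        fix x assume "x \<in> L <+>\<^bsub>RDirProd R S\<^esub> (A' \<times> B')"
        then obtain a b a' b' where "a \<in> A" "b \<in> B" "a' \<in> A'" "b' \<in> B'"
          "x = (a \<oplus>\<^bsub>R\<^esub> a', b \<oplus>\<^bsub>S\<^esub> b')" unfolding LAB set_add_def' by auto
        then show "x \<in> (A <+>\<^bsub>R\<^esub> A') \<times> (B <+>\<^bsub>S\<^esub> B')" unfolding set_add_def' by blast
      next
        fix x assume "x \<in> (A <+>\<^bsub>R\<^esub> A') \<times> (B <+>\<^bsub>S\<^esub> B')"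
        then obtain a b a' b' where *: "a \<in> A" "b \<in> B" "a' \<in> A'" "b' \<in> B'"
          "x = (a \<oplus>\<^bsub>R\<^esub> a', b \<oplus>\<^bsub>S\<^esub> b')" unfolding set_add_def' by blast
        then have "x = (a, b) \<oplus>\<^bsub>RDirProd R S\<^esub> (a', b')" by simp
        moreover have "(a, b) \<in> L" "(a', b') \<in> A' \<times> B'" using * by (auto simp: LAB)
        ultimately show "x \<in> L <+>\<^bsub>RDirProd R S\<^esub> (A' \<times> B')" unfolding set_add_def' by blast
      qed
      then show ?thesis using A'(2) B'(2) by simp
    qed
    moreover have "L \<inter> (A' \<times> B') = {\<zero>\<^bsub>RDirProd R S\<^esub>}"
      using A'(3) B'(3) unfolding LAB by auto
    ultimately show "\<exists>L'. left_ideal L' (RDirProd R S) \<and> L <+>\<^bsub>RDirProd R S\<^esub> L' = carrier (RDirProd R S)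
        \<and> L \<inter> L' = {\<zero>\<^bsub>RDirProd R S\<^esub>}" by blast
  qed
qed

lemma ring_nil_ring: "ring nil_ring"
  using RDirProd_list_is_ring[of "[]"] by simp

lemma semisimple_nil_ring: "semisimple_ring nil_ring"
proof -
  interpret ring nil_ring by (rule ring_nil_ring)
  show ?thesis unfolding semisimple_ring_def
  proof (intro conjI allI impI ring_nil_ring)
    fix L assume "left_ideal L (nil_ring :: 'a list ring)"
    then have L: "L = {[]}" unfolding left_ideal_iff by auto
    have s: "{[]} <+>\<^bsub>nil_ring\<^esub> {[]} = {[] :: 'a list}" unfolding set_add_def'
      by (auto simp: monoid.defs)
    have l: "left_ideal {[]} (nil_ring :: 'a list ring)"
      unfolding left_ideal_iff by (auto simp: monoid.defs)
    have z: "\<zero>\<^bsub>nil_ring\<^esub> = ([] :: 'a list)" by (simp add: monoid.defs)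
    show "\<exists>L'. left_ideal L' nil_ring \<and> L <+>\<^bsub>nil_ring\<^esub> L' = carrier nil_ring \<and>
        L \<inter> L' = {\<zero>\<^bsub>nil_ring\<^esub>}"
      by (rule exI[of _ "{[]}"]) (simp only: L s l z nil_ring_simprules Int_absorb simp_thms)
  qed
qed

text \<open>Some entry of A in column k, say in row i, is invertible. The matrix C whose only
  nonzero column is the i-th copies row i of A into all rows with prescribed factors, so B = C A. In
  other words, the matrices supported in one column form a minimal left ideal.\<close>

lemma (in field) left_ideal_mat_column:
  assumes L: "left_ideal L (Mat n)" and A: "A \<in> L" "A \<noteq> \<zero>\<^bsub>Mat n\<^esub>" and k: "k < n"
    and Acol: "\<And>i j. i < n \<Longrightarrow> j < n \<Longrightarrow> j \<noteq> k \<Longrightarrow> A (i, j) = \<zero>"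
    and B: "B \<in> carrier (Mat n)" and Bcol: "\<And>i j. i < n \<Longrightarrow> j < n \<Longrightarrow> j \<noteq> k \<Longrightarrow> B (i, j) = \<zero>"
  shows "B \<in> L"
proof -
  interpret M: ring "Mat n" by (rule mat_is_ring)
  have Ac: "A \<in> carrier (Mat n)" using L A unfolding M.left_ideal_iff by auto
  have "\<exists>i<n. A (i, k) \<noteq> \<zero>"
  proof (rule ccontr)
    assume "\<not> ?thesis"
    then have "A (i, j) = \<zero>" if "i < n" "j < n" for i j
      using Acol that by (cases "j = k") auto
    then have "A = \<zero>\<^bsub>Mat n\<^esub>"
      using Ac by (intro mat_eqI[where n = n]) auto
    then show False using A by simp
  qed
  then obtain i where i: "i < n" "A (i, k) \<noteq> \<zero>" by blast
  have U: "A (i, k) \<in> Units R" using i k Ac field_Units by auto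
  define C where "C = mat_of n (\<lambda>r l. if l = i then B (r, k) \<otimes> inv (A (i, k)) else \<zero>)"
  have C: "C \<in> carrier (Mat n)" unfolding C_def using B k U by (auto intro!: mat_of_closed)
  have "B = C \<otimes>\<^bsub>Mat n\<^esub> A"
  proof (rule mat_eqI[where n = n])
    fix r j assume rj: "r < n" "j < n"
    have "(\<Oplus>l\<in>{..<n}. C (r, l) \<otimes> A (l, j)) = C (r, i) \<otimes> A (i, j)"
    proof (rule finsum_delta)
      fix l assume l: "l \<in> {..<n}" "l \<noteq> i"
      then have "C (r, l) = \<zero>" using rj by (simp add: C_def)
      then show "C (r, l) \<otimes> A (l, j) = \<zero>" using l rj Ac by simp
    qed (use rj i C Ac in auto)
    also have "\<dots> = B (r, j)"
    proof (cases "j = k")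
      case True
      have "B (r, k) \<otimes> inv (A (i, k)) \<otimes> A (i, k) = B (r, k)"
        using m_assoc[of "B (r, k)" "inv (A (i, k))" "A (i, k)"] Units_l_inv[OF U]
          Units_inv_closed[OF U] Units_closed[OF U] mat_entry[OF B rj(1) k] by simp
      then show ?thesis using rj i True by (simp add: C_def)
    next
      case False
      then show ?thesis using rj i C Acol Bcol by simp
    qed
    finally show "B (r, j) = (C \<otimes>\<^bsub>Mat n\<^esub> A) (r, j)" using rj by simp
  qed (use B C Ac in auto)
  then show ?thesis using L C A unfolding M.left_ideal_iff by auto
qed

lemma (in field) semisimple_mat:
  assumes fin: "finite (carrier R)"
  shows "semisimple_ring (Mat n)"
  unfolding semisimple_ring_def
proof (intro conjI allI impI mat_is_ring)
  interpret M: ring "Mat n" by (rule mat_is_ring)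
  fix L assume L: "left_ideal L (Mat n)"
  then have Ls: "L \<subseteq> carrier (Mat n)" "\<zero>\<^bsub>Mat n\<^esub> \<in> L" "\<And>a b. a \<in> L \<Longrightarrow> b \<in> L \<Longrightarrow> a \<oplus>\<^bsub>Mat n\<^esub> b \<in> L"
    "\<And>r a. r \<in> carrier (Mat n) \<Longrightarrow> a \<in> L \<Longrightarrow> r \<otimes>\<^bsub>Mat n\<^esub> a \<in> L"
    unfolding M.left_ideal_iff by auto
  \<comment> \<open>A left ideal \<open>N\<close> maximal with \<open>L \<inter> N = 0\<close> is a complement: otherwise some column ideal is not
    contained in \<open>L + N\<close> and, being minimal, could be added to \<open>N\<close>.\<close>
  define C where "C = {N. left_ideal N (Mat n) \<and> L \<inter> N = {\<zero>\<^bsub>Mat n\<^esub>}}"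
  have "left_ideal {\<zero>\<^bsub>Mat n\<^esub>} (Mat n)" unfolding M.left_ideal_iff by auto
  then have ne: "{\<zero>\<^bsub>Mat n\<^esub>} \<in> C" using Ls(2) by (auto simp: C_def)
  have "C \<subseteq> Pow (carrier (Mat n))" unfolding C_def M.left_ideal_iff by auto
  then have "finite C" using finite_mat[OF fin] finite_subset by blast
  have "Max (card ` C) \<in> card ` C" using ne \<open>finite C\<close> by (intro Max_in) auto
  then obtain N where N: "N \<in> C" and "card N = Max (card ` C)" by force
  then have max: "\<And>N'. N' \<in> C \<Longrightarrow> card N' \<le> card N" using \<open>finite C\<close> by simp
  have Nl: "left_ideal N (Mat n)" and LN: "L \<inter> N = {\<zero>\<^bsub>Mat n\<^esub>}" using N by (auto simp: C_def)
  have Ns: "N \<subseteq> carrier (Mat n)" "\<zero>\<^bsub>Mat n\<^esub> \<in> N" "\<And>a b. a \<in> N \<Longrightarrow> b \<in> N \<Longrightarrow> a \<oplus>\<^bsub>Mat n\<^esub> b \<in> N"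
    "\<And>r a. r \<in> carrier (Mat n) \<Longrightarrow> a \<in> N \<Longrightarrow> r \<otimes>\<^bsub>Mat n\<^esub> a \<in> N"
    using Nl unfolding M.left_ideal_iff by auto
  have sum_ideal: "left_ideal (I <+>\<^bsub>Mat n\<^esub> J) (Mat n)" if I: "left_ideal I (Mat n)" and J: "left_ideal J (Mat n)" for I J
    unfolding M.left_ideal_iff
  proof (intro conjI ballI)
    have Is: "I \<subseteq> carrier (Mat n)" "\<zero>\<^bsub>Mat n\<^esub> \<in> I" "\<And>a b. a \<in> I \<Longrightarrow> b \<in> I \<Longrightarrow> a \<oplus>\<^bsub>Mat n\<^esub> b \<in> I"
      "\<And>r a. r \<in> carrier (Mat n) \<Longrightarrow> a \<in> I \<Longrightarrow> r \<otimes>\<^bsub>Mat n\<^esub> a \<in> I"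
      and Js: "J \<subseteq> carrier (Mat n)" "\<zero>\<^bsub>Mat n\<^esub> \<in> J" "\<And>a b. a \<in> J \<Longrightarrow> b \<in> J \<Longrightarrow> a \<oplus>\<^bsub>Mat n\<^esub> b \<in> J"
      "\<And>r a. r \<in> carrier (Mat n) \<Longrightarrow> a \<in> J \<Longrightarrow> r \<otimes>\<^bsub>Mat n\<^esub> a \<in> J"
      using I J unfolding M.left_ideal_iff by auto
    show "I <+>\<^bsub>Mat n\<^esub> J \<subseteq> carrier (Mat n)" using Is(1) Js(1) unfolding set_add_def' by auto
    show "\<zero>\<^bsub>Mat n\<^esub> \<in> I <+>\<^bsub>Mat n\<^esub> J" unfolding set_add_def' using Is(2) Js(2) by fastforce
    fix x y assume "x \<in> I <+>\<^bsub>Mat n\<^esub> J" "y \<in> I <+>\<^bsub>Mat n\<^esub> J"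
    then obtain a b c d where *: "a \<in> I" "b \<in> J" "c \<in> I" "d \<in> J" "x = a \<oplus>\<^bsub>Mat n\<^esub> b" "y = c \<oplus>\<^bsub>Mat n\<^esub> d"
      unfolding set_add_def' by blast
    then have "x \<oplus>\<^bsub>Mat n\<^esub> y = (a \<oplus>\<^bsub>Mat n\<^esub> c) \<oplus>\<^bsub>Mat n\<^esub> (b \<oplus>\<^bsub>Mat n\<^esub> d)"
      using Is(1) Js(1) by (simp add: subset_iff M.add.m_ac)
    then show "x \<oplus>\<^bsub>Mat n\<^esub> y \<in> I <+>\<^bsub>Mat n\<^esub> J"
      using set_add_memI[OF Is(3)[OF *(1,3)] Js(3)[OF *(2,4)]] by simp
  next
    have Is: "I \<subseteq> carrier (Mat n)" "\<And>r a. r \<in> carrier (Mat n) \<Longrightarrow> a \<in> I \<Longrightarrow> r \<otimes>\<^bsub>Mat n\<^esub> a \<in> I"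
      and Js: "J \<subseteq> carrier (Mat n)" "\<And>r a. r \<in> carrier (Mat n) \<Longrightarrow> a \<in> J \<Longrightarrow> r \<otimes>\<^bsub>Mat n\<^esub> a \<in> J"
      using I J unfolding M.left_ideal_iff by auto
    fix r x assume r: "r \<in> carrier (Mat n)" and "x \<in> I <+>\<^bsub>Mat n\<^esub> J"
    then obtain a b where *: "a \<in> I" "b \<in> J" "x = a \<oplus>\<^bsub>Mat n\<^esub> b" unfolding set_add_def' by blast
    then have "r \<otimes>\<^bsub>Mat n\<^esub> x = (r \<otimes>\<^bsub>Mat n\<^esub> a) \<oplus>\<^bsub>Mat n\<^esub> (r \<otimes>\<^bsub>Mat n\<^esub> b)"
      using r Is(1) Js(1) by (simp add: subset_iff M.r_distr)
    then show "r \<otimes>\<^bsub>Mat n\<^esub> x \<in> I <+>\<^bsub>Mat n\<^esub> J"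
      using set_add_memI[OF Is(2)[OF r *(1)] Js(2)[OF r *(2)]] by simp
  qed
  have S: "left_ideal (L <+>\<^bsub>Mat n\<^esub> N) (Mat n)" by (rule sum_ideal[OF L Nl])
  have S_add: "\<And>a b. a \<in> L <+>\<^bsub>Mat n\<^esub> N \<Longrightarrow> b \<in> L <+>\<^bsub>Mat n\<^esub> N \<Longrightarrow> a \<oplus>\<^bsub>Mat n\<^esub> b \<in> L <+>\<^bsub>Mat n\<^esub> N"
    and S0: "\<zero>\<^bsub>Mat n\<^esub> \<in> L <+>\<^bsub>Mat n\<^esub> N" and Ss: "L <+>\<^bsub>Mat n\<^esub> N \<subseteq> carrier (Mat n)"
    using S unfolding M.left_ideal_iff by auto
  define col where "col = (\<lambda>k. {A \<in> carrier (Mat n). \<forall>i<n. \<forall>j<n. j \<noteq> k \<longrightarrow> A (i, j) = \<zero>})"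
  have col_in: "col k \<subseteq> L <+>\<^bsub>Mat n\<^esub> N" if k: "k < n" for k
  proof (rule ccontr)
    assume not: "\<not> col k \<subseteq> L <+>\<^bsub>Mat n\<^esub> N"
    have colI: "left_ideal (col k) (Mat n)"
      unfolding M.left_ideal_iff
    proof (intro conjI ballI)
      fix r A assume r: "r \<in> carrier (Mat n)" and A: "A \<in> col k"
      have "(r \<otimes>\<^bsub>Mat n\<^esub> A) (i, j) = \<zero>" if ij: "i < n" "j < n" "j \<noteq> k" for i j
      proof -
        have "(\<Oplus>m\<in>{..<n}. r (i, m) \<otimes> A (m, j)) = (\<Oplus>m\<in>{..<n}. \<zero>)"
          using r A ij by (intro finsum_cong') (auto simp: col_def)
        then show ?thesis using ij by simp
      qed
      then show "r \<otimes>\<^bsub>Mat n\<^esub> A \<in> col k" using r A by (auto simp: col_def)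
    qed (auto simp: col_def)
    have meet: "Y = \<zero>\<^bsub>Mat n\<^esub>" if "Y \<in> col k" "Y \<in> L <+>\<^bsub>Mat n\<^esub> N" for Y
    proof (rule ccontr)
      assume "Y \<noteq> \<zero>\<^bsub>Mat n\<^esub>"
      then have "col k \<subseteq> L <+>\<^bsub>Mat n\<^esub> N"
        using left_ideal_mat_column[OF S that(2) _ k] that(1) by (auto simp: col_def)
      then show False using not by simp
    qed
    define N' where "N' = N <+>\<^bsub>Mat n\<^esub> col k"
    have N'I: "left_ideal N' (Mat n)" unfolding N'_def by (rule sum_ideal[OF Nl colI])
    have NN': "N \<subseteq> N'"
    proof
      fix a assume "a \<in> N"
      then have "a = a \<oplus>\<^bsub>Mat n\<^esub> \<zero>\<^bsub>Mat n\<^esub>" using Ns(1) by auto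
      moreover have "\<zero>\<^bsub>Mat n\<^esub> \<in> col k" using colI unfolding M.left_ideal_iff by blast
      ultimately show "a \<in> N'" unfolding N'_def using set_add_memI[OF \<open>a \<in> N\<close>] by metis
    qed
    have "N' \<noteq> N"
    proof
      assume "N' = N"
      have "col k \<subseteq> L <+>\<^bsub>Mat n\<^esub> N"
      proof
        fix a assume a: "a \<in> col k"
        then have ac: "a \<in> carrier (Mat n)" by (simp add: col_def)
        have "\<zero>\<^bsub>Mat n\<^esub> \<oplus>\<^bsub>Mat n\<^esub> a \<in> N'" unfolding N'_def by (rule set_add_memI[OF Ns(2) a])
        then have "a \<in> N" using ac \<open>N' = N\<close> by simp
        then have "\<zero>\<^bsub>Mat n\<^esub> \<oplus>\<^bsub>Mat n\<^esub> a \<in> L <+>\<^bsub>Mat n\<^esub> N" by (rule set_add_memI[OF Ls(2)])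
        then show "a \<in> L <+>\<^bsub>Mat n\<^esub> N" using ac by simp
      qed
      then show False using not by simp
    qed
    then have "card N < card N'"
      using NN' N'I finite_subset[OF _ finite_mat[OF fin]] unfolding M.left_ideal_iff
      by (intro psubset_card_mono) auto
    moreover have "N' \<in> C"
    proof -
      \<comment> \<open>If Y = a + c lies in L, with a in N and c in the column ideal, then c = Y -
        a lies in L + N and vanishes by \<open>meet\<close>; so Y lies in both L and N.\<close>
      have "Y = \<zero>\<^bsub>Mat n\<^esub>" if Y: "Y \<in> L" "Y \<in> N'" for Y
      proof -
        obtain a c where ac: "a \<in> N" "c \<in> col k" "Y = a \<oplus>\<^bsub>Mat n\<^esub> c"
          using Y(2) unfolding N'_def set_add_def' by blast
        have carr: "a \<in> carrier (Mat n)" "c \<in> carrier (Mat n)" "Y \<in> carrier (Mat n)"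
          using ac Y Ls(1) Ns(1) by (auto simp: col_def)
        have m1: "(\<ominus>\<^bsub>Mat n\<^esub> \<one>\<^bsub>Mat n\<^esub>) \<otimes>\<^bsub>Mat n\<^esub> a = \<ominus>\<^bsub>Mat n\<^esub> a" using carr by (simp add: M.l_minus)
        then have "\<ominus>\<^bsub>Mat n\<^esub> a \<in> N" using Ns(4)[OF _ ac(1), of "\<ominus>\<^bsub>Mat n\<^esub> \<one>\<^bsub>Mat n\<^esub>"] by simp
        from set_add_memI[OF Y(1) this] have "Y \<oplus>\<^bsub>Mat n\<^esub> (\<ominus>\<^bsub>Mat n\<^esub> a) \<in> L <+>\<^bsub>Mat n\<^esub> N" .
        moreover have "Y \<oplus>\<^bsub>Mat n\<^esub> (\<ominus>\<^bsub>Mat n\<^esub> a) = c"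
          unfolding ac(3) M.a_comm[OF carr(1,2)] using carr by (simp add: M.a_assoc M.r_neg)
        ultimately have "c \<in> L <+>\<^bsub>Mat n\<^esub> N" by simp
        then have "c = \<zero>\<^bsub>Mat n\<^esub>" using meet ac(2) by simp
        then have "Y \<in> N" using ac carr by simp
        then show ?thesis using LN Y(1) by blast
      qed
      then show ?thesis using N'I Ls(2) unfolding C_def M.left_ideal_iff by blast
    qed
    ultimately show False using max[of N'] by simp
  qed
  \<comment> \<open>All column ideals lie in L + N, and a matrix is the sum of its columns; the
    induction peels off the last column that may be nonzero.\<close>
  have "A \<in> L <+>\<^bsub>Mat n\<^esub> N"
    if "k \<le> n" "A \<in> carrier (Mat n)" "\<And>i j. i < n \<Longrightarrow> j < n \<Longrightarrow> k \<le> j \<Longrightarrow> A (i, j) = \<zero>" for k A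
    using that
  proof (induction k arbitrary: A)
    case 0
    then have "A = \<zero>\<^bsub>Mat n\<^esub>" by (intro mat_eqI[where n = n]) auto
    then show ?case using S0 by simp
  next
    case (Suc k)
    define A1 where "A1 = mat_of n (\<lambda>i j. if j = k then \<zero> else A (i, j))"
    define A2 where "A2 = mat_of n (\<lambda>i j. if j = k then A (i, j) else \<zero>)"
    have c: "A1 \<in> carrier (Mat n)" "A2 \<in> carrier (Mat n)"
      using Suc.prems(2) by (auto simp: A1_def A2_def intro!: mat_of_closed)
    have "A1 (i, j) = \<zero>" if "i < n" "j < n" "k \<le> j" for i j
      using that Suc.prems(3)[of i j] by (cases "j = k") (auto simp: A1_def)
    then have "A1 \<in> L <+>\<^bsub>Mat n\<^esub> N" using Suc.IH[of A1] Suc.prems(1) c by simp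
    moreover have "A2 \<in> L <+>\<^bsub>Mat n\<^esub> N"
      using col_in[of k] Suc.prems(1) c by (auto simp: col_def A2_def)
    moreover have "A = A1 \<oplus>\<^bsub>Mat n\<^esub> A2"
      by (rule mat_eqI[where n = n]) (use Suc.prems(2) c in \<open>auto simp: A1_def A2_def\<close>)
    ultimately show ?case using S_add by simp
  qed
  from this[of n] have "L <+>\<^bsub>Mat n\<^esub> N = carrier (Mat n)" using Ss by auto
  then show "\<exists>L'. left_ideal L' (Mat n) \<and> L <+>\<^bsub>Mat n\<^esub> L' = carrier (Mat n) \<and> L \<inter> L' = {\<zero>\<^bsub>Mat n\<^esub>}"
    using Nl LN by blast
qed

lemma semisimple_RDirProd_list:
  assumes "\<And>R. R \<in> set Rs \<Longrightarrow> semisimple_ring R"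
  shows "semisimple_ring (RDirProd_list Rs)"
  using assms
proof (induction Rs)
  case Nil
  then show ?case using semisimple_nil_ring by simp
next
  case (Cons R Rs)
  have ss: "semisimple_ring (RDirProd R (RDirProd_list Rs))"
    using Cons by (intro semisimple_RDirProd) auto
  have "ring (RDirProd_list (R # Rs))"
  proof (rule RDirProd_list_is_ring)
    fix i assume "i < length (R # Rs)"
    then have "(R # Rs) ! i \<in> set (R # Rs)" by (rule nth_mem)
    then show "ring ((R # Rs) ! i)" using Cons.prems semisimple_ring_def by blast
  qed
  then show ?case
    using semisimple_ring_iso[OF ss] RDirProd_list_iso1 by (auto simp: is_ring_iso_def)
qed

section \<open>Classification of the finite semisimple rings\<close>

definition central_idempotents :: "('a, 'b) ring_scheme \<Rightarrow> 'a set" where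
  "central_idempotents R = {e \<in> ring_center R. e \<otimes>\<^bsub>R\<^esub> e = e}"

text \<open>The equation e f = f is the order on central idempotents: f belongs to the ideal
  generated by e. Primitive means minimal among the nonzero ones.\<close>

definition primitive_central_idempotents :: "('a, 'b) ring_scheme \<Rightarrow> 'a set" where
  "primitive_central_idempotents R = {e \<in> central_idempotents R. e \<noteq> \<zero>\<^bsub>R\<^esub> \<and>
     (\<forall>f\<in>central_idempotents R. e \<otimes>\<^bsub>R\<^esub> f = f \<longrightarrow> f = \<zero>\<^bsub>R\<^esub> \<or> f = e)}"

text \<open>The simple components are \<open>eR\<close> for the primitive central idempotents \<open>e\<close>, with centre
  \<open>eZ(R)\<close>. Being defined without a decomposition, this multiset is an isomorphism invariant, which
  gives the uniqueness of the decomposition.\<close>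

definition simple_types :: "('a, 'b) ring_scheme \<Rightarrow> (nat \<times> nat) multiset" where
  "simple_types R = image_mset
     (\<lambda>e. (card ((\<lambda>r. e \<otimes>\<^bsub>R\<^esub> r) ` carrier R), card ((\<lambda>r. e \<otimes>\<^bsub>R\<^esub> r) ` ring_center R)))
     (mset_set (primitive_central_idempotents R))"

lemma ring_center_subset: "ring_center R \<subseteq> carrier R"
  by (auto simp: ring_center_def)

lemma primitive_central_idempotents_subset: "primitive_central_idempotents R \<subseteq> carrier R"
  by (auto simp: primitive_central_idempotents_def central_idempotents_def ring_center_def)

lemma simple_types_iso:
  assumes R: "ring R" and S: "ring S" and iso: "R \<simeq> S"
  shows "simple_types R = simple_types S"
proof -
  interpret R: ring R by (rule R)
  interpret S: ring S by (rule S)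
  obtain h where h: "h \<in> ring_iso R S" using iso by (auto simp: is_ring_iso_def)
  then have hom: "h \<in> ring_hom R S" and inj: "inj_on h (carrier R)" and im: "h ` carrier R = carrier S"
    by (auto simp: ring_iso_def bij_betw_def)
  interpret h: ring_hom_ring R S h by (rule ring_hom_ringI2[OF R S hom])
  have hinj: "h a = h b \<longleftrightarrow> a = b" if "a \<in> carrier R" "b \<in> carrier R" for a b
    using inj that by (auto simp: inj_on_def)
  have image_eqI': "A = h ` B"
    if AB: "A \<subseteq> carrier S" "B \<subseteq> carrier R" "\<And>a. a \<in> carrier R \<Longrightarrow> h a \<in> A \<longleftrightarrow> a \<in> B" for A B
  proof (intro equalityI subsetI)
    fix x assume x: "x \<in> A"
    then obtain a where "a \<in> carrier R" "x = h a" using AB(1) im by blast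
    then show "x \<in> h ` B" using x AB(3)[of a] by blast
  next
    fix x assume "x \<in> h ` B"
    then show "x \<in> A" using AB(2,3) by blast
  qed
  have cen: "h a \<in> ring_center S \<longleftrightarrow> a \<in> ring_center R" if a: "a \<in> carrier R" for a
  proof -
    have "h a \<in> ring_center S \<longleftrightarrow> (\<forall>r\<in>carrier R. h a \<otimes>\<^bsub>S\<^esub> h r = h r \<otimes>\<^bsub>S\<^esub> h a)"
      using a unfolding ring_center_def im[symmetric] by auto
    also have "\<dots> \<longleftrightarrow> (\<forall>r\<in>carrier R. a \<otimes>\<^bsub>R\<^esub> r = r \<otimes>\<^bsub>R\<^esub> a)"
    proof (intro ball_cong refl)
      fix r assume "r \<in> carrier R"
      then show "(h a \<otimes>\<^bsub>S\<^esub> h r = h r \<otimes>\<^bsub>S\<^esub> h a) = (a \<otimes>\<^bsub>R\<^esub> r = r \<otimes>\<^bsub>R\<^esub> a)"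
        using hinj[of "a \<otimes>\<^bsub>R\<^esub> r" "r \<otimes>\<^bsub>R\<^esub> a"] a by simp
    qed
    also have "\<dots> \<longleftrightarrow> a \<in> ring_center R" using a by (simp add: ring_center_def)
    finally show ?thesis .
  qed
  have center: "ring_center S = h ` ring_center R"
    by (rule image_eqI'[OF ring_center_subset ring_center_subset cen])
  have ide: "h a \<in> central_idempotents S \<longleftrightarrow> a \<in> central_idempotents R" if a: "a \<in> carrier R" for a
    unfolding central_idempotents_def using cen[OF a] a h.hom_mult[OF a a] hinj[of "a \<otimes>\<^bsub>R\<^esub> a" a] by auto
  have ideS: "central_idempotents S = h ` central_idempotents R"
    by (rule image_eqI') (use ide in \<open>auto simp: central_idempotents_def ring_center_def\<close>)
  have ideR: "central_idempotents R \<subseteq> carrier R" by (auto simp: central_idempotents_def ring_center_def)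
  have prim: "h a \<in> primitive_central_idempotents S \<longleftrightarrow> a \<in> primitive_central_idempotents R"
    if a: "a \<in> carrier R" for a
  proof -
    have "(h a \<otimes>\<^bsub>S\<^esub> h f = h f \<longrightarrow> h f = \<zero>\<^bsub>S\<^esub> \<or> h f = h a) \<longleftrightarrow> (a \<otimes>\<^bsub>R\<^esub> f = f \<longrightarrow> f = \<zero>\<^bsub>R\<^esub> \<or> f = a)"
      if "f \<in> carrier R" for f
      using hinj[of "a \<otimes>\<^bsub>R\<^esub> f" f] hinj[of f "\<zero>\<^bsub>R\<^esub>"] hinj[OF that a] a that by auto
    then have "(\<forall>f\<in>central_idempotents S. h a \<otimes>\<^bsub>S\<^esub> f = f \<longrightarrow> f = \<zero>\<^bsub>S\<^esub> \<or> f = h a)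
      \<longleftrightarrow> (\<forall>f\<in>central_idempotents R. a \<otimes>\<^bsub>R\<^esub> f = f \<longrightarrow> f = \<zero>\<^bsub>R\<^esub> \<or> f = a)"
      unfolding ideS using ideR by auto
    then show ?thesis unfolding primitive_central_idempotents_def
      using ide[OF a] hinj[OF a, of "\<zero>\<^bsub>R\<^esub>"] by simp
  qed
  have primS: "primitive_central_idempotents S = h ` primitive_central_idempotents R"
    by (rule image_eqI'[OF primitive_central_idempotents_subset primitive_central_idempotents_subset prim])
  have cards: "card ((\<lambda>r. h e \<otimes>\<^bsub>S\<^esub> r) ` h ` A) = card ((\<lambda>r. e \<otimes>\<^bsub>R\<^esub> r) ` A)"
    if e: "e \<in> carrier R" and A: "A \<subseteq> carrier R" for e A
  proof -
    have "(\<lambda>r. h e \<otimes>\<^bsub>S\<^esub> r) ` h ` A = h ` (\<lambda>r. e \<otimes>\<^bsub>R\<^esub> r) ` A"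
      unfolding image_image using e A by (intro image_cong) auto
    then show ?thesis using e A by (simp only:) (rule card_image, rule inj_on_subset[OF inj], auto)
  qed
  have "simple_types S = image_mset
      (\<lambda>e. (card ((\<lambda>r. h e \<otimes>\<^bsub>S\<^esub> r) ` h ` carrier R), card ((\<lambda>r. h e \<otimes>\<^bsub>S\<^esub> r) ` h ` ring_center R)))
      (mset_set (primitive_central_idempotents R))"
    unfolding simple_types_def primS center im[symmetric]
    using inj_on_subset[OF inj primitive_central_idempotents_subset]
    by (simp add: image_mset_mset_set[symmetric] multiset.map_comp comp_def)
  also have "\<dots> = simple_types R"
    unfolding simple_types_def
  proof (rule image_mset_cong)
    \<comment> \<open>\<open>mset_set\<close> of an infinite set is empty, so membership yields a
      primitive idempotent whether or not R is finite.\<close>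
    fix e assume "e \<in># mset_set (primitive_central_idempotents R)"
    then have "e \<in> carrier R"
      using primitive_central_idempotents_subset by (metis elem_mset_set mset_set.infinite set_mset_empty empty_iff subsetD)
    then show "(card ((\<lambda>r. h e \<otimes>\<^bsub>S\<^esub> r) ` h ` carrier R), card ((\<lambda>r. h e \<otimes>\<^bsub>S\<^esub> r) ` h ` ring_center R))
      = (card ((\<lambda>r. e \<otimes>\<^bsub>R\<^esub> r) ` carrier R), card ((\<lambda>r. e \<otimes>\<^bsub>R\<^esub> r) ` ring_center R))"
      using cards[OF _ subset_refl, of e] cards[OF _ ring_center_subset, of e] by (simp only:)
  qed
  finally show ?thesis ..
qed

text \<open>The centre of the product is the product of the centres, and (a, b) lies above both (a,
  0) and (0, b). So a primitive idempotent has one component zero and the other primitive.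
  Finiteness makes \<open>mset_set\<close> additive on the two families.\<close>

lemma simple_types_RDirProd:
  assumes R: "ring R" "finite (carrier R)" and S: "ring S" "finite (carrier S)"
  shows "simple_types (RDirProd R S) = simple_types R + simple_types S"
proof -
  interpret R: ring R by (rule R)
  interpret S: ring S by (rule S)
  let ?P = "RDirProd R S"
  have center: "ring_center ?P = ring_center R \<times> ring_center S"
  proof (intro equalityI subsetI)
    fix z assume z: "z \<in> ring_center ?P"
    obtain a b where ab: "z = (a, b)" by (cases z)
    have c: "a \<in> carrier R" "b \<in> carrier S"
      and comm: "\<And>r s. r \<in> carrier R \<Longrightarrow> s \<in> carrier S \<Longrightarrow> a \<otimes>\<^bsub>R\<^esub> r = r \<otimes>\<^bsub>R\<^esub> a \<and> b \<otimes>\<^bsub>S\<^esub> s = s \<otimes>\<^bsub>S\<^esub> b"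
      using z unfolding ab ring_center_def by auto
    show "z \<in> ring_center R \<times> ring_center S"
      using c comm[OF _ S.zero_closed] comm[OF R.zero_closed] unfolding ab ring_center_def by auto
  qed (auto simp: ring_center_def)
  have zeros: "\<zero>\<^bsub>R\<^esub> \<in> ring_center R" "\<zero>\<^bsub>S\<^esub> \<in> ring_center S" by (auto simp: ring_center_def)
  have ide: "central_idempotents ?P = central_idempotents R \<times> central_idempotents S"
    unfolding central_idempotents_def center by auto
  have zi: "\<zero>\<^bsub>R\<^esub> \<in> central_idempotents R" "\<zero>\<^bsub>S\<^esub> \<in> central_idempotents S"
    using zeros by (auto simp: central_idempotents_def)
  have cR: "central_idempotents R \<subseteq> carrier R" and cS: "central_idempotents S \<subseteq> carrier S"
    by (auto simp: central_idempotents_def ring_center_def)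
  have idR: "e \<otimes>\<^bsub>R\<^esub> e = e" if "e \<in> central_idempotents R" for e
    using that by (simp add: central_idempotents_def)
  have idS: "e \<otimes>\<^bsub>S\<^esub> e = e" if "e \<in> central_idempotents S" for e
    using that by (simp add: central_idempotents_def)
  let ?A = "(\<lambda>e. (e, \<zero>\<^bsub>S\<^esub>)) ` primitive_central_idempotents R"
  let ?B = "(\<lambda>e. (\<zero>\<^bsub>R\<^esub>, e)) ` primitive_central_idempotents S"
  have "primitive_central_idempotents ?P = ?A \<union> ?B"
  proof (intro equalityI subsetI)
    fix z assume z: "z \<in> primitive_central_idempotents ?P"
    obtain a b where ab: "z = (a, b)" by (cases z)
    have c: "a \<in> central_idempotents R" "b \<in> central_idempotents S" and nz: "a \<noteq> \<zero>\<^bsub>R\<^esub> \<or> b \<noteq> \<zero>\<^bsub>S\<^esub>"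
      and min: "\<And>f g. f \<in> central_idempotents R \<Longrightarrow> g \<in> central_idempotents S \<Longrightarrow>
        a \<otimes>\<^bsub>R\<^esub> f = f \<Longrightarrow> b \<otimes>\<^bsub>S\<^esub> g = g \<Longrightarrow> f = \<zero>\<^bsub>R\<^esub> \<and> g = \<zero>\<^bsub>S\<^esub> \<or> f = a \<and> g = b"
      using z unfolding ab primitive_central_idempotents_def ide by auto
    have carr: "a \<in> carrier R" "b \<in> carrier S" using c cR cS by auto
    from min[OF c(1) zi(2) idR[OF c(1)]] carr have "a = \<zero>\<^bsub>R\<^esub> \<or> b = \<zero>\<^bsub>S\<^esub>" by auto
    then show "z \<in> ?A \<union> ?B"
    proof
      assume a: "a = \<zero>\<^bsub>R\<^esub>"
      have "b \<in> primitive_central_idempotents S"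
        unfolding primitive_central_idempotents_def using c(2) nz a min[OF zi(1)] carr by auto
      then show ?thesis using ab a by auto
    next
      assume b: "b = \<zero>\<^bsub>S\<^esub>"
      have "a \<in> primitive_central_idempotents R"
        unfolding primitive_central_idempotents_def using c(1) nz b min[OF _ zi(2)] carr by auto
      then show ?thesis using ab b by auto
    qed
  next
    fix z assume "z \<in> ?A \<union> ?B"
    then show "z \<in> primitive_central_idempotents ?P"
    proof
      assume "z \<in> ?A"
      then obtain a where a: "a \<in> primitive_central_idempotents R" "z = (a, \<zero>\<^bsub>S\<^esub>)" by blast
      have "g = \<zero>\<^bsub>S\<^esub>" if "g \<in> central_idempotents S" "\<zero>\<^bsub>S\<^esub> \<otimes>\<^bsub>S\<^esub> g = g" for g
        using that cS by auto
      then show ?thesis using a zi unfolding primitive_central_idempotents_def ide by auto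
    next
      assume "z \<in> ?B"
      then obtain a where a: "a \<in> primitive_central_idempotents S" "z = (\<zero>\<^bsub>R\<^esub>, a)" by blast
      have "g = \<zero>\<^bsub>R\<^esub>" if "g \<in> central_idempotents R" "\<zero>\<^bsub>R\<^esub> \<otimes>\<^bsub>R\<^esub> g = g" for g
        using that cR by auto
      then show ?thesis using a zi unfolding primitive_central_idempotents_def ide by auto
    qed
  qed
  moreover have "?A \<inter> ?B = {}" by (auto simp: primitive_central_idempotents_def)
  moreover have fin: "finite (primitive_central_idempotents R)" "finite (primitive_central_idempotents S)"
    using finite_subset[OF primitive_central_idempotents_subset] R S by auto
  ultimately have ms: "mset_set (primitive_central_idempotents ?P) = mset_set ?A + mset_set ?B"
    by (simp add: mset_set_Union)
  have msA: "mset_set ?A = image_mset (\<lambda>e. (e, \<zero>\<^bsub>S\<^esub>)) (mset_set (primitive_central_idempotents R))"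
    by (rule image_mset_mset_set[symmetric]) (auto simp: inj_on_def)
  have msB: "mset_set ?B = image_mset (\<lambda>e. (\<zero>\<^bsub>R\<^esub>, e)) (mset_set (primitive_central_idempotents S))"
    by (rule image_mset_mset_set[symmetric]) (auto simp: inj_on_def)
  have cardA: "card ((\<lambda>r. (e, \<zero>\<^bsub>S\<^esub>) \<otimes>\<^bsub>?P\<^esub> r) ` (T \<times> Y)) = card ((\<lambda>r. e \<otimes>\<^bsub>R\<^esub> r) ` T)"
    if "Y \<subseteq> carrier S" "\<zero>\<^bsub>S\<^esub> \<in> Y" for e T Y
  proof -
    have "(\<lambda>r. (e, \<zero>\<^bsub>S\<^esub>) \<otimes>\<^bsub>?P\<^esub> r) ` (T \<times> Y) = (\<lambda>x. (x, \<zero>\<^bsub>S\<^esub>)) ` (\<lambda>r. e \<otimes>\<^bsub>R\<^esub> r) ` T"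
      using that by (force simp: image_iff subset_iff)
    moreover have "card ((\<lambda>x. (x, \<zero>\<^bsub>S\<^esub>)) ` (\<lambda>r. e \<otimes>\<^bsub>R\<^esub> r) ` T) = card ((\<lambda>r. e \<otimes>\<^bsub>R\<^esub> r) ` T)" by (rule card_image) (simp add: inj_on_def)
    ultimately show ?thesis by (simp only:)
  qed
  have cardB: "card ((\<lambda>r. (\<zero>\<^bsub>R\<^esub>, e) \<otimes>\<^bsub>?P\<^esub> r) ` (T \<times> Y)) = card ((\<lambda>r. e \<otimes>\<^bsub>S\<^esub> r) ` Y)"
    if "T \<subseteq> carrier R" "\<zero>\<^bsub>R\<^esub> \<in> T" for e T Y
  proof -
    have "(\<lambda>r. (\<zero>\<^bsub>R\<^esub>, e) \<otimes>\<^bsub>?P\<^esub> r) ` (T \<times> Y) = (\<lambda>x. (\<zero>\<^bsub>R\<^esub>, x)) ` (\<lambda>r. e \<otimes>\<^bsub>S\<^esub> r) ` Y"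
      using that by (force simp: image_iff subset_iff)
    moreover have "card ((\<lambda>x. (\<zero>\<^bsub>R\<^esub>, x)) ` (\<lambda>r. e \<otimes>\<^bsub>S\<^esub> r) ` Y) = card ((\<lambda>r. e \<otimes>\<^bsub>S\<^esub> r) ` Y)" by (rule card_image) (simp add: inj_on_def)
    ultimately show ?thesis by (simp only:)
  qed
  show ?thesis unfolding simple_types_def ms msA msB
    using zeros ring_center_subset[of R] ring_center_subset[of S]
    by (simp add: multiset.map_comp comp_def center cardA cardB)
qed

lemma simple_types_nil_ring: "simple_types (nil_ring :: 'a list ring) = {#}"
proof -
  have z: "\<zero>\<^bsub>nil_ring\<^esub> = ([] :: 'a list)" by (simp add: monoid.defs)
  have "primitive_central_idempotents (nil_ring :: 'a list ring) = {}"
  proof (rule equals0I)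
    fix e :: "'a list" assume e: "e \<in> primitive_central_idempotents nil_ring"
    have "e = []"
      using subsetD[OF primitive_central_idempotents_subset e] unfolding nil_ring_simprules by blast
    moreover have "e \<noteq> \<zero>\<^bsub>nil_ring\<^esub>"
      using e[unfolded primitive_central_idempotents_def mem_Collect_eq] by (elim conjE)
    ultimately show False by (simp only: z simp_thms)
  qed
  then show ?thesis unfolding simple_types_def by (simp only: mset_set.empty image_mset_empty)
qed

lemma (in field) simple_types_mat:
  assumes "n \<ge> 1"
  shows "simple_types (Mat n) = {#(card (carrier R) ^ n\<^sup>2, card (carrier R))#}"
proof -
  interpret M: ring "Mat n" by (rule mat_is_ring)
  have ne: "\<one>\<^bsub>Mat n\<^esub> \<noteq> \<zero>\<^bsub>Mat n\<^esub>" using mat_one_not_zero[OF one_not_zero assms] .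
  have "\<one>\<^bsub>Mat n\<^esub> \<in> ring_center (Mat n)" "\<zero>\<^bsub>Mat n\<^esub> \<in> ring_center (Mat n)" by (auto simp: ring_center_def)
  then have "central_idempotents (Mat n) = {\<zero>\<^bsub>Mat n\<^esub>, \<one>\<^bsub>Mat n\<^esub>}"
    using mat_central_idempotent[of _ n] by (auto simp: central_idempotents_def)
  then have prim: "primitive_central_idempotents (Mat n) = {\<one>\<^bsub>Mat n\<^esub>}"
    using ne unfolding primitive_central_idempotents_def by auto
  have "(\<lambda>r. \<one>\<^bsub>Mat n\<^esub> \<otimes>\<^bsub>Mat n\<^esub> r) ` T = T" if "T \<subseteq> carrier (Mat n)" for T
    using that by (force simp: image_iff subset_iff)
  then show ?thesis unfolding simple_types_def prim
    using ring_center_subset[of "Mat n"] by (simp add: card_mat card_mat_center[OF assms])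
qed

section \<open>Products of matrix rings over finite fields\<close>

declare ring_iso_trans [trans]

lemma is_ring_iso_RDirProd_cong: "R \<simeq> R' \<Longrightarrow> S \<simeq> S' \<Longrightarrow> RDirProd R S \<simeq> RDirProd R' S'"
  unfolding is_ring_iso_def using RDirProd_iso6 by blast

lemma RDirProd_list_Cons_iso:
  "RDirProd_list (R # Rs) \<simeq> RDirProd R (RDirProd_list Rs)"
  "RDirProd R (RDirProd_list Rs) \<simeq> RDirProd_list (R # Rs)"
  unfolding is_ring_iso_def using RDirProd_list_iso1 RDirProd_list_iso2 by blast+

lemma RDirProd_lcomm_iso: "RDirProd R (RDirProd S T) \<simeq> RDirProd S (RDirProd R T)"
proof -
  have swap: "RDirProd R S \<simeq> RDirProd S R"
    unfolding is_ring_iso_def using RDirProd_iso1 by blast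
  have "RDirProd R (RDirProd S T) \<simeq> RDirProd (RDirProd R S) T"
    unfolding is_ring_iso_def using RDirProd_iso2 by blast
  also have "RDirProd (RDirProd R S) T \<simeq> RDirProd (RDirProd S R) T"
    by (rule is_ring_iso_RDirProd_cong[OF swap ring_iso_refl])
  also have "RDirProd (RDirProd S R) T \<simeq> RDirProd S (RDirProd R T)"
    unfolding is_ring_iso_def using RDirProd_iso3 by blast
  finally show ?thesis .
qed

text \<open>Bringing one factor to the front suffices to match two lists with the same multiset of
  types one element at a time.\<close>

lemma RDirProd_list_move_iso:
  "RDirProd_list (xs @ R # ys) \<simeq> RDirProd_list (R # xs @ ys)"
proof (induction xs)
  case Nil
  then show ?case using ring_iso_refl by simp
next
  case (Cons W xs)
  have "RDirProd_list ((W # xs) @ R # ys) \<simeq> RDirProd W (RDirProd_list (xs @ R # ys))"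
    using RDirProd_list_Cons_iso by simp
  also have "RDirProd W (RDirProd_list (xs @ R # ys)) \<simeq> RDirProd W (RDirProd_list (R # xs @ ys))"
    by (rule is_ring_iso_RDirProd_cong[OF ring_iso_refl Cons])
  also have "RDirProd W (RDirProd_list (R # xs @ ys)) \<simeq> RDirProd W (RDirProd R (RDirProd_list (xs @ ys)))"
    by (rule is_ring_iso_RDirProd_cong[OF ring_iso_refl RDirProd_list_Cons_iso(1)])
  also have "RDirProd W (RDirProd R (RDirProd_list (xs @ ys))) \<simeq> RDirProd R (RDirProd W (RDirProd_list (xs @ ys)))"
    by (rule RDirProd_lcomm_iso)
  also have "RDirProd R (RDirProd W (RDirProd_list (xs @ ys))) \<simeq> RDirProd R (RDirProd_list (W # xs @ ys))"
    by (rule is_ring_iso_RDirProd_cong[OF ring_iso_refl RDirProd_list_Cons_iso(2)])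
  also have "RDirProd R (RDirProd_list (W # xs @ ys)) \<simeq> RDirProd_list (R # W # xs @ ys)"
    by (rule RDirProd_list_Cons_iso(2))
  finally show ?case by simp
qed

text \<open>The condition imposed on the list in \<open>wedderburn_decomposition\<close>, separated
  from the isomorphism and stated for any carrier type.\<close>

definition finite_field_list :: "('a ring \<times> nat) list \<Rightarrow> bool" where
  "finite_field_list Ds \<longleftrightarrow> (\<forall>(F, n)\<in>set Ds. field F \<and> finite (carrier F) \<and> n \<ge> 1)"

abbreviation mat_list :: "('a ring \<times> nat) list \<Rightarrow> (nat \<times> nat \<Rightarrow> 'a) list ring" where
  "mat_list Ds \<equiv> RDirProd_list (map (\<lambda>(F, n). mat_ring F n) Ds)"

definition field_types :: "('a ring \<times> nat) list \<Rightarrow> (nat \<times> nat) multiset" where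
  "field_types Ds = image_mset (\<lambda>(F, n). (card (carrier F), n)) (mset Ds)"

lemma finite_field_list_Cons:
  "finite_field_list ((F, n) # Ds) \<longleftrightarrow> field F \<and> finite (carrier F) \<and> n \<ge> 1 \<and> finite_field_list Ds"
  by (auto simp: finite_field_list_def)

lemma ring_mat_list:
  assumes "finite_field_list Ds"
  shows "ring (mat_list Ds)"
proof (rule RDirProd_list_is_ring)
  fix i assume i: "i < length (map (\<lambda>(F, n). mat_ring F n) Ds)"
  obtain F n where Fn: "Ds ! i = (F, n)" by (cases "Ds ! i")
  then have "(F, n) \<in> set Ds" using i by (metis length_map nth_mem)
  then have "field F" using assms by (auto simp: finite_field_list_def)
  then interpret field F .
  show "ring (map (\<lambda>(F, n). mat_ring F n) Ds ! i)" using i Fn mat_is_ring by simp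
qed

lemma semisimple_mat_list:
  assumes "finite_field_list Ds"
  shows "semisimple_ring (mat_list Ds)"
proof (rule semisimple_RDirProd_list)
  fix R assume "R \<in> set (map (\<lambda>(F, n). mat_ring F n) Ds)"
  then obtain F n where "(F, n) \<in> set Ds" "R = mat_ring F n" by auto
  moreover from this have "field F" "finite (carrier F)"
    using assms by (auto simp: finite_field_list_def)
  ultimately show "semisimple_ring R" using field.semisimple_mat by metis
qed

lemma card_mat_list:
  assumes "finite_field_list Ds"
  shows "finite (carrier (mat_list Ds))"
    "card (carrier (mat_list Ds)) = (\<Prod>(q, n)\<in>#field_types Ds. q ^ n\<^sup>2)"
proof -
  have "finite (carrier (mat_list Ds)) \<and>
      card (carrier (mat_list Ds)) = (\<Prod>(q, n)\<in>#field_types Ds. q ^ n\<^sup>2)"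
    using assms
  proof (induction Ds)
    case Nil
    show ?case by (simp add: field_types_def)
  next
    case (Cons D Ds)
    obtain F n where D: "D = (F, n)" by (cases D)
    then have F: "field F" "finite (carrier F)" and Ds: "finite_field_list Ds"
      using Cons.prems by (auto simp: finite_field_list_Cons)
    interpret F: field F by (rule F)
    have c: "carrier (mat_list (D # Ds)) = (\<lambda>(x, xs). x # xs) ` (carrier (mat_ring F n) \<times> carrier (mat_list Ds))"
      by (simp add: D RDirProd_list_carrier)
    have inj: "inj_on (\<lambda>(x, xs). x # xs) A" for A :: "('c \<times> 'c list) set" by (auto simp: inj_on_def)
    show ?case unfolding c
      using Cons.IH[OF Ds] F.finite_mat[OF F(2)]
      by (simp add: card_image[OF inj] card_cartesian_product F.card_mat field_types_def D)
  qed
  then show "finite (carrier (mat_list Ds))"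
    "card (carrier (mat_list Ds)) = (\<Prod>(q, n)\<in>#field_types Ds. q ^ n\<^sup>2)" by auto
qed

lemma simple_types_mat_list:
  assumes "finite_field_list Ds"
  shows "simple_types (mat_list Ds) = image_mset (\<lambda>(q, n). (q ^ n\<^sup>2, q)) (field_types Ds)"
  using assms
proof (induction Ds)
  case Nil
  show ?case using simple_types_nil_ring by (simp add: field_types_def)
next
  case (Cons D Ds)
  obtain F n where D: "D = (F, n)" by (cases D)
  then have F: "field F" "finite (carrier F)" "n \<ge> 1" and Ds: "finite_field_list Ds"
    using Cons.prems by (auto simp: finite_field_list_Cons)
  interpret F: field F by (rule F)
  have r: "ring (mat_ring F n)" by (rule F.mat_is_ring)
  have "simple_types (mat_list (D # Ds)) = simple_types (RDirProd (mat_ring F n) (mat_list Ds))"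
    by (rule simple_types_iso[OF ring_mat_list[OF Cons.prems] RDirProd_ring[OF r ring_mat_list[OF Ds]]])
      (simp add: D RDirProd_list_Cons_iso)
  also have "\<dots> = simple_types (mat_ring F n) + simple_types (mat_list Ds)"
    by (rule simple_types_RDirProd[OF r F.finite_mat[OF F(2)] ring_mat_list[OF Ds] card_mat_list(1)[OF Ds]])
  finally show ?case using Cons.IH[OF Ds] F.simple_types_mat[OF F(3)] by (simp add: field_types_def D)
qed

text \<open>For the head of one list, a factor with the same field order and matrix size is found in
  the other, moved to the front and cancelled. Uniqueness of finite fields turns equal orders into
  isomorphic factors.\<close>

lemma mat_list_iso:
  fixes Ds Ds' :: "('a ring \<times> nat) list"
  assumes "finite_field_list Ds" "finite_field_list Ds'" "field_types Ds = field_types Ds'"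
  shows "mat_list Ds \<simeq> mat_list Ds'"
  using assms
proof (induction Ds arbitrary: Ds')
  case Nil
  then have "Ds' = []" by (simp add: field_types_def)
  then show ?case using ring_iso_refl by simp
next
  case (Cons D Ds)
  obtain F n where D: "D = (F, n)" by (cases D)
  then have F: "field F" "finite (carrier F)" "n \<ge> 1" and Ds: "finite_field_list Ds"
    using Cons.prems by (auto simp: finite_field_list_Cons)
  have "(card (carrier F), n) \<in># field_types (D # Ds)" by (simp add: field_types_def D)
  then have "(card (carrier F), n) \<in># field_types Ds'" using Cons.prems(3) by simp
  then obtain F' where F': "(F', n) \<in> set Ds'" "card (carrier F') = card (carrier F)"
    by (auto simp: field_types_def)
  then obtain xs ys where Ds': "Ds' = xs @ (F', n) # ys" by (meson split_list)
  have ff: "field F'" "finite (carrier F')" "finite_field_list (xs @ ys)"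
    using Cons.prems(2) by (auto simp: Ds' finite_field_list_def)
  have "field_types Ds = field_types (xs @ ys)"
    using Cons.prems(3) F'(2) by (simp add: field_types_def D Ds')
  then have IH: "mat_list Ds \<simeq> mat_list (xs @ ys)" using Cons.IH[OF Ds ff(3)] by simp
  have "F \<simeq> F'" using finite_fields_iso_iff_card[OF F(1,2) ff(1,2)] F'(2) by simp
  then have FF: "mat_ring F n \<simeq> mat_ring F' n"
    using mat_ring_iso F(1) ff(1) by (metis field_def domain_def cring_def)
  have Dl: "finite_field_list (D # Ds)" by (rule Cons.prems(1))
  have "mat_list (D # Ds) \<simeq> RDirProd (mat_ring F n) (mat_list Ds)"
    by (simp add: D RDirProd_list_Cons_iso)
  also have "RDirProd (mat_ring F n) (mat_list Ds) \<simeq> RDirProd (mat_ring F' n) (mat_list (xs @ ys))"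
    by (rule is_ring_iso_RDirProd_cong[OF FF IH])
  also have "RDirProd (mat_ring F' n) (mat_list (xs @ ys)) \<simeq> mat_list ((F', n) # xs @ ys)"
    by (simp add: RDirProd_list_Cons_iso)
  also have "mat_list ((F', n) # xs @ ys) \<simeq> mat_list Ds'"
  proof (rule ring_iso_sym[OF ring_mat_list[OF Cons.prems(2)]])
    show "mat_list Ds' \<simeq> mat_list ((F', n) # xs @ ys)"
      unfolding Ds' using RDirProd_list_move_iso[of "map (\<lambda>(F, n). mat_ring F n) xs" "mat_ring F' n"] by simp
  qed
  finally show ?case .
qed

section \<open>Isomorphism classes as multisets of types\<close>

lemma card_quotient_kernel:
  "card (A // {(a, b). a \<in> A \<and> b \<in> A \<and> f a = f b}) = card (f ` A)"
proof -
  let ?r = "{(a, b). a \<in> A \<and> b \<in> A \<and> f a = f b}"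
  have "A // ?r = (\<lambda>a. ?r `` {a}) ` A" by (auto simp: quotient_def)
  also have "\<dots> = (\<lambda>a. {b \<in> A. f b = f a}) ` A" by (intro image_cong) auto
  finally have "A // ?r = (\<lambda>t. {b \<in> A. f b = t}) ` f ` A" by (simp add: image_image)
  moreover have "inj_on (\<lambda>t. {b \<in> A. f b = t}) (f ` A)"
  proof (rule inj_onI)
    fix s t assume "s \<in> f ` A" and eq: "{b \<in> A. f b = s} = {b \<in> A. f b = t}"
    then obtain a where "a \<in> A" "f a = s" by blast
    then have "a \<in> {b \<in> A. f b = t}" using eq by blast
    then show "s = t" using \<open>f a = s\<close> by simp
  qed
  ultimately show ?thesis by (simp add: card_image)
qed

text \<open>The types of the rings in \<open>smooth_rings x y\<close>, with order and smoothness
  read off from the pairs. The empty multiset is the type of the zero ring, of order 1.\<close>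

definition smooth_types :: "real \<Rightarrow> real \<Rightarrow> (nat \<times> nat) multiset set" where
  "smooth_types x y = {M. (\<forall>(q, n)\<in>#M. n \<ge> 1 \<and> (\<exists>p r. prime p \<and> r \<ge> 1 \<and> q = p ^ r) \<and> real (q ^ n\<^sup>2) \<le> y)
     \<and> real (\<Prod>(q, n)\<in>#M. q ^ n\<^sup>2) \<le> x}"

lemma smooth_rings_decomposition:
  assumes "R \<in> smooth_rings x y"
  obtains Ds :: "(nat ring \<times> nat) list" where "finite_field_list Ds" "R \<simeq> mat_list Ds" "field_types Ds \<in> smooth_types x y"
    "simple_types R = image_mset (\<lambda>(q, n). (q ^ n\<^sup>2, q)) (field_types Ds)"
proof -
  obtain Ds where wd: "wedderburn_decomposition R Ds"
    and sm: "\<forall>(F, n)\<in>set Ds. real (card (carrier (mat_ring F n))) \<le> y"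
    and R: "semisimple_ring R" "real (card (carrier R)) \<le> x"
    using assms by (auto simp: smooth_rings_def)
  have ff: "finite_field_list Ds" and iso: "R \<simeq> mat_list Ds"
    using wd by (auto simp: wedderburn_decomposition_def finite_field_list_def)
  have "real (\<Prod>(q, n)\<in>#field_types Ds. q ^ n\<^sup>2) \<le> x"
    using R(2) ring_iso_same_card[OF iso] card_mat_list(2)[OF ff] by simp
  moreover have "n \<ge> 1 \<and> (\<exists>p r. prime p \<and> r \<ge> 1 \<and> q = p ^ r) \<and> real (q ^ n\<^sup>2) \<le> y"
    if qn: "(q, n) \<in># field_types Ds" for q n
  proof -
    obtain F where F: "(F, n) \<in> set Ds" "q = card (carrier F)" using qn by (auto simp: field_types_def)
    have Ff: "field F" "finite (carrier F)" "n \<ge> 1" using F(1) ff by (auto simp: finite_field_list_def)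
    interpret F: field F by (rule Ff)
    have "\<exists>p r. prime p \<and> r \<ge> 1 \<and> q = p ^ r" using F.finite_field_order[OF Ff(2)] F(2) by metis
    moreover have "real (q ^ n\<^sup>2) \<le> y" using sm F by (auto simp: F.card_mat)
    ultimately show ?thesis using Ff(3) by simp
  qed
  ultimately have "field_types Ds \<in> smooth_types x y" by (auto simp: smooth_types_def)
  moreover have "simple_types R = image_mset (\<lambda>(q, n). (q ^ n\<^sup>2, q)) (field_types Ds)"
    using simple_types_iso[OF _ ring_mat_list[OF ff] iso] simple_types_mat_list[OF ff] R(1)
    by (simp add: semisimple_ring_def)
  ultimately show ?thesis using that[OF ff iso] by simp
qed

text \<open>For each q a field of order q is chosen on the naturals. The product of the matrix rings
  lives on lists of matrices and, being finite, is carried over to the naturals along an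
  injection.\<close>

lemma smooth_types_realised:
  assumes M: "M \<in> smooth_types x y"
  shows "\<exists>R\<in>smooth_rings x y. simple_types R = image_mset (\<lambda>(q, n). (q ^ n\<^sup>2, q)) M"
proof -
  obtain xs where xs: "mset xs = M" using ex_mset by blast
  define FF :: "nat \<Rightarrow> nat ring" where
    "FF = (\<lambda>q. SOME F. field F \<and> finite (carrier F) \<and> card (carrier F) = q)"
  have FF: "field (FF q) \<and> finite (carrier (FF q)) \<and> card (carrier (FF q)) = q" if "(q, n) \<in> set xs" for q n
  proof -
    have "(q, n) \<in># M" using that xs by auto
    then obtain p r where "prime (p::nat)" "r \<ge> 1" "q = p ^ r" using M by (fastforce simp: smooth_types_def)
    then have "\<exists>F :: nat ring. field F \<and> finite (carrier F) \<and> card (carrier F) = q"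
      using exists_finite_field by blast
    then show ?thesis unfolding FF_def by (rule someI_ex)
  qed
  define Ds where "Ds = map (\<lambda>(q, n). (FF q, n)) xs"
  have n1: "n \<ge> 1" "real (q ^ n\<^sup>2) \<le> y" if "(q, n) \<in> set xs" for q n
    using that M xs by (fastforce simp: smooth_types_def)+
  have ff: "finite_field_list Ds" using FF n1 by (fastforce simp: Ds_def finite_field_list_def)
  have "field_types Ds = image_mset (\<lambda>(q, n). (card (carrier (FF q)), n)) (mset xs)"
    by (simp add: field_types_def Ds_def multiset.map_comp comp_def case_prod_beta')
  also have "\<dots> = image_mset (\<lambda>z. z) (mset xs)"
    by (rule image_mset_cong) (use FF in auto)
  finally have ft: "field_types Ds = M" using xs by simp
  obtain e :: "_ \<Rightarrow> nat" where e: "inj_on e (carrier (mat_list Ds))"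
    using finite_imp_inj_to_nat_seg[OF card_mat_list(1)[OF ff]] by blast
  define R where "R = image_ring e (mat_list Ds)"
  have rM: "ring (mat_list Ds)" by (rule ring_mat_list[OF ff])
  have rR: "ring R" unfolding R_def by (rule ring.inj_imp_image_ring_is_ring[OF rM e])
  have isoM: "mat_list Ds \<simeq> R"
    unfolding R_def is_ring_iso_def using inj_imp_image_ring_iso[OF e] by blast
  then have isoR: "R \<simeq> mat_list Ds" by (rule ring_iso_sym[OF rM])
  have ss: "semisimple_ring R" by (rule semisimple_ring_iso[OF semisimple_mat_list[OF ff] rR isoM])
  have card: "card (carrier R) = (\<Prod>(q, n)\<in>#M. q ^ n\<^sup>2)"
    using ring_iso_same_card[OF isoR] card_mat_list(2)[OF ff] ft by simp
  have "carrier R = e ` carrier (mat_list Ds)" by (simp add: R_def image_ring_carrier)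
  then have fin: "finite (carrier R)" using card_mat_list(1)[OF ff] by simp
  have wd: "wedderburn_decomposition R Ds"
    using ff isoR by (simp add: wedderburn_decomposition_def finite_field_list_def)
  have "real (card (carrier (mat_ring F n))) \<le> y" if Fn: "(F, n) \<in> set Ds" for F n
  proof -
    obtain q where q: "(q, n) \<in> set xs" "F = FF q" using Fn by (auto simp: Ds_def)
    then interpret F: field F using FF by blast
    show ?thesis using n1(2)[OF q(1)] FF[OF q(1)] q(2) F.card_mat[of n] by simp
  qed
  moreover have "real (card (carrier R)) \<le> x" using M card by (simp add: smooth_types_def)
  ultimately have "R \<in> smooth_rings x y"
    using ss fin wd unfolding smooth_rings_def by blast
  moreover have "simple_types R = image_mset (\<lambda>(q, n). (q ^ n\<^sup>2, q)) M"
    using simple_types_iso[OF rR rM isoR] simple_types_mat_list[OF ff] ft by simp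
  ultimately show ?thesis by blast
qed

text \<open>The pair (q^(n^2), q) returns q, and then n because q \<ge> 2; for q = 1 the size n
  would be lost. As the map is injective only on such pairs, the multiset is recovered by
  \<open>inv_into\<close> relative to them.\<close>

lemma smooth_types_inj:
  "inj_on (image_mset (\<lambda>(q, n). (q ^ n\<^sup>2, q))) (smooth_types x y)"
proof (rule inj_onI)
  let ?f = "\<lambda>(q, n). (q ^ n\<^sup>2, q) :: nat \<times> nat"
  let ?A = "{(q, n). q \<ge> 2 \<and> n \<ge> (1::nat)}"
  have inj: "inj_on ?f ?A"
    by (auto simp: inj_on_def)
  have sub: "set_mset M \<subseteq> ?A" if Ms: "M \<in> smooth_types x y" for M
  proof
    fix z assume z: "z \<in># M"
    obtain q n where zq: "z = (q, n)" by (cases z)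
    have "n \<ge> 1 \<and> (\<exists>p r. prime (p::nat) \<and> r \<ge> 1 \<and> q = p ^ r)"
      using Ms z unfolding zq smooth_types_def by blast
    then obtain p r where pr: "prime (p::nat)" "r \<ge> 1" "q = p ^ r" "n \<ge> 1" by blast
    have "2 \<le> p" using pr prime_ge_2_nat by blast
    also have "p \<le> p ^ r" using pr \<open>2 \<le> p\<close> by (intro self_le_power) auto
    finally show "z \<in> ?A" using pr zq by simp
  qed
  have recover: "image_mset (inv_into ?A ?f) (image_mset ?f M) = M" if "M \<in> smooth_types x y" for M
  proof -
    have "image_mset (inv_into ?A ?f) (image_mset ?f M) = image_mset (\<lambda>z. inv_into ?A ?f (?f z)) M"
      by (simp add: multiset.map_comp comp_def)
    also have "\<dots> = image_mset (\<lambda>z. z) M"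
    proof (rule image_mset_cong)
      fix z assume "z \<in># M"
      then have "z \<in> ?A" using sub[OF that] by blast
      then show "inv_into ?A ?f (?f z) = z" by (rule inv_into_f_f[OF inj])
    qed
    finally show ?thesis by simp
  qed
  fix M N assume M: "M \<in> smooth_types x y" and N: "N \<in> smooth_types x y"
    and eq: "image_mset ?f M = image_mset ?f N"
  show "M = N" using recover[OF M] recover[OF N] unfolding eq by (rule trans[OF sym])
qed

text \<open>On \<open>smooth_rings x y\<close> isomorphism is the kernel of
  \<open>simple_types\<close>: equal invariants force equal multisets of pairs, hence isomorphic
  products. The classes are therefore counted by the image of \<open>simple_types\<close>, which
  realisability identifies.\<close>

theorem Psi_sar_eq_card_smooth_types: "Psi_sar x y = card (smooth_types x y)"
proof -
  let ?A = "smooth_rings x y"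
  let ?f = "\<lambda>(q, n). (q ^ n\<^sup>2, q) :: nat \<times> nat"
  have iso_iff: "R \<simeq> S \<longleftrightarrow> simple_types R = simple_types S" if R: "R \<in> ?A" and S: "S \<in> ?A" for R S
  proof
    have rR: "ring R" "ring S" using R S by (auto simp: smooth_rings_def semisimple_ring_def)
    then show "simple_types R = simple_types S" if "R \<simeq> S" using simple_types_iso that by blast
    assume eq: "simple_types R = simple_types S"
    obtain Ds :: "(nat ring \<times> nat) list" where Ds: "finite_field_list Ds" "R \<simeq> mat_list Ds" "field_types Ds \<in> smooth_types x y"
      "simple_types R = image_mset ?f (field_types Ds)" using smooth_rings_decomposition[OF R] by blast
    obtain Es :: "(nat ring \<times> nat) list" where Es: "finite_field_list Es" "S \<simeq> mat_list Es" "field_types Es \<in> smooth_types x y"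
      "simple_types S = image_mset ?f (field_types Es)" using smooth_rings_decomposition[OF S] by blast
    have "field_types Ds = field_types Es"
      using inj_onD[OF smooth_types_inj _ Ds(3) Es(3)] eq Ds(4) Es(4) by simp
    then have "mat_list Ds \<simeq> mat_list Es" using mat_list_iso[OF Ds(1) Es(1)] by simp
    moreover have "mat_list Es \<simeq> S" by (rule ring_iso_sym[OF rR(2) Es(2)])
    ultimately have "mat_list Ds \<simeq> S" by (rule ring_iso_trans)
    with Ds(2) show "R \<simeq> S" by (rule ring_iso_trans)
  qed
  have "{(R, S). R \<in> ?A \<and> S \<in> ?A \<and> R \<simeq> S} = {(R, S). R \<in> ?A \<and> S \<in> ?A \<and> simple_types R = simple_types S}"
    using iso_iff by auto
  then have "Psi_sar x y = card (simple_types ` ?A)"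
    unfolding Psi_sar_def by (simp only: card_quotient_kernel)
  also have "simple_types ` ?A = image_mset ?f ` smooth_types x y"
  proof (intro equalityI subsetI)
    fix t assume "t \<in> simple_types ` ?A"
    then obtain R where R: "R \<in> ?A" "t = simple_types R" by blast
    obtain Ds :: "(nat ring \<times> nat) list" where Ds: "field_types Ds \<in> smooth_types x y"
      "simple_types R = image_mset ?f (field_types Ds)" using smooth_rings_decomposition[OF R(1)] by blast
    show "t \<in> image_mset ?f ` smooth_types x y" unfolding R(2) Ds(2) by (rule imageI[OF Ds(1)])
  next
    fix t assume "t \<in> image_mset ?f ` smooth_types x y"
    then obtain M where M: "M \<in> smooth_types x y" "t = image_mset ?f M" by blast
    obtain R where "R \<in> ?A" "simple_types R = image_mset ?f M" using smooth_types_realised[OF M(1)] by blast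
    then show "t \<in> simple_types ` ?A" unfolding M(2) by (metis imageI)
  qed
  also have "card \<dots> = card (smooth_types x y)" by (rule card_image[OF smooth_types_inj])
  finally show ?thesis .
qed

section \<open>Mertens' theorems\<close>

definition primes_upto :: "nat \<Rightarrow> nat set" where
  "primes_upto n = {p. prime p \<and> p \<le> n}"

lemma finite_primes_upto [simp, intro]: "finite (primes_upto n)"
  unfolding primes_upto_def by (rule finite_subset[of _ "{..n}"]) auto

lemma primes_upto_Suc:
  "primes_upto (Suc n) = (if prime (Suc n) then insert (Suc n) (primes_upto n) else primes_upto n)"
  by (auto simp: primes_upto_def le_Suc_eq)

lemma ln_prime_nonneg: "prime p \<Longrightarrow> 0 \<le> ln (real p)"
  using prime_ge_1_nat[of p] by simp

lemma ln_eq_sum_prime_factors: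
  assumes "n > (0::nat)"
  shows "ln (real n) = (\<Sum>p\<in>prime_factors n. real (multiplicity p n) * ln (real p))"
proof -
  have "ln (real n) = ln (real (\<Prod>p\<in>prime_factors n. p ^ multiplicity p n))"
    using prime_factorization_nat[OF assms] by simp
  also have "\<dots> = ln (\<Prod>p\<in>prime_factors n. real p ^ multiplicity p n)" by simp
  also have "\<dots> = (\<Sum>p\<in>prime_factors n. ln (real p ^ multiplicity p n))"
    by (rule ln_prod) (auto simp: prime_gt_0_nat in_prime_factors_imp_prime)
  also have "\<dots> = (\<Sum>p\<in>prime_factors n. real (multiplicity p n) * ln (real p))"
    by (rule sum.cong) (auto simp: ln_realpow prime_gt_0_nat in_prime_factors_imp_prime)
  finally show ?thesis .
qed

lemma sum_ln_primes_dividing_le: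
  assumes "n > (0::nat)" "finite A" "\<And>p. p \<in> A \<Longrightarrow> prime p \<and> p dvd n"
  shows "(\<Sum>p\<in>A. ln (real p)) \<le> ln (real n)"
proof -
  have sub: "A \<subseteq> prime_factors n" using assms by (auto simp: prime_factors_dvd)
  have ln0: "ln (real p) \<ge> 0" if "p \<in> prime_factors n" for p
    using in_prime_factors_imp_prime[OF that] by (rule ln_prime_nonneg)
  have "(\<Sum>p\<in>A. ln (real p)) \<le> (\<Sum>p\<in>prime_factors n. ln (real p))"
    using sub ln0 by (intro sum_mono2) auto
  also have "\<dots> \<le> (\<Sum>p\<in>prime_factors n. real (multiplicity p n) * ln (real p))"
  proof (rule sum_mono)
    fix p assume p: "p \<in> prime_factors n"
    have "multiplicity p n \<ge> 1" using p unfolding prime_factors_multiplicity by auto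
    moreover have "ln (real p) \<ge> 0" by (rule ln0[OF p])
    ultimately have "1 * ln (real p) \<le> real (multiplicity p n) * ln (real p)"
      by (intro mult_right_mono) auto
    then show "ln (real p) \<le> real (multiplicity p n) * ln (real p)" by simp
  qed
  also have "\<dots> = ln (real n)" using ln_eq_sum_prime_factors[OF assms(1)] by simp
  finally show ?thesis .
qed

text \<open>Every prime in (m + 1, 2 m + 1] divides the binomial coefficient of 2 m + 1 over m,
  which is at most 4^m. Strong induction passes from 2 m + 1 to m + 1; an even n > 2 is no prime and
  passes to n - 1.\<close>

lemma chebyshev_theta_le: "(\<Sum>p\<in>primes_upto n. ln (real p)) \<le> real n * ln 4"
proof (induction n rule: less_induct)
  case (less n)
  consider "n \<le> 1" | "n = 2" | "n > 2" "even n" | m where "m \<ge> 1" "n = 2 * m + 1"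
  proof (cases "even n")
    case True
    then show ?thesis using that(1-3) by linarith
  next
    case False
    then obtain m where m: "n = 2 * m + 1" by (rule oddE)
    then show ?thesis using that(1) that(4)[of m] by (cases "m = 0") auto
  qed
  then show ?case
  proof cases
    case 1
    then have "p \<notin> primes_upto n" for p using prime_ge_2_nat[of p] by (auto simp: primes_upto_def)
    then have "primes_upto n = {}" by blast
    then show ?thesis by simp
  next
    case 2
    then have "p \<in> primes_upto n \<longleftrightarrow> p = 2" for p
      using prime_ge_2_nat[of p] by (auto simp: primes_upto_def)
    then have "primes_upto n = {2}" by blast
    moreover have "ln (2::real) \<le> ln 4" "0 \<le> ln (2::real)" by auto
    ultimately show ?thesis using 2 by (simp, linarith)
  next
    case 3
    then have "\<not> prime n" using prime_odd_nat[of n] by auto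
    then have "primes_upto n = primes_upto (n - 1)"
      using 3 primes_upto_Suc[of "n - 1"] by simp
    then have "(\<Sum>p\<in>primes_upto n. ln (real p)) \<le> real (n - 1) * ln 4" using less[of "n - 1"] 3 by simp
    also have "\<dots> \<le> real n * ln 4" by (intro mult_right_mono) auto
    finally show ?thesis .
  next
    case (4 m)
    define A where "A = {p. prime p \<and> m + 1 < p \<and> p \<le> 2 * m + 1}"
    have finA: "finite A" unfolding A_def by (rule finite_subset[of _ "{..2*m+1}"]) auto
    have split: "primes_upto n = primes_upto (m + 1) \<union> A" "primes_upto (m + 1) \<inter> A = {}"
      using 4 by (auto simp: primes_upto_def A_def)
    have dvd: "p dvd (2 * m + 1 choose m)" if "p \<in> A" for p
    proof -
      have p: "prime p" "m + 1 < p" "p \<le> 2 * m + 1" using that by (auto simp: A_def)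
      have "fact m * fact (2 * m + 1 - m) * (2 * m + 1 choose m) = (fact (2 * m + 1) :: nat)"
        by (rule binomial_fact_lemma) simp
      moreover have "p dvd (fact (2 * m + 1) :: nat)"
        using prime_dvd_fact_iff[OF p(1), of "2 * m + 1"] p(3) by blast
      ultimately have "p dvd fact m * fact (2 * m + 1 - m) * (2 * m + 1 choose m)" by simp
      moreover have "\<not> p dvd fact m" "\<not> p dvd fact (2 * m + 1 - m)"
        using p by (simp_all add: prime_dvd_fact_iff del: fact_Suc)
      ultimately show ?thesis using p(1) prime_dvd_mult_iff by blast
    qed
    have le: "(2 * m + 1 choose m) \<le> 4 ^ m"
    proof -
      \<comment> \<open>The coefficient occurs twice in its row, at m and at m + 1, which halves the
        bound 2^(2 m + 1).\<close>
      have "2 * (2 * m + 1 choose m) = (2 * m + 1 choose m) + (2 * m + 1 choose (m + 1))"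
        using binomial_symmetric[of m "2 * m + 1"] by simp
      also have "\<dots> = (\<Sum>k\<in>{m, m + 1}. 2 * m + 1 choose k)" by simp
      also have "\<dots> \<le> (\<Sum>k\<le>2 * m + 1. 2 * m + 1 choose k)" by (intro sum_mono2) auto
      also have "\<dots> = 2 ^ (2 * m + 1)" by (rule choose_row_sum)
      also have "\<dots> = 2 * 4 ^ m" by (simp add: power_mult)
      finally show ?thesis by simp
    qed
    have "(\<Sum>p\<in>A. ln (real p)) \<le> ln (real (2 * m + 1 choose m))"
      by (rule sum_ln_primes_dividing_le) (use finA dvd in \<open>auto simp: A_def\<close>)
    also have "\<dots> \<le> ln (4 ^ m)"
    proof (rule ln_mono)
      show "real (2 * m + 1 choose m) \<le> 4 ^ m" using of_nat_mono[OF le, where 'a = real] by simp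
    qed (auto simp: zero_less_binomial_iff)
    also have "\<dots> = real m * ln 4" by (simp add: ln_realpow)
    finally have A: "(\<Sum>p\<in>A. ln (real p)) \<le> real m * ln 4" .
    have "(\<Sum>p\<in>primes_upto n. ln (real p)) = (\<Sum>p\<in>primes_upto (m + 1). ln (real p)) + (\<Sum>p\<in>A. ln (real p))"
      unfolding split(1) using split(2) finA by (intro sum.union_disjoint) auto
    also have "\<dots> \<le> real (m + 1) * ln 4 + real m * ln 4" using less[of "m + 1"] 4 A by simp
    also have "\<dots> = real n * ln 4" using 4 by (simp add: algebra_simps)
    finally show ?thesis .
  qed
qed

text \<open>Legendre's formula in recursive form: dividing the multiples of p up to n by p leaves
  the factors of the factorial of n div p.\<close>

lemma multiplicity_fact:
  assumes p: "prime (p::nat)"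
  shows "multiplicity p (fact n :: nat) = n div p + multiplicity p (fact (n div p) :: nat)"
proof (induction n)
  case (Suc n)
  have p0: "p > 1" using p prime_gt_1_nat by blast
  have mf: "multiplicity p (fact (Suc k) :: nat) = multiplicity p (Suc k) + multiplicity p (fact k :: nat)" for k
    unfolding fact_Suc of_nat_id
    by (rule prime_elem_multiplicity_mult_distrib) (use p in auto)
  note m = mf[of n]
  show ?case
  proof (cases "p dvd Suc n")
    case True
    then have d: "Suc n div p = Suc (n div p)" using p0 by (simp add: div_Suc dvd_eq_mod_eq_0)
    have "Suc n = p * Suc (n div p)" using dvd_mult_div_cancel[OF True] d by simp
    then have "multiplicity p (Suc n) = multiplicity p (p * Suc (n div p))" by simp
    also have "\<dots> = 1 + multiplicity p (Suc (n div p))"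
      using p p0 by (subst prime_elem_multiplicity_mult_distrib) auto
    finally show ?thesis using Suc m mf[of "n div p"] d by (simp del: fact_Suc)
  next
    case False
    then have "Suc n div p = n div p" by (simp add: div_Suc dvd_eq_mod_eq_0)
    then show ?thesis using Suc m False by (simp add: not_dvd_imp_multiplicity_0 del: fact_Suc)
  qed
qed simp

text \<open>The bound is the geometric series n / p + n / p^2 + ...; the recursion reproduces it,
  since m + m / (p - 1) = m p / (p - 1), and m p \<le> n for m = n div p.\<close>

lemma multiplicity_fact_le:
  assumes p: "prime (p::nat)"
  shows "real (multiplicity p (fact n :: nat)) \<le> real n / (real p - 1)"
proof (induction n rule: less_induct)
  case (less n)
  have p1: "real p > 1" using prime_gt_1_nat[OF p] by simp
  show ?case
  proof (cases "n = 0")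
    case False
    let ?m = "n div p"
    have "?m < n" using False prime_gt_1_nat[OF p] by simp
    then have "real (multiplicity p (fact n :: nat)) \<le> real ?m + real ?m / (real p - 1)"
      using less[of ?m] multiplicity_fact[OF p, of n] by simp
    also have "\<dots> = real ?m * real p / (real p - 1)" using p1 by (simp add: field_simps)
    also have "\<dots> \<le> real n / (real p - 1)"
      using p1 by (intro divide_right_mono) (simp_all flip: of_nat_mult)
    finally show ?thesis .
  qed simp
qed

text \<open>Stirling's formula up to O(n), precise enough for Mertens' first theorem because
  everything is divided by n there.\<close>

lemma ln_fact_bounds:
  "ln (fact n) \<le> real n * ln (real n)" "real n * ln (real n) - real n \<le> ln (fact n)"
proof -
  show "ln (fact n) \<le> real n * ln (real n)"
  proof (induction n)
    case (Suc n)
    have "ln (fact (Suc n)) = ln (real (Suc n)) + ln (fact n :: real)"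
      by (simp add: ln_mult)
    also have "\<dots> \<le> ln (real (Suc n)) + real n * ln (real n)" using Suc by simp
    also have "\<dots> \<le> ln (real (Suc n)) + real n * ln (real (Suc n))"
      by (cases "n = 0") (auto intro!: mult_left_mono)
    finally show ?case by (simp add: algebra_simps)
  qed simp
  show "real n * ln (real n) - real n \<le> ln (fact n)"
  proof (induction n)
    case (Suc n)
    have *: "real n * (ln (real (Suc n)) - ln (real n)) \<le> 1"
    proof (cases "n = 0")
      case False
      have "ln (real (Suc n)) - ln (real n) = ln (1 + 1 / real n)"
        using False by (subst ln_divide_pos[symmetric]) (auto simp: field_simps)
      also have "\<dots> \<le> 1 / real n" using False by (intro ln_add_one_self_le_self) auto
      finally show ?thesis using False by (simp add: field_simps)
    qed simp
    have "real (Suc n) * ln (real (Suc n)) - real (Suc n)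
        = (real n * ln (real n) - real n) + ln (real (Suc n)) + (real n * (ln (real (Suc n)) - ln (real n)) - 1)"
      by (simp add: algebra_simps)
    also have "\<dots> \<le> ln (fact n) + ln (real (Suc n))" using Suc * by linarith
    also have "\<dots> = ln (fact (Suc n))" by (simp add: ln_mult)
    finally show ?case .
  qed simp
qed

lemma ln_fact_eq_sum_primes:
  "ln (fact n) = (\<Sum>p\<in>primes_upto n. real (multiplicity p (fact n :: nat)) * ln (real p))"
proof -
  have "prime_factors (fact n :: nat) = primes_upto n"
    by (auto simp: prime_factors_dvd primes_upto_def prime_dvd_fact_iff)
  then show ?thesis using ln_eq_sum_prime_factors[of "fact n"] by simp
qed

definition mertens_sum :: "nat \<Rightarrow> real" where
  "mertens_sum n = (\<Sum>p\<in>primes_upto n. ln (real p) / real p)"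

text \<open>The logarithm of n! is evaluated twice, by \<open>ln_fact_bounds\<close> and as the sum
  of v_p(n!) ln p. Replacing v_p(n!) by n / p costs at most \<theta>(n) \<le> n ln 4 in one
  direction and n times the convergent sum of ln p / (p (p - 1)) in the other.\<close>

lemma mertens_first:
  obtains C where "C \<ge> 0" "\<And>n. n \<ge> 1 \<Longrightarrow> \<bar>mertens_sum n - ln (real n)\<bar> \<le> C"
proof -
  define f where "f = (\<lambda>k::nat. ln (real k) / (real k * (real k - 1)))"
  have sm: "summable f"
  proof (rule summable_comparison_test_bigo)
    show "summable (\<lambda>k. norm (real k powr (-3/2)))" by (simp add: summable_real_powr_iff)
    show "f \<in> O(\<lambda>k. real k powr (-3/2))" unfolding f_def by real_asymp
  qed
  have f0: "f k \<ge> 0" for k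
    by (cases "k = 0") (auto simp: f_def)
  define C0 where "C0 = suminf f"
  have C0: "C0 \<ge> 0" unfolding C0_def by (rule suminf_nonneg[OF sm]) (rule f0)
  have sumf: "(\<Sum>p\<in>A. f p) \<le> C0" if "finite A" for A
    unfolding C0_def by (rule sum_le_suminf[OF sm that]) (use f0 in auto)
  have up: "mertens_sum n \<le> ln (real n) + ln 4" if n: "n \<ge> 1" for n
  proof -
    have "real n * mertens_sum n - (\<Sum>p\<in>primes_upto n. ln (real p))
        = (\<Sum>p\<in>primes_upto n. (real n / real p - 1) * ln (real p))"
      by (simp add: mertens_sum_def sum_distrib_left sum_subtractf algebra_simps)
    also have "\<dots> \<le> (\<Sum>p\<in>primes_upto n. real (multiplicity p (fact n :: nat)) * ln (real p))"
    proof (intro sum_mono mult_right_mono)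
      fix p assume "p \<in> primes_upto n"
      then have p: "prime p" by (simp add: primes_upto_def)
      have "real n / real p - 1 \<le> real (n div p)"
      proof -
        have "real (n div p) = real_of_int \<lfloor>real n / real p\<rfloor>" by (simp add: floor_divide_of_nat_eq)
        then show ?thesis by linarith
      qed
      also have "\<dots> \<le> real (multiplicity p (fact n :: nat))" using multiplicity_fact[OF p, of n] by simp
      finally show "real n / real p - 1 \<le> real (multiplicity p (fact n :: nat))" .
      show "0 \<le> ln (real p)" using p by (rule ln_prime_nonneg)
    qed
    also have "\<dots> \<le> real n * ln (real n)" using ln_fact_bounds(1)[of n] ln_fact_eq_sum_primes[of n] by simp
    finally have "real n * mertens_sum n \<le> real n * ln (real n) + real n * ln 4"
      using chebyshev_theta_le[of n] by linarith
    also have "\<dots> = real n * (ln (real n) + ln 4)" by (simp add: algebra_simps)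
    finally show ?thesis using n by (simp add: mult_le_cancel_left)
  qed
  have lo: "mertens_sum n \<ge> ln (real n) - 1 - C0" if n: "n \<ge> 1" for n
  proof -
    have "real n * ln (real n) - real n \<le> (\<Sum>p\<in>primes_upto n. real (multiplicity p (fact n :: nat)) * ln (real p))"
      using ln_fact_bounds(2)[of n] ln_fact_eq_sum_primes[of n] by simp
    also have "\<dots> \<le> (\<Sum>p\<in>primes_upto n. real n * (ln (real p) / real p) + real n * f p)"
    proof (rule sum_mono)
      fix p assume "p \<in> primes_upto n"
      then have p: "prime p" by (simp add: primes_upto_def)
      have p1: "real p > 1" using prime_gt_1_nat[OF p] by simp
      have "real (multiplicity p (fact n :: nat)) * ln (real p) \<le> real n / (real p - 1) * ln (real p)"
        using multiplicity_fact_le[OF p] p1 by (intro mult_right_mono) auto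
      also have "\<dots> = real n * (ln (real p) / real p) + real n * f p"
        using p1 by (simp add: f_def divide_simps) (simp add: algebra_simps)
      finally show "real (multiplicity p (fact n :: nat)) * ln (real p)
          \<le> real n * (ln (real p) / real p) + real n * f p" .
    qed
    also have "\<dots> = real n * mertens_sum n + real n * (\<Sum>p\<in>primes_upto n. f p)"
      by (simp add: sum.distrib sum_distrib_left mertens_sum_def)
    also have "\<dots> \<le> real n * mertens_sum n + real n * C0"
      using sumf[of "primes_upto n"] by (intro add_left_mono mult_left_mono) auto
    finally have "real n * (ln (real n) - 1 - C0) \<le> real n * mertens_sum n" by (simp add: algebra_simps)
    then show ?thesis using n by (simp add: mult_le_cancel_left)
  qed
  show ?thesis
  proof (rule that[of "ln 4 + 1 + C0"])
    fix n :: nat assume n: "n \<ge> 1"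
    have "ln (4::real) \<ge> 0" by simp
    then show "\<bar>mertens_sum n - ln (real n)\<bar> \<le> ln 4 + 1 + C0" using up[OF n] lo[OF n] C0 by linarith
  qed (use C0 in simp)
qed

section \<open>Mertens' second theorem\<close>

definition prime_recip_sum :: "nat \<Rightarrow> real" where
  "prime_recip_sum n = (\<Sum>p\<in>primes_upto n. 1 / real p)"

text \<open>With a = ln n and b = ln (n + 1), both quantities lie between (b - a) / b and (b - a) /
  a. As b - a \<le> 1, these differ by at most 1 / a - 1 / b, a bound that telescopes in n.\<close>

lemma ln_ln_step:
  assumes n: "n \<ge> (2::nat)"
  defines "L \<equiv> ln (real (Suc n)) - ln (real n)" and "D \<equiv> ln (ln (real (Suc n))) - ln (ln (real n))"
  shows "\<bar>L / ln (real (Suc n)) - D\<bar> \<le> 1 / ln (real n) - 1 / ln (real (Suc n))"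
proof -
  define a where "a = ln (real n)"
  define b where "b = ln (real (Suc n))"
  have a: "0 < a" "a < b" using n by (auto simp: a_def b_def)
  have L1: "b - a \<le> 1"
  proof -
    have "b - a = ln (1 + 1 / real n)"
      unfolding a_def b_def using n by (subst ln_divide_pos[symmetric]) (auto simp: field_simps)
    also have "\<dots> \<le> 1 / real n" using n by (intro ln_add_one_self_le_self) auto
    also have "\<dots> \<le> 1" using n by simp
    finally show ?thesis .
  qed
  have D: "D = ln (b / a)"
    unfolding D_def a_def[symmetric] b_def[symmetric] by (rule ln_divide_pos[symmetric]) (use a in auto)
  have "ln (b / a) \<le> b / a - 1" using a by (intro ln_le_minus_one) auto
  also have "\<dots> = (b - a) / a" using a by (simp add: field_simps)
  finally have up: "D \<le> (b - a) / a" using D by simp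
  have "ln (a / b) \<le> a / b - 1" using a by (intro ln_le_minus_one) auto
  moreover have "ln (a / b) = - ln (b / a)" using a by (simp add: ln_divide_pos)
  ultimately have lo: "(b - a) / b \<le> D" using D a by (simp add: field_simps)
  have "(b - a) / a - (b - a) / b = (b - a) * (1 / a - 1 / b)" by (simp add: algebra_simps)
  also have "\<dots> \<le> 1 * (1 / a - 1 / b)" using L1 a by (intro mult_right_mono) (auto simp: field_simps)
  finally have "(b - a) / a - (b - a) / b \<le> 1 / a - 1 / b" by simp
  moreover have "\<bar>P - d\<bar> \<le> R" if "P \<le> d" "d \<le> Q" "Q - P \<le> R" for P Q R d :: real
    using that by linarith
  ultimately show ?thesis using up lo unfolding L_def a_def[symmetric] b_def[symmetric] by blast
qed

lemma mertens_second_nat: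
  obtains K where "K \<ge> 0" "\<And>m n. 2 \<le> m \<Longrightarrow> m \<le> n \<Longrightarrow>
    \<bar>prime_recip_sum n - prime_recip_sum m - (ln (ln (real n)) - ln (ln (real m)))\<bar> \<le> K / ln (real m)"
proof -
  obtain C where C: "C \<ge> 0" "\<And>n. n \<ge> 1 \<Longrightarrow> \<bar>mertens_sum n - ln (real n)\<bar> \<le> C"
    using mertens_first by blast
  define r where "r = (\<lambda>n. mertens_sum n - ln (real n))"
  have r: "\<bar>r n\<bar> \<le> C" if "n \<ge> 1" for n using C(2)[OF that] by (simp add: r_def)
  define T where "T = (\<lambda>m n. prime_recip_sum n - prime_recip_sum m - (ln (ln (real n)) - ln (ln (real m))))"
  \<comment> \<open>Partial summation in the form of an induction on n: r(n) / ln n is its boundary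
    term, and each step costs at most (C + 1) (1 / a - 1 / b), exactly the growth of the right-hand
    side.\<close>
  have main: "\<bar>T m n - r n / ln (real n)\<bar> \<le> (2 * C + 1) / ln (real m) - (C + 1) / ln (real n)"
    if m: "2 \<le> m" "m \<le> n" for m n
    using m(2)
  proof (induction n rule: dec_induct)
    case base
    have "\<bar>T m m - r m / ln (real m)\<bar> = \<bar>r m\<bar> / ln (real m)" using m by (simp add: T_def)
    also have "\<dots> \<le> C / ln (real m)" using r[of m] m by (intro divide_right_mono) auto
    finally show ?case by (simp add: diff_divide_distrib[symmetric])
  next
    case (step n)
    have n2: "n \<ge> 2" using step m by simp
    define a where "a = ln (real n)"
    define b where "b = ln (real (Suc n))"
    have a: "0 < a" "a < b" using n2 by (auto simp: a_def b_def)
    have "prime_recip_sum (Suc n) - prime_recip_sum n = (mertens_sum (Suc n) - mertens_sum n) / b"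
    proof (cases "prime (Suc n)")
      case True
      have "Suc n \<notin> primes_upto n" by (simp add: primes_upto_def)
      then show ?thesis using True a n2 by (simp add: prime_recip_sum_def mertens_sum_def primes_upto_Suc b_def)
    qed (simp add: prime_recip_sum_def mertens_sum_def primes_upto_Suc)
    also have "\<dots> = (b - a) / b + (r (Suc n) - r n) / b"
      by (simp add: r_def a_def b_def add_divide_distrib[symmetric])
    finally have st: "prime_recip_sum (Suc n) - prime_recip_sum n = (b - a) / b + (r (Suc n) - r n) / b" .
    have inc: "T m (Suc n) - r (Suc n) / b
        = (T m n - r n / a) + r n * (1 / a - 1 / b) + ((b - a) / b - (ln b - ln a))"
    proof -
      have "T m (Suc n) = prime_recip_sum (Suc n) - prime_recip_sum m - (ln b - ln (ln (real m)))"
        "T m n = prime_recip_sum n - prime_recip_sum m - (ln a - ln (ln (real m)))"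
        by (simp_all only: T_def a_def b_def)
      then show ?thesis
        using st by (simp add: algebra_simps diff_divide_distrib)
    qed
    have "\<bar>r n * (1 / a - 1 / b)\<bar> \<le> C * (1 / a - 1 / b)"
      using r[of n] n2 a unfolding abs_mult by (intro mult_mono) (auto simp: field_simps)
    moreover have "\<bar>(b - a) / b - (ln b - ln a)\<bar> \<le> 1 / a - 1 / b"
      using ln_ln_step[OF n2] by (simp add: a_def b_def)
    ultimately have "\<bar>T m (Suc n) - r (Suc n) / b\<bar>
        \<le> (2 * C + 1) / ln (real m) - (C + 1) / a + C * (1 / a - 1 / b) + (1 / a - 1 / b)"
      unfolding inc using step.IH unfolding a_def[symmetric] by linarith
    also have "\<dots> = (2 * C + 1) / ln (real m) - (C + 1) / b"
      by (simp add: algebra_simps add_divide_distrib)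
    finally show ?case by (simp add: b_def)
  qed
  show ?thesis
  proof (rule that[of "3 * C + 1"])
    fix m n :: nat assume m: "2 \<le> m" "m \<le> n"
    have lm: "0 < ln (real m)" "ln (real m) \<le> ln (real n)" using m by auto
    have "\<bar>r n / ln (real n)\<bar> \<le> C / ln (real m)"
      using r[of n] m lm C(1) by (simp add: abs_divide) (intro frac_le, auto)
    moreover have "(C + 1) / ln (real n) \<ge> 0" using C lm by simp
    ultimately have "\<bar>T m n\<bar> \<le> C / ln (real m) + (2 * C + 1) / ln (real m)"
      using main[OF m] by linarith
    also have "\<dots> = (3 * C + 1) / ln (real m)" by (simp add: add_divide_distrib[symmetric])
    finally show "\<bar>prime_recip_sum n - prime_recip_sum m - (ln (ln (real n)) - ln (ln (real m)))\<bar> \<le> (3 * C + 1) / ln (real m)"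
      by (simp add: T_def)
  qed (use C in simp)
qed

lemma finite_primes_Ioc [simp, intro]: "finite {p::nat. prime p \<and> a < real p \<and> real p \<le> b}"
  by (rule finite_subset[of _ "{..nat \<lfloor>b\<rfloor>}"]) (auto simp: le_nat_floor)

lemma mertens_second:
  obtains K where "K \<ge> 0" "\<And>a b. 2 \<le> a \<Longrightarrow> a \<le> b \<Longrightarrow>
    \<bar>(\<Sum>p | prime p \<and> a < real p \<and> real p \<le> b. 1 / real p) - (ln (ln b) - ln (ln a))\<bar> \<le> K / ln a"
proof -
  obtain K where K: "K \<ge> 0" "\<And>m n. 2 \<le> m \<Longrightarrow> m \<le> n \<Longrightarrow>
    \<bar>prime_recip_sum n - prime_recip_sum m - (ln (ln (real n)) - ln (ln (real m)))\<bar> \<le> K / ln (real m)"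
    using mertens_second_nat by blast
  \<comment> \<open>Real endpoints are replaced by their integer parts m. From a \<le> 2 m \<le> m^2
    follows ln a \<le> 2 ln m, and ln ln changes by at most 2 / ln a.\<close>
  have fl: "0 \<le> ln (ln a) - ln (ln (real (nat \<lfloor>a\<rfloor>)))" "ln (ln a) - ln (ln (real (nat \<lfloor>a\<rfloor>))) \<le> 2 / ln a"
    "1 / ln (real (nat \<lfloor>a\<rfloor>)) \<le> 2 / ln a" if a: "2 \<le> a" for a
  proof -
    define m where "m = nat \<lfloor>a\<rfloor>"
    have m: "2 \<le> m" "real m \<le> a" "a < real m + 1" unfolding m_def using a by linarith+
    have lm: "0 < ln (real m)" "ln (real m) \<le> ln a" using m by auto
    then show "0 \<le> ln (ln a) - ln (ln (real (nat \<lfloor>a\<rfloor>)))" by (simp add: m_def[symmetric])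
    have "a \<le> real m + real m" using m by linarith
    also have "\<dots> \<le> real m * real m" using m mult_right_mono[of 2 "real m" "real m"] by simp
    finally have "ln a \<le> ln (real m * real m)" using a by simp
    then have la: "ln a \<le> 2 * ln (real m)" using m by (simp add: ln_mult)
    show i: "1 / ln (real (nat \<lfloor>a\<rfloor>)) \<le> 2 / ln a"
      unfolding m_def[symmetric] using la lm by (simp add: field_simps)
    have "ln a - ln (real m) = ln (a / real m)" using m a by (intro ln_divide_pos[symmetric]) auto
    also have "\<dots> \<le> a / real m - 1" using m a by (intro ln_le_minus_one) auto
    also have "\<dots> \<le> 1" using m by (simp add: field_simps)
    finally have d1: "ln a - ln (real m) \<le> 1" .
    have "ln (ln a) - ln (ln (real m)) = ln (ln a / ln (real m))" using lm by (intro ln_divide_pos[symmetric]) auto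
    also have "\<dots> \<le> ln a / ln (real m) - 1" using lm by (intro ln_le_minus_one) auto
    also have "\<dots> = (ln a - ln (real m)) / ln (real m)" using lm by (simp add: field_simps)
    also have "\<dots> \<le> 1 / ln (real m)" using d1 lm by (intro divide_right_mono) auto
    also have "\<dots> \<le> 2 / ln a" using i by (simp add: m_def)
    finally show "ln (ln a) - ln (ln (real (nat \<lfloor>a\<rfloor>))) \<le> 2 / ln a" by (simp add: m_def)
  qed
  show ?thesis
  \<comment> \<open>2 K comes from K / ln m \<le> 2 K / ln a, and 4 from rounding the two endpoints
    at a cost of 2 / ln a each.\<close>
  proof (rule that[of "2 * K + 4"])
    fix a b :: real assume a: "2 \<le> a" "a \<le> b"
    define m where "m = nat \<lfloor>a\<rfloor>"
    define n where "n = nat \<lfloor>b\<rfloor>"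
    have mn: "2 \<le> m" "m \<le> n" unfolding m_def n_def using a by (linarith, simp add: floor_mono nat_mono)
    have ab: "2 / ln b \<le> 2 / ln a" using a by (intro divide_left_mono) auto
    have "{p. prime p \<and> a < real p \<and> real p \<le> b} = primes_upto n - primes_upto m"
    proof -
      have "real p \<le> c \<longleftrightarrow> p \<le> nat \<lfloor>c\<rfloor>" if "c \<ge> 2" for p :: nat and c :: real
        using that by (simp add: le_nat_iff le_floor_iff)
      then show ?thesis using a by (auto simp: primes_upto_def m_def n_def not_le[symmetric])
    qed
    moreover have "primes_upto m \<subseteq> primes_upto n" using mn by (auto simp: primes_upto_def)
    ultimately have S: "(\<Sum>p | prime p \<and> a < real p \<and> real p \<le> b. 1 / real p) = prime_recip_sum n - prime_recip_sum m"
      by (simp add: prime_recip_sum_def sum_diff)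
    have "K / ln (real m) \<le> 2 * K / ln a"
      using mult_left_mono[OF fl(3)[OF a(1)] K(1)] by (simp add: m_def mult.commute)
    then have "\<bar>prime_recip_sum n - prime_recip_sum m - (ln (ln b) - ln (ln a))\<bar> \<le> 2 * K / ln a + 4 / ln a"
      using K(2)[OF mn] fl(1,2)[of a] fl(1,2)[of b] a ab unfolding m_def[symmetric] n_def[symmetric] by linarith
    then show "\<bar>(\<Sum>p | prime p \<and> a < real p \<and> real p \<le> b. 1 / real p) - (ln (ln b) - ln (ln a))\<bar> \<le> (2 * K + 4) / ln a"
      unfolding S by (simp add: add_divide_distrib)
  qed (use K in simp)
qed

text \<open>At most sqrt n primes lie up to sqrt n, and each larger one contributes at least (ln n)
  / 2 to \<theta>(n) \<le> n ln 4.\<close>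

lemma prime_count_le:
  assumes "n \<ge> 2"
  shows "real (card (primes_upto n)) \<le> sqrt (real n) + 2 * ln 4 * real n / ln (real n)"
proof -
  define A where "A = {p \<in> primes_upto n. real p > sqrt (real n)}"
  define B where "B = {p \<in> primes_upto n. real p \<le> sqrt (real n)}"
  have "primes_upto n = A \<union> B" by (auto simp: A_def B_def)
  then have "card (primes_upto n) \<le> card A + card B" using card_Un_le[of A B] by simp
  moreover have "real (card B) \<le> sqrt (real n)"
  proof -
    have "B \<subseteq> {1..nat \<lfloor>sqrt (real n)\<rfloor>}"
      by (auto simp: B_def primes_upto_def le_nat_floor Suc_le_eq prime_gt_0_nat)
    then have "card B \<le> nat \<lfloor>sqrt (real n)\<rfloor>" using card_mono[of "{1..nat \<lfloor>sqrt (real n)\<rfloor>}" B] by simp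
    moreover have "real (nat \<lfloor>sqrt (real n)\<rfloor>) \<le> sqrt (real n)" by simp
    ultimately show ?thesis by linarith
  qed
  moreover have "real (card A) \<le> 2 * ln 4 * real n / ln (real n)"
  proof -
    have ln: "ln (real n) > 0" using assms by simp
    have "real (card A) * (ln (real n) / 2) = (\<Sum>p\<in>A. ln (sqrt (real n)))"
      using assms by (simp add: ln_sqrt)
    also have "\<dots> \<le> (\<Sum>p\<in>A. ln (real p))"
      using assms by (intro sum_mono ln_mono) (auto simp: A_def)
    also have "\<dots> \<le> (\<Sum>p\<in>primes_upto n. ln (real p))"
      by (intro sum_mono2) (auto simp: A_def primes_upto_def ln_prime_nonneg)
    also have "\<dots> \<le> real n * ln 4" by (rule chebyshev_theta_le)
    finally show ?thesis using ln by (simp add: field_simps)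
  qed
  ultimately show ?thesis by linarith
qed

text \<open>Serves to bound the total of the additive errors 1 in the Buchstab recursion, one for
  each prime involved.\<close>

lemma prime_count_little_o:
  assumes "\<epsilon> > 0"
  obtains x0 where "x0 \<ge> 2" "\<And>x. x \<ge> x0 \<Longrightarrow> real (card {p::nat. prime p \<and> real p \<le> x}) \<le> \<epsilon> * x"
proof -
  have "((\<lambda>x::real. (sqrt x + 2 * ln 4 * x / ln x) / x) \<longlongrightarrow> 0) at_top" by real_asymp
  then have "eventually (\<lambda>x::real. (sqrt x + 2 * ln 4 * x / ln x) / x < \<epsilon>) at_top"
    using assms by (rule order_tendstoD(2))
  then obtain Y where Y: "\<And>x. x \<ge> Y \<Longrightarrow> (sqrt x + 2 * ln 4 * x / ln x) / x < \<epsilon>"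
    by (auto simp: eventually_at_top_linorder)
  show ?thesis
  proof (rule that[of "max Y 2 + 1"])
    fix x assume x: "x \<ge> max Y 2 + 1"
    define n where "n = nat \<lfloor>x\<rfloor>"
    have n: "2 \<le> n" "real n \<ge> Y" "real n \<le> x" unfolding n_def using x by linarith+
    have "{p::nat. prime p \<and> real p \<le> x} = primes_upto n"
      using x by (auto simp: primes_upto_def n_def le_nat_iff le_floor_iff)
    then have "real (card {p::nat. prime p \<and> real p \<le> x}) \<le> sqrt (real n) + 2 * ln 4 * real n / ln (real n)"
      using prime_count_le[OF n(1)] by simp
    also have "\<dots> \<le> \<epsilon> * real n" using Y[OF n(2)] n(1) by (simp add: field_simps)
    also have "\<dots> \<le> \<epsilon> * x" using n assms by (intro mult_left_mono) auto
    finally show "real (card {p::nat. prime p \<and> real p \<le> x}) \<le> \<epsilon> * x" .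
  qed simp
qed

section \<open>The Dickman function\<close>

text \<open>Picard iterates for the integral equation \<open>\<rho>(u) = 1 - \<integral>\<^sub>1\<^sup>u \<rho>(v - 1) / v dv\<close>.
  The iterate of index \<open>n\<close> is already exact on \<open>[0, n + 1]\<close>.\<close>

primrec dickman_approx :: "nat \<Rightarrow> real \<Rightarrow> real" where
  "dickman_approx 0 = (\<lambda>u. 1)"
| "dickman_approx (Suc n) = (\<lambda>u. 1 - integral {1..max 1 u} (\<lambda>v. dickman_approx n (v - 1) / v))"

lemma continuous_dickman_approx: "continuous_on {0..} (dickman_approx n)"
proof (induction n)
  case (Suc n)
  show ?case
  proof (rule continuous_on_subset[OF _ subset_UNIV])
    have "isCont (dickman_approx (Suc n)) u" for u
    proof -
      define b where "b = max 1 u + 1"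
      have c: "continuous_on {1..b} (\<lambda>v. dickman_approx n (v - 1) / v)"
        by (intro continuous_on_divide continuous_on_compose2[OF Suc]) (auto intro!: continuous_intros)
      then have "(\<lambda>v. dickman_approx n (v - 1) / v) integrable_on {1..b}"
        by (rule integrable_continuous_real)
      then have i: "continuous_on {1..b} (\<lambda>x. integral {1..x} (\<lambda>v. dickman_approx n (v - 1) / v))"
        by (rule indefinite_integral_continuous_1)
      have "continuous_on {..<b} (\<lambda>u. integral {1..max 1 u} (\<lambda>v. dickman_approx n (v - 1) / v))"
        by (rule continuous_on_compose2[OF i]) (auto intro!: continuous_intros simp: b_def)
      then have "continuous_on {..<b} (dickman_approx (Suc n))"
        by (auto intro!: continuous_intros)
      moreover have "u \<in> {..<b}" by (simp add: b_def)
      ultimately show ?thesis by (simp add: continuous_on_eq_continuous_at open_lessThan)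
    qed
    then show "continuous_on UNIV (dickman_approx (Suc n))"
      by (simp add: continuous_at_imp_continuous_on)
  qed
qed simp

lemma dickman_approx_Suc_eq:
  "u \<le> real n + 1 \<Longrightarrow> dickman_approx (Suc n) u = dickman_approx n u"
proof (induction n arbitrary: u)
  case 0
  then show ?case by simp
next
  case (Suc n)
  have "integral {1..max 1 u} (\<lambda>v. dickman_approx (Suc n) (v - 1) / v)
      = integral {1..max 1 u} (\<lambda>v. dickman_approx n (v - 1) / v)"
  proof (rule integral_cong)
    fix v assume "v \<in> {1..max 1 u}"
    then have "v - 1 \<le> real n + 1" using Suc.prems by auto
    then show "dickman_approx (Suc n) (v - 1) / v = dickman_approx n (v - 1) / v"
      using Suc.IH by metis
  qed
  then show ?case by simp
qed

lemma dickman_approx_stable: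
  assumes "u \<le> real n + 1" "n \<le> m"
  shows "dickman_approx m u = dickman_approx n u"
  using assms(2)
proof (induction m rule: dec_induct)
  case (step m)
  then show ?case using dickman_approx_Suc_eq[of u m] assms(1) by simp
qed simp

text \<open>For u \<ge> 0 the index \<lceil>u\<rceil> leaves u strictly below \<lceil>u\<rceil> + 1,
  the end of the interval on which the iterate is exact. The same iterate thus serves near u, as
  continuity and the derivative require.\<close>

definition dickman_fun :: "real \<Rightarrow> real" where
  "dickman_fun u = (if u < 0 then 0 else dickman_approx (nat \<lceil>u\<rceil>) u)"

lemma dickman_fun_eq_approx:
  assumes "0 \<le> u" "u \<le> real n + 1"
  shows "dickman_fun u = dickman_approx n u"
proof -
  have u: "u \<le> real (nat \<lceil>u\<rceil>) + 1" using assms by linarith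
  show ?thesis
    using dickman_approx_stable[OF assms(2), of "max n (nat \<lceil>u\<rceil>)"]
      dickman_approx_stable[OF u, of "max n (nat \<lceil>u\<rceil>)"] assms(1)
    by (simp add: dickman_fun_def)
qed

lemma continuous_dickman_fun: "continuous_on {0..} dickman_fun"
  unfolding continuous_on_eq_continuous_within
proof
  fix u :: real assume u: "u \<in> {0..}"
  define n where "n = nat \<lceil>u\<rceil>"
  have un: "u < real n + 1" unfolding n_def using u by (auto simp: ceiling_le_iff) linarith
  have "continuous_on {0..} (dickman_approx n)" by (rule continuous_dickman_approx)
  then have "continuous (at u within {0..}) (dickman_approx n)"
    using u continuous_on_eq_continuous_within by blast
  then show "continuous (at u within {0..}) dickman_fun"
  proof (rule continuous_transform_within[where \<delta> = "real n + 1 - u"])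
    fix x assume "x \<in> {0..}" "dist x u < real n + 1 - u"
    then have "0 \<le> x" "x \<le> real n + 1" by (auto simp: dist_real_def)
    then show "dickman_approx n x = dickman_fun x" using dickman_fun_eq_approx by simp
  qed (use u un in auto)
qed

lemma dickman_fun_le_1: "0 \<le> u \<Longrightarrow> u \<le> 1 \<Longrightarrow> dickman_fun u = 1"
  using dickman_fun_eq_approx[of u 0] by simp

text \<open>Near u the function is the iterate n + 1, which is 1 minus an integral of the iterate n,
  so the fundamental theorem applies; at u - 1 the iterate n is exact as well.\<close>

lemma dickman_fun_deriv:
  assumes "u > 1"
  shows "(dickman_fun has_real_derivative - dickman_fun (u - 1) / u) (at u)"
proof -
  define n where "n = nat \<lceil>u\<rceil>"
  have un: "u < real n + 1" unfolding n_def by linarith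
  have c: "continuous_on {1..real n + 1} (\<lambda>v. dickman_approx n (v - 1) / v)"
    by (intro continuous_on_divide continuous_on_compose2[OF continuous_dickman_approx])
      (auto intro!: continuous_intros)
  have "((\<lambda>x. integral {1..x} (\<lambda>v. dickman_approx n (v - 1) / v)) has_real_derivative
      dickman_approx n (u - 1) / u) (at u within {1..real n + 1})"
    by (rule integral_has_real_derivative[OF c]) (use assms un in auto)
  then have d: "((\<lambda>x. integral {1..x} (\<lambda>v. dickman_approx n (v - 1) / v)) has_real_derivative
      dickman_approx n (u - 1) / u) (at u)"
    using assms un by (simp add: at_within_Icc_at)
  have "((\<lambda>x. 1 - integral {1..x} (\<lambda>v. dickman_approx n (v - 1) / v)) has_real_derivative
      - (dickman_approx n (u - 1) / u)) (at u)"
    using DERIV_diff[OF DERIV_const[of 1] d] by simp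
  then have "(dickman_fun has_real_derivative - (dickman_approx n (u - 1) / u)) (at u)"
  proof (rule has_field_derivative_transform_within_open[where S = "{1<..<real n + 1}"])
    fix x :: real assume x: "x \<in> {1<..<real n + 1}"
    then have "dickman_fun x = dickman_approx (Suc n) x" by (intro dickman_fun_eq_approx) auto
    then show "1 - integral {1..x} (\<lambda>v. dickman_approx n (v - 1) / v) = dickman_fun x" using x by simp
  qed (use assms un in auto)
  moreover have "dickman_approx n (u - 1) = dickman_fun (u - 1)"
    using dickman_fun_eq_approx[of "u - 1" n] assms un by simp
  ultimately show ?thesis by simp
qed

section \<open>Characterisation by the delay differential equation\<close>

definition dickman_spec :: "(real \<Rightarrow> real) \<Rightarrow> bool" where
  "dickman_spec f \<longleftrightarrow> (\<forall>u<0. f u = 0) \<and> continuous_on {0..} f \<and> (\<forall>u\<in>{0..1}. f u = 1) \<and>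
     (\<forall>u>1. \<exists>D. (f has_real_derivative D) (at u) \<and> u * D + f (u - 1) = 0)"

lemma dickman_spec_dickman_fun: "dickman_spec dickman_fun"
  unfolding dickman_spec_def
proof (intro conjI allI impI ballI)
  fix u :: real assume "u > 1"
  then show "\<exists>D. (dickman_fun has_real_derivative D) (at u) \<and> u * D + dickman_fun (u - 1) = 0"
    using dickman_fun_deriv[of u] by (intro exI[of _ "- dickman_fun (u - 1) / u"]) simp
next
  fix u :: real assume "u < 0"
  then show "dickman_fun u = 0" by (simp add: dickman_fun_def)
qed (use continuous_dickman_fun dickman_fun_le_1 in auto)

text \<open>Method of steps: between n + 1 and n + 2 both derivatives are determined by the values
  at x - 1, where the functions already agree, so the difference is constant there.\<close>

lemma dickman_spec_unique:
  assumes f: "dickman_spec f" and g: "dickman_spec g"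
  shows "f = g"
proof -
  have eq: "f u = g u" if "0 \<le> u" "u \<le> real n + 1" for n u
    using that
  proof (induction n arbitrary: u)
    case 0
    then show ?case using f g by (simp add: dickman_spec_def)
  next
    case (Suc n)
    show ?case
    proof (cases "u \<le> real n + 1")
      case True
      then show ?thesis using Suc by simp
    next
      case False
      define a where "a = real n + 1"
      have au: "a < u" "u \<le> a + 1" "1 \<le> a" using False Suc.prems by (auto simp: a_def)
      have "f u - g u = f a - g a"
      proof (rule DERIV_isconst_end[where f = "\<lambda>u. f u - g u"])
        show "continuous_on {a..u} (\<lambda>u. f u - g u)"
          using f g au by (intro continuous_intros; auto simp: dickman_spec_def intro: continuous_on_subset)
      next
        fix x assume x: "a < x" "x < u"
        then have "x > 1" using au by simp
        then obtain D E where D: "(f has_real_derivative D) (at x)" "x * D + f (x - 1) = 0"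
          and E: "(g has_real_derivative E) (at x)" "x * E + g (x - 1) = 0"
          using f g unfolding dickman_spec_def by meson
        have "f (x - 1) = g (x - 1)" using Suc.IH[of "x - 1"] x au Suc.prems by simp
        then have "x * D = x * E" using D(2) E(2) by linarith
        then have "D = E" using \<open>x > 1\<close> by simp
        then show "((\<lambda>u. f u - g u) has_real_derivative 0) (at x)"
          using DERIV_diff[OF D(1) E(1)] by simp
      qed (use au in simp)
      moreover have "f a = g a" using Suc.IH[of a] by (simp add: a_def)
      ultimately show ?thesis by simp
    qed
  qed
  show ?thesis
  proof
    fix u
    show "f u = g u"
    proof (cases "u < 0")
      case True
      then show ?thesis using f g by (simp add: dickman_spec_def)
    next
      case False
      then show ?thesis using eq[of u "nat \<lceil>u\<rceil>"] by linarith
    qed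
  qed
qed

lemma dickman_spec_rho: "dickman_spec dickman_rho"
proof -
  have "dickman_rho = (THE f. dickman_spec f)" by (simp add: dickman_rho_def dickman_spec_def)
  also have "\<dots> = dickman_fun"
    using dickman_spec_dickman_fun dickman_spec_unique by (intro the_equality) auto
  finally show ?thesis using dickman_spec_dickman_fun by simp
qed

lemma continuous_dickman_rho: "continuous_on {0..} dickman_rho"
  and dickman_rho_le_1_eq: "0 \<le> u \<Longrightarrow> u \<le> 1 \<Longrightarrow> dickman_rho u = 1"
  and dickman_rho_neg: "u < 0 \<Longrightarrow> dickman_rho u = 0"
  using dickman_spec_rho by (auto simp: dickman_spec_def)

lemma dickman_rho_deriv:
  assumes "u > 1"
  shows "(dickman_rho has_real_derivative - dickman_rho (u - 1) / u) (at u)"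
proof -
  obtain D where D: "(dickman_rho has_real_derivative D) (at u)" "u * D + dickman_rho (u - 1) = 0"
    using dickman_spec_rho assms by (auto simp: dickman_spec_def)
  have "D = - dickman_rho (u - 1) / u" using D(2) assms by (simp add: field_simps)
  then show ?thesis using D(1) by simp
qed

text \<open>The identity of u \<rho>(u) with the integral of \<rho> over [u - 1, u], written with
  integrals from 0 so that it can be differentiated. Both sides have the derivative \<rho>(u) -
  \<rho>(u - 1) and equal 1 at u = 1.\<close>

lemma dickman_rho_integral:
  assumes "u > 1"
  shows "u * dickman_rho u = integral {0..u} dickman_rho - integral {0..u-1} dickman_rho"
proof -
  define F where "F = (\<lambda>u. integral {0..u} dickman_rho)"
  have cont: "continuous_on {0..b} dickman_rho" for b
    using continuous_dickman_rho by (rule continuous_on_subset) auto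
  have F': "(F has_real_derivative dickman_rho x) (at x)" if "x > 0" for x
  proof -
    have "(F has_real_derivative dickman_rho x) (at x within {0..x+1})"
      unfolding F_def by (rule integral_has_real_derivative[OF cont]) (use that in auto)
    then show ?thesis using that by (simp add: at_within_Icc_at)
  qed
  have contF: "continuous_on {0..b} F" for b
    unfolding F_def by (rule indefinite_integral_continuous_1) (rule integrable_continuous_real[OF cont])
  define H where "H = (\<lambda>u. u * dickman_rho u - (F u - F (u - 1)))"
  have "H u = H 1"
  proof (rule DERIV_isconst_end[where f = H])
    have "continuous_on {1..u} dickman_rho" by (rule continuous_on_subset[OF cont[of u]]) auto
    moreover have "continuous_on {1..u} F" by (rule continuous_on_subset[OF contF[of u]]) auto
    moreover have "continuous_on {1..u} (\<lambda>x. F (x - 1))"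
      by (rule continuous_on_compose2[OF contF[of u]]) (auto intro!: continuous_intros)
    ultimately show "continuous_on {1..u} H" unfolding H_def
      by (intro continuous_on_diff continuous_on_mult continuous_on_id)
  next
    fix x assume x: "1 < x" "x < u"
    have "((\<lambda>x. F (x - 1)) has_real_derivative dickman_rho (x - 1) * (1 - 0)) (at x)"
      by (rule DERIV_chain2[OF F']) (use x in \<open>auto intro!: derivative_eq_intros\<close>)
    then have "(H has_real_derivative
        (x * (- dickman_rho (x - 1) / x) + 1 * dickman_rho x) - (dickman_rho x - dickman_rho (x - 1))) (at x)"
      unfolding H_def using x
      by (intro DERIV_diff DERIV_mult' DERIV_ident dickman_rho_deriv F') auto
    then show "(H has_real_derivative 0) (at x)" using x by simp
  qed (use assms in simp)
  moreover have "H 1 = 0"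
  proof -
    have "F 1 = integral {0..1} (\<lambda>_ :: real. 1 :: real)"
      unfolding F_def by (rule integral_cong) (simp add: dickman_rho_le_1_eq)
    then have "F 1 = 1" by simp
    moreover have "F 0 = 0" by (simp add: F_def)
    ultimately show ?thesis by (simp add: H_def dickman_rho_le_1_eq)
  qed
  ultimately show ?thesis by (simp add: H_def F_def)
qed

text \<open>Compactness provides a least v with \<rho>(v) \<le> 0. There v \<rho>(v) is the mean of
  \<rho> over [v - 1, v], hence equal to \<rho>(z) for some z < v, and \<rho>(z) > 0 by
  minimality.\<close>

lemma dickman_rho_pos:
  assumes "u \<ge> 0"
  shows "dickman_rho u > 0"
proof (rule ccontr)
  assume not: "\<not> dickman_rho u > 0"
  define S where "S = {x \<in> {0..u}. dickman_rho x \<le> 0}"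
  have cont: "continuous_on {0..b} dickman_rho" for b
    using continuous_dickman_rho by (rule continuous_on_subset) auto
  have "closed S" unfolding S_def
    by (rule continuous_on_closed_Collect_le) (auto intro: cont continuous_intros)
  moreover have "bounded S" unfolding S_def by (rule bounded_subset[of "{0..u}"]) auto
  ultimately have "compact S" by (simp add: compact_eq_bounded_closed)
  moreover have "S \<noteq> {}" using not assms by (auto simp: S_def)
  ultimately obtain v where v: "v \<in> S" and min: "\<And>w. w \<in> S \<Longrightarrow> v \<le> w"
    using compact_attains_inf by metis
  have v1: "v > 1"
  proof (rule ccontr)
    assume "\<not> v > 1"
    then show False using v dickman_rho_le_1_eq[of v] by (auto simp: S_def)
  qed
  have "\<exists>z. v - 1 < z \<and> z < v \<and> integral {0..v} dickman_rho - integral {0..v-1} dickman_rho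
      = (v - (v - 1)) * dickman_rho z"
  proof (rule MVT2)
    fix x assume x: "v - 1 \<le> x" "x \<le> v"
    have "((\<lambda>u. integral {0..u} dickman_rho) has_real_derivative dickman_rho x) (at x within {0..x+1})"
      by (rule integral_has_real_derivative[OF cont]) (use x v1 in auto)
    then show "((\<lambda>u. integral {0..u} dickman_rho) has_real_derivative dickman_rho x) (at x)"
      using x v1 by (simp add: at_within_Icc_at)
  qed simp
  then obtain z where z: "v - 1 < z" "z < v" "v * dickman_rho v = dickman_rho z"
    using dickman_rho_integral[OF v1] by auto
  have "z \<notin> S" using min z(2) by force
  then have "dickman_rho z > 0" using z v v1 by (auto simp: S_def)
  moreover have "v * dickman_rho v \<le> 0" using v v1 by (auto simp: S_def intro: mult_nonneg_nonpos)
  ultimately show False using z(3) by simp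
qed

section \<open>Monotonicity and local approximation of the Dickman function\<close>

lemma dickman_rho_MVT:
  assumes "1 \<le> a" "a < b"
  obtains z where "a < z" "z < b" "dickman_rho b - dickman_rho a = (b - a) * (- dickman_rho (z - 1) / z)"
proof -
  have "\<exists>l z. a < z \<and> z < b \<and> (dickman_rho has_real_derivative l) (at z) \<and> dickman_rho b - dickman_rho a = (b - a) * l"
  proof (rule MVT[OF assms(2)])
    show "continuous_on {a..b} dickman_rho"
      using continuous_dickman_rho by (rule continuous_on_subset) (use assms in auto)
  qed (use assms dickman_rho_deriv in \<open>force simp: real_differentiable_def\<close>)
  then obtain l z where z: "a < z" "z < b" "(dickman_rho has_real_derivative l) (at z)"
    "dickman_rho b - dickman_rho a = (b - a) * l" by blast
  moreover have "l = - dickman_rho (z - 1) / z"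
    using DERIV_unique[OF z(3) dickman_rho_deriv[of z]] z assms by simp
  ultimately show ?thesis using that by blast
qed

lemma dickman_rho_antimono:
  assumes "0 \<le> a" "a \<le> b"
  shows "dickman_rho b \<le> dickman_rho a"
proof -
  have *: "dickman_rho b \<le> dickman_rho a" if ab: "1 \<le> a" "a < b" for a b
  proof -
    obtain z where z: "a < z" "z < b" "dickman_rho b - dickman_rho a = (b - a) * (- dickman_rho (z - 1) / z)"
      using dickman_rho_MVT[OF ab] .
    have "dickman_rho (z - 1) / z \<ge> 0" using z ab dickman_rho_pos[of "z - 1"] by simp
    then have "(b - a) * (dickman_rho (z - 1) / z) \<ge> 0" using ab by (intro mult_nonneg_nonneg) auto
    then show ?thesis using z(3) by simp
  qed
  show ?thesis
  proof (cases "b \<le> 1")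
    case True
    then show ?thesis using assms dickman_rho_le_1_eq by simp
  next
    case b: False
    show ?thesis
    proof (cases "a \<le> 1")
      case True
      then show ?thesis using *[of 1 b] b assms dickman_rho_le_1_eq[of a] dickman_rho_le_1_eq[of 1] by simp
    next
      case False
      then show ?thesis using *[of a b] assms by (cases "a = b") auto
    qed
  qed
qed

lemma dickman_rho_le_1: "dickman_rho u \<le> 1"
proof (cases "u < 0")
  case False
  then show ?thesis using dickman_rho_antimono[of 0 u] dickman_rho_le_1_eq[of 0] by simp
qed (simp add: dickman_rho_neg)

text \<open>Beyond 1 the derivative -\<rho>(z - 1) / z is at most 1 in modulus, and up to 1 the
  function is constant; the corner at 1 is the reason for cutting the interval there.\<close>

lemma dickman_rho_lipschitz:
  assumes "0 \<le> a" "a \<le> b"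
  shows "dickman_rho a - dickman_rho b \<le> b - a"
proof -
  have *: "dickman_rho a - dickman_rho b \<le> b - a" if ab: "1 \<le> a" "a < b" for a b
  proof -
    obtain z where z: "a < z" "z < b" "dickman_rho b - dickman_rho a = (b - a) * (- dickman_rho (z - 1) / z)"
      using dickman_rho_MVT[OF ab] .
    have "dickman_rho (z - 1) / z \<le> 1" using z ab dickman_rho_le_1[of "z - 1"] by simp
    then have "(b - a) * (dickman_rho (z - 1) / z) \<le> (b - a) * 1" using ab by (intro mult_left_mono) auto
    then show ?thesis using z(3) by simp
  qed
  show ?thesis
  proof (cases "b \<le> 1")
    case True
    then show ?thesis using assms dickman_rho_le_1_eq by simp
  next
    case b: False
    show ?thesis
    proof (cases "a \<le> 1")
      case True
      then show ?thesis using *[of 1 b] b assms dickman_rho_le_1_eq[of a] dickman_rho_le_1_eq[of 1] by simp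
    next
      case False
      then show ?thesis using *[of a b] assms by (cases "a = b") auto
    qed
  qed
qed

text \<open>Freezing \<rho>(t - 1) at t = a in the equation \<rho>'(t) = -\<rho>(t - 1) / t and
  integrating gives ln (b / a) \<rho>(a - 1). The auxiliary \<open>G\<close> has the derivative
  (\<rho>(a - 1) - \<rho>(t - 1)) / t, which lies between 0 and b - a. This is the continuous
  counterpart of a Buchstab step.\<close>

lemma dickman_rho_step:
  assumes "1 \<le> a" "a \<le> b"
  shows "\<bar>dickman_rho a - dickman_rho b - ln (b / a) * dickman_rho (a - 1)\<bar> \<le> (b - a)\<^sup>2"
proof (cases "a = b")
  case False
  then have ab: "a < b" using assms by simp
  define G where "G = (\<lambda>t. dickman_rho t + dickman_rho (a - 1) * ln t)"
  have "\<exists>l z. a < z \<and> z < b \<and> (G has_real_derivative l) (at z) \<and> G b - G a = (b - a) * l"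
  proof (rule MVT[OF ab])
    show "continuous_on {a..b} G" unfolding G_def
      using assms by (intro continuous_intros continuous_on_subset[OF continuous_dickman_rho]) auto
  next
    fix x assume x: "a < x" "x < b"
    have "(G has_real_derivative - dickman_rho (x - 1) / x + dickman_rho (a - 1) * (1 / x)) (at x)"
      unfolding G_def using x assms by (intro DERIV_add dickman_rho_deriv DERIV_cmult DERIV_ln_divide) auto
    then show "G differentiable at x" using real_differentiable_def by blast
  qed
  then obtain l z where z: "a < z" "z < b" "(G has_real_derivative l) (at z)" "G b - G a = (b - a) * l"
    by blast
  have "(G has_real_derivative - dickman_rho (z - 1) / z + dickman_rho (a - 1) * (1 / z)) (at z)"
    unfolding G_def using z assms by (intro DERIV_add dickman_rho_deriv DERIV_cmult DERIV_ln_divide) auto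
  then have l: "l = (dickman_rho (a - 1) - dickman_rho (z - 1)) / z"
    using DERIV_unique[OF z(3)] by (simp add: diff_divide_distrib)
  have "0 \<le> dickman_rho (a - 1) - dickman_rho (z - 1)"
    using dickman_rho_antimono[of "a - 1" "z - 1"] z assms by simp
  then have l0: "0 \<le> l" using l z assms by simp
  have "dickman_rho (a - 1) - dickman_rho (z - 1) \<le> z - a"
    using dickman_rho_lipschitz[of "a - 1" "z - 1"] z assms by simp
  also have "\<dots> \<le> (b - a) * z" using z assms mult_mono[of "z - a" "b - a" 1 z] by simp
  finally have l1: "l \<le> b - a" using l z assms by (simp add: divide_le_eq)
  have "(b - a) * l \<le> (b - a)\<^sup>2" using l1 ab by (simp add: power2_eq_square)
  moreover have "(b - a) * l \<ge> 0" using l0 ab by simp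
  moreover have lnd: "ln (b / a) = ln b - ln a" using assms ab by (intro ln_divide_pos) auto
  have "dickman_rho a - dickman_rho b - ln (b / a) * dickman_rho (a - 1) = - (G b - G a)"
    unfolding G_def lnd by (simp add: algebra_simps)
  ultimately show ?thesis using z(4) by linarith
qed (use assms in simp)

section \<open>Smooth integers\<close>

definition smooth_nums :: "real \<Rightarrow> real \<Rightarrow> nat set" where
  "smooth_nums x y = {n. n \<ge> 1 \<and> real n \<le> x \<and> (\<forall>p. prime p \<and> p dvd n \<longrightarrow> real p \<le> y)}"

definition smooth_count :: "real \<Rightarrow> real \<Rightarrow> nat" where
  "smooth_count x y = card (smooth_nums x y)"

lemma smooth_nums_subset: "smooth_nums x y \<subseteq> {1..nat \<lfloor>x\<rfloor>}"
  by (auto simp: smooth_nums_def le_nat_floor)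

lemma finite_smooth_nums [simp, intro]: "finite (smooth_nums x y)"
  using smooth_nums_subset by (rule finite_subset) simp

lemma smooth_count_le: "x \<ge> 0 \<Longrightarrow> real (smooth_count x y) \<le> x"
proof -
  assume x: "x \<ge> 0"
  have "smooth_count x y \<le> nat \<lfloor>x\<rfloor>"
    using card_mono[OF _ smooth_nums_subset[of x y]] by (simp add: smooth_count_def)
  then show ?thesis using x by linarith
qed

lemma smooth_count_trivial:
  assumes "x \<le> y"
  shows "smooth_count x y = nat \<lfloor>x\<rfloor>"
proof -
  have "smooth_nums x y = {1..nat \<lfloor>x\<rfloor>}"
  proof (intro equalityI smooth_nums_subset subsetI)
    fix n assume n: "n \<in> {1..nat \<lfloor>x\<rfloor>}"
    then have "int n \<le> \<lfloor>x\<rfloor>" by auto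
    then have nx: "real n \<le> x" by (simp add: le_floor_iff)
    have "real p \<le> y" if "p dvd n" for p
    proof -
      have "p \<le> n" using that n by (intro dvd_imp_le) auto
      then show ?thesis using nx assms by linarith
    qed
    then show "n \<in> smooth_nums x y" using n nx by (auto simp: smooth_nums_def)
  qed
  then show ?thesis by (simp add: smooth_count_def)
qed

lemma mult_mem_smooth_nums:
  assumes p: "prime p" and m: "m \<in> smooth_nums (x / real p) (real p)"
  shows "p * m \<ge> 1" "real (p * m) \<le> x" "\<And>q. prime q \<Longrightarrow> q dvd p * m \<Longrightarrow> q \<le> p"
proof -
  have p0: "p > 0" using p prime_gt_0_nat by blast
  show "p * m \<ge> 1" using p0 m by (simp add: smooth_nums_def Suc_le_eq)
  show "real (p * m) \<le> x" using p0 m by (simp add: smooth_nums_def field_simps)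
  fix q assume q: "prime q" "q dvd p * m"
  then have "q dvd p \<or> q dvd m" by (simp add: prime_dvd_mult_iff)
  then show "q \<le> p"
  proof
    assume "q dvd p" then show ?thesis using p0 by (rule dvd_imp_le)
  next
    assume "q dvd m" then show ?thesis using m q by (auto simp: smooth_nums_def)
  qed
qed

lemma abs_mult_diff: "0 \<le> c \<Longrightarrow> \<bar>c * a - c * b\<bar> = c * \<bar>a - b\<bar>" for a b c :: real
  by (simp add: right_diff_distrib[symmetric] abs_mult)

text \<open>The integers that are z-smooth but not y-smooth are sorted by their largest prime factor
  p. The cofactor may still contain p, which is why its own smoothness bound is p.\<close>

lemma buchstab_identity:
  assumes yz: "y \<le> z"
  shows "real (smooth_count x z) = real (smooth_count x y)
    + (\<Sum>p | prime p \<and> y < real p \<and> real p \<le> z. real (smooth_count (x / real p) (real p)))"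
proof -
  define P where "P = {p::nat. prime p \<and> y < real p \<and> real p \<le> z}"
  have finP: "finite P" unfolding P_def by (rule finite_primes_Ioc)
  define T where "T = (\<lambda>p. (\<lambda>m. p * m) ` smooth_nums (x / real p) (real p))"
  have split: "smooth_nums x z = smooth_nums x y \<union> (\<Union>p\<in>P. T p)"
  proof (intro equalityI subsetI)
    fix n assume n: "n \<in> smooth_nums x z"
    then have n1: "n \<ge> 1" "real n \<le> x" and sm: "\<And>p. prime p \<Longrightarrow> p dvd n \<Longrightarrow> real p \<le> z"
      by (auto simp: smooth_nums_def)
    show "n \<in> smooth_nums x y \<union> (\<Union>p\<in>P. T p)"
    proof (cases "n \<in> smooth_nums x y")
      case False
      then obtain q where q: "prime q" "q dvd n" "real q > y" using n1 by (force simp: smooth_nums_def)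
      define p where "p = Max (prime_factors n)"
      have ne: "q \<in> prime_factors n" using q n1 by (auto simp: prime_factors_dvd)
      then have pin: "p \<in> prime_factors n" unfolding p_def by (intro Max_in) auto
      have pmax: "r \<le> p" if "r \<in> prime_factors n" for r unfolding p_def using that by simp
      have p: "prime p" "p dvd n" using pin by (auto simp: prime_factors_dvd)
      have "y < real p" using pmax[OF ne] q by linarith
      then have pP: "p \<in> P" using p sm by (simp add: P_def)
      obtain m where m: "n = p * m" using p(2) by blast
      have p0: "p > 0" using p prime_gt_0_nat by blast
      have "m \<in> smooth_nums (x / real p) (real p)"
      proof -
        have "m \<ge> 1" using n1 m by (cases m) auto
        moreover have "real m \<le> x / real p" using n1(2) p0 unfolding m by (simp add: field_simps)
        moreover have "r \<le> p" if "prime r" "r dvd m" for r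
          using pmax[of r] that n1 m by (auto simp: prime_factors_dvd)
        ultimately show ?thesis by (auto simp: smooth_nums_def)
      qed
      then show ?thesis using pP m by (auto simp: T_def)
    qed simp
  next
    fix n assume "n \<in> smooth_nums x y \<union> (\<Union>p\<in>P. T p)"
    then show "n \<in> smooth_nums x z"
    proof
      assume "n \<in> smooth_nums x y"
      then show ?thesis by (auto simp: smooth_nums_def intro: order_trans[OF _ yz])
    next
      assume "n \<in> (\<Union>p\<in>P. T p)"
      then obtain p m where p: "p \<in> P" "m \<in> smooth_nums (x / real p) (real p)" "n = p * m"
        by (auto simp: T_def)
      have pr: "prime p" "real p \<le> z" using p(1) by (auto simp: P_def)
      have "real q \<le> z" if "prime q" "q dvd n" for q
        using mult_mem_smooth_nums(3)[OF pr(1) p(2), of q] that pr(2) unfolding p(3) by linarith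
      then show ?thesis using mult_mem_smooth_nums(1,2)[OF pr(1) p(2)] unfolding smooth_nums_def p(3) by blast
    qed
  qed
  have disj1: "smooth_nums x y \<inter> (\<Union>p\<in>P. T p) = {}"
  proof -
    have False if "p \<in> P" "p * m \<in> smooth_nums x y" for p m
      using that by (auto simp: P_def smooth_nums_def)
    then show ?thesis by (auto simp: T_def)
  qed
  have disj2: "T p \<inter> T q = {}" if pq: "p \<in> P" "q \<in> P" "p \<noteq> q" for p q
  proof (rule ccontr)
    assume "T p \<inter> T q \<noteq> {}"
    then obtain m k where mk: "m \<in> smooth_nums (x / real p) (real p)" "k \<in> smooth_nums (x / real q) (real q)"
      "p * m = q * k" by (auto simp: T_def)
    have pr: "prime p" "prime q" using pq by (auto simp: P_def)
    have "p \<le> q" using mult_mem_smooth_nums(3)[OF pr(2) mk(2) pr(1)] mk(3) by (metis dvd_triv_left)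
    moreover have "q \<le> p" using mult_mem_smooth_nums(3)[OF pr(1) mk(1) pr(2)] mk(3) by (metis dvd_triv_left)
    ultimately show False using pq by simp
  qed
  have cT: "card (T p) = smooth_count (x / real p) (real p)" if "p \<in> P" for p
  proof -
    have "p > 0" using that prime_gt_0_nat by (auto simp: P_def)
    then show ?thesis unfolding T_def smooth_count_def by (intro card_image inj_onI) auto
  qed
  have finT: "finite (T p)" for p by (simp add: T_def)
  have "card (\<Union>p\<in>P. T p) = (\<Sum>p\<in>P. card (T p))"
    by (rule card_UN_disjoint[OF finP]) (use finT disj2 in auto)
  also have "\<dots> = (\<Sum>p\<in>P. smooth_count (x / real p) (real p))" by (rule sum.cong) (use cT in auto)
  finally have c: "card (\<Union>p\<in>P. T p) = (\<Sum>p\<in>P. smooth_count (x / real p) (real p))" .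
  have "smooth_count x z = card (smooth_nums x y) + card (\<Union>p\<in>P. T p)"
    unfolding smooth_count_def split using finP finT disj1 by (intro card_Un_disjoint) auto
  then have "smooth_count x z = smooth_count x y + (\<Sum>p\<in>P. smooth_count (x / real p) (real p))"
    unfolding c by (simp add: smooth_count_def)
  then show ?thesis unfolding P_def[symmetric] by simp
qed

definition dickman_error :: "real \<Rightarrow> real \<Rightarrow> real" where
  "dickman_error x y = \<bar>real (smooth_count x y) - x * dickman_rho (ln x / ln y)\<bar>"

lemma dickman_error_initial:
  assumes "1 \<le> x" "x \<le> y" "2 \<le> y"
  shows "dickman_error x y \<le> 1"
proof -
  have "ln x / ln y \<le> 1" "0 \<le> ln x / ln y" using assms by (auto simp: field_simps)
  then have "dickman_rho (ln x / ln y) = 1" by (intro dickman_rho_le_1_eq) auto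
  then have "dickman_error x y = \<bar>real (nat \<lfloor>x\<rfloor>) - x\<bar>"
    using smooth_count_trivial[OF assms(2)] by (simp add: dickman_error_def)
  then show ?thesis using assms(1) by linarith
qed

text \<open>One Buchstab step: the smoothness bound is lowered from \<open>x\<^sup>1\<^sup>/\<^sup>v\<close> to \<open>x\<^sup>1\<^sup>/\<^sup>w\<close>, where \<open>v\<close> and \<open>w\<close>
  are close.\<close>

lemma buchstab_step:
  fixes k :: nat
  assumes k: "1 \<le> k" and x: "x > 1" and vw: "real k \<le> v" "v \<le> w" "w \<le> real k + 1" "w - v \<le> d"
    and y: "Y \<le> y" "2 \<le> y" "ln x = w' * ln y" "w \<le> w'"
    and IH: "\<And>x y. 1 \<le> x \<Longrightarrow> Y \<le> y \<Longrightarrow> x \<le> y ^ k \<Longrightarrow> dickman_error x y \<le> e * x + 1"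
    and K: "K \<ge> 0" "\<And>a b. 2 \<le> a \<Longrightarrow> a \<le> b \<Longrightarrow>
      \<bar>(\<Sum>p | prime p \<and> a < real p \<and> real p \<le> b. 1 / real p) - (ln (ln b) - ln (ln a))\<bar> \<le> K / ln a"
    and e: "e \<ge> 0"
  defines "D \<equiv> \<lambda>v. real (smooth_count x (exp (ln x / v))) - x * dickman_rho v"
  shows "\<bar>D v - D w\<bar> \<le> x * (d\<^sup>2 + (e + d) * (d + K / ln y) + K / ln y)
    + real (card {p. prime p \<and> exp (ln x / w) < real p \<and> real p \<le> exp (ln x / v)})"
proof -
  define L where "L = ln x"
  define zv where "zv = exp (L / v)"
  define zw where "zw = exp (L / w)"
  define P where "P = {p::nat. prime p \<and> zw < real p \<and> real p \<le> zv}"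
  define S where "S = (\<Sum>p\<in>P. 1 / real p)"
  define \<kappa> where "\<kappa> = K / ln y"
  define \<rho> where "\<rho> = dickman_rho (v - 1)"
  have L0: "L > 0" using x by (simp add: L_def)
  have pos: "v \<ge> 1" "w \<ge> 1" using k vw by linarith+
  have d0: "0 \<le> d" using vw by linarith
  have ly: "ln y > 0" using y by simp
  \<comment> \<open>Since w \<le> w', all primes of the step exceed y; this bounds the Mertens error
    by K / ln y and lets the induction hypothesis apply to every such prime.\<close>
  have yzw: "y \<le> zw"
  proof -
    have "ln y = L / w'" using y pos by (simp add: L_def)
    also have "\<dots> \<le> L / w" using L0 pos y(4) by (intro divide_left_mono) auto
    finally have "exp (ln y) \<le> zw" unfolding zw_def by simp
    then show ?thesis using y by simp
  qed
  have zle: "zw \<le> zv" unfolding zw_def zv_def using L0 pos vw by (auto intro!: divide_left_mono)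
  have zv_x: "zv \<le> x"
  proof -
    have "L / v \<le> L" using L0 pos by (simp add: field_simps)
    then have "zv \<le> exp L" by (simp add: zv_def)
    then show ?thesis using x by (simp add: L_def)
  qed
  have \<kappa>0: "\<kappa> \<ge> 0" using K(1) ly by (simp add: \<kappa>_def)
  \<comment> \<open>By Mertens the sum of 1 / p over \<open>P\<close> is ln ln zv - ln ln zw = ln (w
    / v) up to \<kappa>; the same logarithm appears in \<open>dickman_rho_step\<close>.\<close>
  define lam where "lam = ln (w / v)"
  have lam: "0 \<le> lam" "lam \<le> d"
  proof -
    show "0 \<le> lam" using vw pos by (simp add: lam_def)
    have "lam \<le> w / v - 1" unfolding lam_def using pos by (intro ln_le_minus_one) auto
    also have "\<dots> = (w - v) / v" using pos by (simp add: field_simps)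
    also have "\<dots> \<le> (w - v) / 1" using pos vw by (intro divide_left_mono) auto
    finally show "lam \<le> d" using vw by simp
  qed
  have "\<bar>S - (ln (ln zv) - ln (ln zw))\<bar> \<le> K / ln zw"
    unfolding S_def P_def using K(2)[of zw zv] yzw y zle by simp
  moreover have "ln (ln zv) - ln (ln zw) = lam"
    unfolding zv_def zw_def lam_def using L0 pos by (simp add: ln_divide_pos)
  moreover have "K / ln zw \<le> \<kappa>" unfolding \<kappa>_def using K(1) ly yzw y by (intro divide_left_mono) auto
  ultimately have Slam: "\<bar>S - lam\<bar> \<le> \<kappa>" by linarith
  have S0: "S \<ge> 0" unfolding S_def by (intro sum_nonneg) auto
  have S1: "S \<le> d + \<kappa>" using Slam lam by linarith
  have \<rho>: "0 \<le> \<rho>" "\<rho> \<le> 1"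
    unfolding \<rho>_def using dickman_rho_pos[of "v - 1"] dickman_rho_le_1 pos by (auto simp: less_imp_le)
  have each: "\<bar>real (smooth_count (x / real p) (real p)) - x * \<rho> * (1 / real p)\<bar> \<le> (e + d) * x * (1 / real p) + 1"
    if p: "p \<in> P" for p
  proof -
    have p': "zw < real p" "real p \<le> zv" using p by (auto simp: P_def)
    have py: "y < real p" "2 \<le> real p" using p' yzw y by linarith+
    have lp: "0 < ln (real p)" using py by simp
    have lpv: "ln (real p) \<le> L / v" using p'(2) py unfolding zv_def by (metis exp_le_cancel_iff exp_ln less_le_trans zero_less_numeral)
    have lpw: "L / w < ln (real p)" using p'(1) py unfolding zw_def by (metis exp_less_cancel_iff exp_ln less_le_trans zero_less_numeral)
    \<comment> \<open>For p in \<open>P\<close> the ratio t = ln x / ln p lies between v and w. So x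
      / p has the ratio t - 1 \<le> k with respect to p, within reach of the induction hypothesis,
      and \<rho>(t - 1) may be replaced by \<rho>(v - 1) at the cost d.\<close>
    define t where "t = L / ln (real p)"
    have tv: "v \<le> t" using lpv lp pos by (simp add: t_def field_simps)
    have tw: "t \<le> w" using lpw lp pos by (simp add: t_def field_simps)
    have px: "1 \<le> x / real p" using p'(2) zv_x py by (simp add: field_simps)
    have lxp: "ln (x / real p) = L - ln (real p)" using x py by (simp add: ln_divide_pos L_def)
    have rat: "ln (x / real p) / ln (real p) = t - 1" unfolding lxp t_def using lp by (simp add: field_simps)
    have "ln (x / real p) = (t - 1) * ln (real p)" using rat lp by (simp add: field_simps)
    also have "\<dots> \<le> real k * ln (real p)" using tw vw lp by (intro mult_right_mono) auto
    also have "\<dots> = ln (real p ^ k)" using py by (simp add: ln_realpow)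
    finally have "x / real p \<le> real p ^ k" using px py by (simp add: ln_le_cancel_iff)
    then have "dickman_error (x / real p) (real p) \<le> e * (x / real p) + 1"
      using IH[of "x / real p" "real p"] px py y by simp
    then have 1: "\<bar>real (smooth_count (x / real p) (real p)) - x / real p * dickman_rho (t - 1)\<bar> \<le> e * (x / real p) + 1"
      unfolding dickman_error_def rat .
    have "\<bar>dickman_rho (t - 1) - \<rho>\<bar> \<le> d"
      unfolding \<rho>_def using dickman_rho_lipschitz[of "v - 1" "t - 1"] dickman_rho_antimono[of "v - 1" "t - 1"] tv tw vw pos
      by linarith
    then have "x / real p * \<bar>dickman_rho (t - 1) - \<rho>\<bar> \<le> x / real p * d" using px by (intro mult_left_mono) auto
    then have 2: "\<bar>x / real p * dickman_rho (t - 1) - x / real p * \<rho>\<bar> \<le> x / real p * d"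
      using px abs_mult_diff[of "x / real p"] by simp
    have eq: "x * \<rho> * (1 / real p) = x / real p * \<rho>" "(e + d) * x * (1 / real p) = e * (x / real p) + x / real p * d"
      by (simp_all add: algebra_simps add_divide_distrib)
    have "\<bar>a - b\<bar> \<le> E \<Longrightarrow> \<bar>b - c\<bar> \<le> F \<Longrightarrow> \<bar>a - c\<bar> \<le> E + F" for a b c E F :: real by linarith
    from this[OF 1 2] show ?thesis unfolding eq by (simp only: add_ac)
  qed
  have finP: "finite P" unfolding P_def by (rule finite_primes_Ioc)
  have "\<bar>(\<Sum>p\<in>P. real (smooth_count (x / real p) (real p))) - x * \<rho> * S\<bar>
      = \<bar>\<Sum>p\<in>P. (real (smooth_count (x / real p) (real p)) - x * \<rho> * (1 / real p))\<bar>"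
    by (simp add: S_def sum_subtractf sum_distrib_left)
  also have "\<dots> \<le> (\<Sum>p\<in>P. (e + d) * x * (1 / real p) + 1)"
    by (rule order_trans[OF sum_abs sum_mono]) (rule each)
  also have "\<dots> = (e + d) * x * S + real (card P)"
    by (simp add: S_def sum.distrib sum_distrib_left)
  also have "\<dots> \<le> (e + d) * x * (d + \<kappa>) + real (card P)"
    using S1 e d0 x by (intro add_right_mono mult_left_mono) auto
  finally have main: "\<bar>(\<Sum>p\<in>P. real (smooth_count (x / real p) (real p))) - x * \<rho> * S\<bar>
      \<le> (e + d) * x * (d + \<kappa>) + real (card P)" .
  have "x * \<rho> * \<bar>S - lam\<bar> \<le> x * 1 * \<kappa>" using Slam \<rho> x by (intro mult_mono) auto
  then have t2: "\<bar>x * \<rho> * S - x * \<rho> * lam\<bar> \<le> x * \<kappa>"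
    using x \<rho> abs_mult_diff[of "x * \<rho>" S lam] by simp
  have "\<bar>dickman_rho v - dickman_rho w - lam * \<rho>\<bar> \<le> (w - v)\<^sup>2"
    unfolding lam_def \<rho>_def by (rule dickman_rho_step) (use pos vw in auto)
  also have "\<dots> \<le> d\<^sup>2" using vw by (intro power_mono) auto
  finally have "x * \<bar>dickman_rho v - dickman_rho w - lam * \<rho>\<bar> \<le> x * d\<^sup>2" using x by (intro mult_left_mono) auto
  then have t3: "\<bar>x * dickman_rho v - x * dickman_rho w - x * \<rho> * lam\<bar> \<le> x * d\<^sup>2"
    using x abs_mult_diff[of x "dickman_rho v - dickman_rho w" "lam * \<rho>"] by (simp add: algebra_simps)
  have "real (smooth_count x zv) = real (smooth_count x zw) + (\<Sum>p\<in>P. real (smooth_count (x / real p) (real p)))"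
    unfolding P_def by (rule buchstab_identity[OF zle])
  \<comment> \<open>The sum over primes is close to x \<rho>(v - 1) ln (w / v), and so is x
    (\<rho>(v) - \<rho>(w)); the main terms cancel in this difference.\<close>
  then have "D v - D w = (\<Sum>p\<in>P. real (smooth_count (x / real p) (real p))) - (x * dickman_rho v - x * dickman_rho w)"
    unfolding D_def zv_def zw_def L_def by simp
  then have "\<bar>D v - D w\<bar> \<le> (e + d) * x * (d + \<kappa>) + real (card P) + x * \<kappa> + x * d\<^sup>2"
    using main t2 t3 by linarith
  also have "\<dots> = x * (d\<^sup>2 + (e + d) * (d + \<kappa>) + \<kappa>) + real (card P)" by (simp add: algebra_simps)
  finally show ?thesis unfolding \<kappa>_def P_def zv_def zw_def L_def .
qed

lemma dickman_error_nat:
  assumes "1 \<le> k" "\<epsilon> > 0"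
  shows "\<exists>Y\<ge>2. \<forall>y\<ge>Y. \<forall>x\<ge>1. x \<le> y ^ k \<longrightarrow> dickman_error x y \<le> \<epsilon> * x + 1"
  using assms
proof (induction k arbitrary: \<epsilon> rule: dec_induct)
  case base
  have "dickman_error x y \<le> \<epsilon> * x + 1" if "y \<ge> 2" "x \<ge> 1" "x \<le> y" for x y :: real
  proof -
    have "0 \<le> \<epsilon> * x" using that base by simp
    then show ?thesis using dickman_error_initial[of x y] that by linarith
  qed
  then show ?case by (intro exI[of _ 2]) auto
next
  case (step k)
  \<comment> \<open>The errors will add up to 6 e from the Buchstab steps, e from the additive
    errors 1 at the primes, and e from the starting point v 0; hence \<epsilon> / 8.\<close>
  define e where "e = min (\<epsilon> / 8) 1"
  have e: "0 < e" "e \<le> 1" "8 * e \<le> \<epsilon>" using step.prems by (auto simp: e_def)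
  obtain Y1 where Y1: "Y1 \<ge> 2" "\<And>x y. 1 \<le> x \<Longrightarrow> Y1 \<le> y \<Longrightarrow> x \<le> y ^ k \<Longrightarrow> dickman_error x y \<le> e * x + 1"
    using step.IH[OF e(1)] by blast
  obtain K where K: "K \<ge> 0" "\<And>a b. 2 \<le> a \<Longrightarrow> a \<le> b \<Longrightarrow>
      \<bar>(\<Sum>p | prime p \<and> a < real p \<and> real p \<le> b. 1 / real p) - (ln (ln b) - ln (ln a))\<bar> \<le> K / ln a"
    using mertens_second by blast
  obtain x0 where x0: "x0 \<ge> 2" "\<And>x. x \<ge> x0 \<Longrightarrow> real (card {p::nat. prime p \<and> real p \<le> x}) \<le> e * x"
    using prime_count_little_o[OF e(1)] by blast
  define J where "J = nat \<lceil>1 / e\<rceil>"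
  have J: "real J \<ge> 1 / e" unfolding J_def by linarith
  have J0: "J \<ge> 1" using J e by (cases J) (auto simp: field_simps)
  have Je: "1 / real J \<le> e" using J e J0 by (simp add: field_simps)
  \<comment> \<open>\<open>Y1\<close> serves the induction hypothesis, \<open>x0\<close> the prime
    count, and the exponential makes J K / ln y at most e, so that the Mertens errors of all J steps
    together stay small.\<close>
  define Y where "Y = max (max Y1 x0) (exp (real J * K / e))"
  show ?case
  proof (intro exI[of _ Y] conjI allI impI)
    show "2 \<le> Y" using Y1 by (simp add: Y_def)
    fix y x :: real assume y: "Y \<le> y" and x1: "1 \<le> x" and xy: "x \<le> y ^ Suc k"
    have y': "Y1 \<le> y" "x0 \<le> y" "exp (real J * K / e) \<le> y" "2 \<le> y" using y Y1(1) by (auto simp: Y_def)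
    have ly: "ln y > 0" using y' by simp
    show "dickman_error x y \<le> \<epsilon> * x + 1"
    proof (cases "x \<le> y ^ k")
      case True
      have "dickman_error x y \<le> e * x + 1" using Y1(2)[OF x1 y'(1) True] .
      also have "e * x \<le> \<epsilon> * x" using e x1 by (intro mult_right_mono) auto
      finally show ?thesis by simp
    next
      case False
      then have xk: "y ^ k < x" by simp
      have "y ^ 1 \<le> y ^ k" using y' step.hyps by (intro power_increasing) auto
      then have yx: "y < x" using xk by simp
      define L where "L = ln x"
      define l where "l = ln y"
      define u where "u = L / l"
      have l: "l > 0" using ly by (simp add: l_def)
      have L0: "L > 0" using yx y' by (simp add: L_def)
      have "ln (y ^ k) < L" "L \<le> ln (y ^ Suc k)" unfolding L_def using xk xy y' x1 by auto
      then have "real k * l < L" "L \<le> real (Suc k) * l" using y' unfolding l_def by (auto simp: ln_realpow ln_mult algebra_simps)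
      then have u: "real k < u" "u \<le> real k + 1" using l by (auto simp: u_def field_simps)
      have k1: "real k \<ge> 1" using step.hyps by simp
      define \<kappa> where "\<kappa> = K / ln y"
      have \<kappa>: "0 \<le> \<kappa>" "real J * \<kappa> \<le> e"
      proof -
        show "0 \<le> \<kappa>" using K(1) ly by (simp add: \<kappa>_def)
        have "real J * K / e \<le> ln y" using y'(3) by (metis exp_gt_zero ln_exp ln_le_cancel_iff less_le_trans)
        then show "real J * \<kappa> \<le> e" using e ly by (simp add: \<kappa>_def field_simps)
      qed
      define d where "d = 1 / real J"
      have d: "0 \<le> d" "d \<le> e" "real J * d = 1" using Je J0 by (auto simp: d_def)
      define v where "v = (\<lambda>j::nat. real k + (u - real k) * real j / real J)"
      define z where "z = (\<lambda>j. exp (L / v j))"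
      define D where "D = (\<lambda>v. real (smooth_count x (exp (ln x / v))) - x * dickman_rho v)"
      define B where "B = d\<^sup>2 + (e + d) * (d + \<kappa>) + \<kappa>"
      have v0: "v 0 = real k" and vJ: "v J = u" using J0 by (auto simp: v_def)
      have vmono: "v i \<le> v j" if "i \<le> j" for i j
        unfolding v_def using u that by (auto intro!: divide_right_mono mult_left_mono)
      have vk: "real k \<le> v j" for j using vmono[of 0 j] v0 by simp
      have vd: "v (Suc j) - v j \<le> d" for j
      proof -
        have "v (Suc j) - v j = (u - real k) / real J"
          unfolding v_def of_nat_Suc distrib_left add_divide_distrib by simp
        also have "\<dots> \<le> 1 / real J" using u by (intro divide_right_mono) auto
        finally show ?thesis by (simp add: d_def)
      qed
      have zmono: "z j \<le> z i" if "i \<le> j" for i j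
      proof -
        have "L / v j \<le> L / v i" using vmono[OF that] vk[of i] k1 L0 by (intro divide_left_mono) auto
        then show ?thesis by (simp add: z_def)
      qed
      \<comment> \<open>The prime sets of different steps are disjoint. Counting their union keeps
        the accumulated errors 1 below the number of primes up to x, instead of J times that
        number.\<close>
      define Q where "Q = (\<lambda>m. {p::nat. prime p \<and> z m < real p \<and> real p \<le> z 0})"
      have ind: "\<bar>D (v m) - D (v 0)\<bar> \<le> real m * (x * B) + real (card (Q m))" if "m \<le> J" for m
        using that
      proof (induction m)
        case (Suc m)
        have st: "\<bar>D (v m) - D (v (Suc m))\<bar> \<le> x * B
            + real (card {p. prime p \<and> exp (ln x / v (Suc m)) < real p \<and> real p \<le> exp (ln x / v m)})"
          unfolding D_def B_def \<kappa>_def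
        proof (rule buchstab_step[where Y = Y1 and k = k and w' = u])
          show "v (Suc m) \<le> real k + 1" "v (Suc m) \<le> u"
            using vmono[of "Suc m" J] Suc.prems vJ u by auto
          show "ln x = u * ln y" using l by (simp add: u_def L_def l_def)
        qed (use step.hyps yx y' vk vmono vd Y1 K e d in auto)
        let ?P = "{p::nat. prime p \<and> z (Suc m) < real p \<and> real p \<le> z m}"
        have "Q (Suc m) = Q m \<union> ?P" using zmono[of 0 m] zmono[of m "Suc m"] by (auto simp: Q_def)
        moreover have "Q m \<inter> ?P = {}" by (auto simp: Q_def)
        moreover have "finite (Q m)" unfolding Q_def by (rule finite_primes_Ioc)
        moreover have "finite ?P" by (rule finite_primes_Ioc)
        ultimately have "card (Q (Suc m)) = card (Q m) + card ?P" by (simp add: card_Un_disjoint)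
        moreover have "{p::nat. prime p \<and> exp (ln x / v (Suc m)) < real p \<and> real p \<le> exp (ln x / v m)} = ?P"
          by (simp add: z_def L_def)
        ultimately have "\<bar>D (v m) - D (v (Suc m))\<bar> \<le> x * B + (real (card (Q (Suc m))) - real (card (Q m)))"
          using st by simp
        moreover have "\<bar>D (v m) - D (v 0)\<bar> \<le> real m * (x * B) + real (card (Q m))" using Suc by simp
        moreover have "real (Suc m) * (x * B) = real m * (x * B) + x * B" by (simp add: algebra_simps)
        ultimately show ?case by linarith
      qed simp
      have cQ: "real (card (Q J)) \<le> e * x"
      proof -
        have "z 0 \<le> x"
        proof -
          have "L / real k \<le> L" using L0 k1 by (simp add: field_simps)
          then have "z 0 \<le> exp L" by (simp add: z_def v0)
          then show ?thesis using x1 by (simp add: L_def)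
        qed
        moreover have "finite {p::nat. prime p \<and> real p \<le> x}"
          by (rule finite_subset[of _ "{..nat \<lfloor>x\<rfloor>}"]) (auto simp: le_nat_floor)
        ultimately have "card (Q J) \<le> card {p::nat. prime p \<and> real p \<le> x}"
          by (intro card_mono) (auto simp: Q_def)
        then show ?thesis using x0(2)[of x] yx y' by linarith
      qed
      \<comment> \<open>At v 0 = k the smoothness bound is z 0 = x^(1/k) \<ge> y, the boundary case
        of the induction hypothesis.\<close>
      have D0: "\<bar>D (v 0)\<bar> \<le> e * x + 1"
      proof -
        have yz: "y \<le> z 0"
        proof -
          have "l = L / u" using l L0 by (simp add: u_def)
          also have "\<dots> \<le> L / real k" using u k1 L0 by (intro divide_left_mono) auto
          finally have "exp l \<le> z 0" by (simp add: z_def v0)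
          then show ?thesis using y' by (simp add: l_def)
        qed
        have "z 0 ^ k = exp (real k * (L / real k))" by (simp add: z_def v0 exp_of_nat_mult[symmetric])
        also have "\<dots> = x" using k1 x1 by (simp add: L_def)
        finally have "dickman_error x (z 0) \<le> e * x + 1" using Y1(2)[of x "z 0"] x1 y' yz by simp
        moreover have "ln x / ln (z 0) = real k" using L0 k1 by (simp add: z_def v0 L_def)
        ultimately show ?thesis by (simp add: dickman_error_def D_def v0 z_def L_def)
      qed
      \<comment> \<open>Apart from \<kappa>, a step costs only terms of second order. J steps of
        length d = 1 / J turn d^2 into d and (e + d) d into e + d, while J \<kappa> \<le> e by the
        choice of \<open>Y\<close>.\<close>
      have "real J * B = (real J * d) * d + (e + d) * (real J * d + real J * \<kappa>) + real J * \<kappa>"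
        by (simp add: B_def power2_eq_square algebra_simps)
      also have "\<dots> = d + (e + d) * (1 + real J * \<kappa>) + real J * \<kappa>" unfolding d(3) by simp
      also have "\<dots> \<le> 6 * e"
      proof -
        have "(e + d) * (1 + real J * \<kappa>) \<le> (e + e) * (1 + 1)"
          using d e \<kappa> by (intro mult_mono) auto
        from add_mono[OF add_mono[OF d(2) this] \<kappa>(2)] show ?thesis by simp
      qed
      finally have "x * (real J * B) \<le> x * (6 * e)" using x1 by (intro mult_left_mono) auto
      moreover have "\<bar>D u - D (v 0)\<bar> \<le> x * (real J * B) + real (card (Q J))"
        using ind[of J] vJ by (simp add: mult.left_commute)
      moreover have "8 * e * x = x * (6 * e) + e * x + e * x" by simp
      ultimately have "\<bar>D u\<bar> \<le> 8 * e * x + 1" using cQ D0 by linarith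
      also have "8 * e * x \<le> \<epsilon> * x" using e x1 by (intro mult_right_mono) auto
      finally have "\<bar>D u\<bar> \<le> \<epsilon> * x + 1" by simp
      moreover have "exp (ln x / u) = y" using l L0 y' by (simp add: u_def L_def l_def)
      ultimately show ?thesis by (simp add: D_def dickman_error_def u_def L_def l_def)
    qed
  qed
qed

theorem dickman_smooth_count:
  assumes "\<epsilon> > 0"
  obtains Y where "Y \<ge> 2"
    "\<And>x y. Y \<le> y \<Longrightarrow> 1 \<le> x \<Longrightarrow> ln x / ln y \<le> U \<Longrightarrow>
       \<bar>real (smooth_count x y) - x * dickman_rho (ln x / ln y)\<bar> \<le> \<epsilon> * x + 1"
proof -
  define k where "k = max 1 (nat \<lceil>U\<rceil>)"
  have k: "1 \<le> k" "U \<le> real k" unfolding k_def by linarith+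
  obtain Y where Y: "Y \<ge> 2" "\<And>y x. Y \<le> y \<Longrightarrow> 1 \<le> x \<Longrightarrow> x \<le> y ^ k \<Longrightarrow> dickman_error x y \<le> \<epsilon> * x + 1"
    using dickman_error_nat[OF k(1) assms] by blast
  show ?thesis
  proof (rule that[OF Y(1)])
    fix x y :: real assume y: "Y \<le> y" and x: "1 \<le> x" and u: "ln x / ln y \<le> U"
    have ly: "ln y > 0" "y > 0" using y Y(1) by auto
    have "ln x = ln x / ln y * ln y" using ly by simp
    also have "\<dots> \<le> real k * ln y" using u k ly by (intro mult_right_mono) auto
    also have "\<dots> = ln (y ^ k)" using ly by (simp add: ln_realpow)
    finally have "x \<le> y ^ k" using x ly by simp
    then show "\<bar>real (smooth_count x y) - x * dickman_rho (ln x / ln y)\<bar> \<le> \<epsilon> * x + 1"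
      using Y(2)[OF y x] by (simp add: dickman_error_def)
  qed
qed

section \<open>The Euler product\<close>

text \<open>For nonnegative terms summability over the product only requires bounded finite sums,
  and a finite set of pairs is contained in the rectangle of its projections.\<close>

lemma has_sum_product_nonneg:
  fixes f :: "'a \<Rightarrow> real" and g :: "'b \<Rightarrow> real"
  assumes f: "(f has_sum a) A" and g: "(g has_sum b) B"
    and f0: "\<And>x. x \<in> A \<Longrightarrow> f x \<ge> 0" and g0: "\<And>y. y \<in> B \<Longrightarrow> g y \<ge> 0"
  shows "((\<lambda>(x, y). f x * g y) has_sum a * b) (A \<times> B)"
proof (rule has_sum_SigmaI)
  show "((\<lambda>y. case (x, y) of (x, y) \<Rightarrow> f x * g y) has_sum f x * b) B" if "x \<in> A" for x
    using has_sum_cmult_right[OF g, of "f x"] by simp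
  show "((\<lambda>x. f x * b) has_sum a * b) A" by (rule has_sum_cmult_left[OF f])
  show "(\<lambda>(x, y). f x * g y) summable_on A \<times> B"
  proof (rule nonneg_bdd_above_summable_on)
    have b0: "b \<ge> 0" using has_sum_nonneg[OF g] g0 by blast
    show "bdd_above (sum (\<lambda>(x, y). f x * g y) ` {F. F \<subseteq> A \<times> B \<and> finite F})"
    proof (rule bdd_aboveI2)
      fix F assume F: "F \<in> {F. F \<subseteq> A \<times> B \<and> finite F}"
      let ?A = "fst ` F" and ?B = "snd ` F"
      have sub: "?A \<subseteq> A" "?B \<subseteq> B" and fin: "finite ?A" "finite ?B" using F by auto
      have "sum (\<lambda>(x, y). f x * g y) F \<le> sum (\<lambda>(x, y). f x * g y) (?A \<times> ?B)"
      proof (rule sum_mono2)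
        show "F \<subseteq> ?A \<times> ?B" by force
        show "0 \<le> (case z of (x, y) \<Rightarrow> f x * g y)" if "z \<in> ?A \<times> ?B - F" for z
          using that f0[OF subsetD[OF sub(1)], of "fst z"] g0[OF subsetD[OF sub(2)], of "snd z"]
          by (simp add: case_prod_beta mem_Times_iff)
      qed (use fin in simp)
      also have "\<dots> = sum f ?A * sum g ?B" by (simp add: sum_product sum.cartesian_product)
      also have "\<dots> \<le> a * b"
      proof (rule mult_mono)
        show "sum f ?A \<le> a" using finite_sum_le_has_sum[OF f fin(1) sub(1)] f0 by auto
        show "sum g ?B \<le> b" using finite_sum_le_has_sum[OF g fin(2) sub(2)] g0 by auto
        show "0 \<le> a" using has_sum_nonneg[OF f] f0 by blast
        show "0 \<le> sum g ?B" using sub g0 by (intro sum_nonneg) auto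
      qed
      finally show "sum (\<lambda>(x, y). f x * g y) F \<le> a * b" .
    qed
  qed (use f0 g0 in auto)
qed

section \<open>The free commutative monoid on the matrix rings\<close>

definition msets_on :: "'a set \<Rightarrow> 'a multiset set" where
  "msets_on G = {M. set_mset M \<subseteq> G}"

text \<open>The free commutative monoid on a disjoint union is the product of the two monoids;
  filtering splits a multiset.\<close>

lemma bij_betw_msets_on_Un:
  assumes "G \<inter> H = {}"
  shows "bij_betw (\<lambda>(M, N). M + N) (msets_on G \<times> msets_on H) (msets_on (G \<union> H))"
proof (rule bij_betw_byWitness[where f' = "\<lambda>M. (filter_mset (\<lambda>x. x \<in> G) M, filter_mset (\<lambda>x. x \<notin> G) M)"])
  have "filter_mset (\<lambda>x. x \<in> G) (M + N) = M \<and> filter_mset (\<lambda>x. x \<notin> G) (M + N) = N"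
    if M: "M \<in> msets_on G" and N: "N \<in> msets_on H" for M N
  proof -
    have "filter_mset (\<lambda>x. x \<in> G) M = M" "filter_mset (\<lambda>x. x \<notin> G) N = N"
      using M N assms by (auto simp: msets_on_def filter_mset_eq_conv)
    moreover have "filter_mset (\<lambda>x. x \<notin> G) M = {#}" "filter_mset (\<lambda>x. x \<in> G) N = {#}"
      using M N assms by (auto simp: msets_on_def set_mset_eq_empty_iff[symmetric] simp del: set_mset_eq_empty_iff)
    ultimately show ?thesis by simp
  qed
  then show "\<forall>a\<in>msets_on G \<times> msets_on H.
      (\<lambda>M. (filter_mset (\<lambda>x. x \<in> G) M, filter_mset (\<lambda>x. x \<notin> G) M)) ((\<lambda>(M, N). M + N) a) = a" by auto
  show "\<forall>M\<in>msets_on (G \<union> H). (\<lambda>(M, N). M + N) (filter_mset (\<lambda>x. x \<in> G) M, filter_mset (\<lambda>x. x \<notin> G) M) = M"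
    by (simp add: multiset_partition[symmetric])
qed (auto simp: msets_on_def)

text \<open>The order of a ring whose decomposition has the type M, as in
  \<open>card_mat_list\<close>.\<close>

definition mat_norm :: "(nat \<times> nat) multiset \<Rightarrow> nat" where
  "mat_norm M = (\<Prod>(q, n)\<in>#M. q ^ n\<^sup>2)"

definition mat_weight :: "(nat \<times> nat) multiset \<Rightarrow> real" where
  "mat_weight M = 1 / real (mat_norm M)"

lemma mat_norm_simps [simp]:
  "mat_norm {#} = 1" "mat_norm (M + N) = mat_norm M * mat_norm N"
  "mat_norm (add_mset (q, n) M) = q ^ n\<^sup>2 * mat_norm M"
  by (simp_all add: mat_norm_def)

lemma mat_weight_nonneg [simp]: "mat_weight M \<ge> 0"
  by (simp add: mat_weight_def)

text \<open>The pairs \<open>(q, n)\<close> with \<open>q = p\<^sup>r\<close> that belong to the factors \<open>\<zeta>(r n\<^sup>2)\<close>, \<open>(r, n) \<in> A\<close>, of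
  \<open>\<alpha>\<^sub>1\<close>. The exponent pair \<open>(1, 1)\<close>, excluded from \<open>\<alpha>\<^sub>1\<close>, belongs to the prime fields.\<close>

definition mat_gens :: "(nat \<times> nat) set \<Rightarrow> (nat \<times> nat) set" where
  "mat_gens A = {(p ^ r, n) | p r n. prime p \<and> (r, n) \<in> A}"

definition zeta_exps :: "(nat \<times> nat) set" where
  "zeta_exps = {(r, m). r \<ge> 1 \<and> m \<ge> 1 \<and> r * m\<^sup>2 > 1}"

lemma mat_gens_Un: "mat_gens (A \<union> B) = mat_gens A \<union> mat_gens B"
  by (auto simp: mat_gens_def)

text \<open>A prime power p^r with r \<ge> 1 determines r, so (p^r, n) reveals the pair (r, n); with
  r = 0 every p would give 1.\<close>

lemma mat_gens_disjoint:
  assumes "A \<inter> B = {}" "\<And>r n. (r, n) \<in> A \<union> B \<Longrightarrow> r \<ge> 1"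
  shows "mat_gens A \<inter> mat_gens B = {}"
proof -
  have False if "prime p" "(r, n) \<in> A" "prime p'" "(r', n) \<in> B" "p ^ r = p' ^ r'" for p r n p' r' :: nat
  proof -
    have "r \<ge> 1" "r' \<ge> 1" using assms(2) that by blast+
    then have "r = r'" using prime_power_inj'(2)[OF that(1,3,5)] by simp
    then show False using that assms(1) by blast
  qed
  then show ?thesis unfolding mat_gens_def by blast
qed

lemma mat_norm_ge:
  assumes "\<And>q n. (q, n) \<in># M \<Longrightarrow> q \<ge> 1"
  shows "mat_norm M \<ge> 1"
  using assms
proof (induction M)
  case (add z M)
  obtain q n where z: "z = (q, n)" by (cases z)
  have "q \<ge> 1" using add.prems[of q n] z by simp
  then have "q ^ n\<^sup>2 \<ge> 1" by simp
  moreover have "mat_norm M \<ge> 1" using add by auto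
  ultimately show ?case by (simp add: z Suc_le_eq)
qed simp

lemma mat_gens_ge: "(q, n) \<in> mat_gens A \<Longrightarrow> q \<ge> 1"
  by (auto simp: mat_gens_def prime_gt_0_nat Suc_le_eq)

lemma mat_norm_ge_1: "M \<in> msets_on (mat_gens A) \<Longrightarrow> mat_norm M \<ge> 1"
  using mat_gens_ge by (intro mat_norm_ge) (auto simp: msets_on_def)

text \<open>The integer k becomes the multiset with one pair (p^r, n) for each prime factor p of k,
  counted with multiplicity. Its norm is k^(r n^2), so for (r, n) in \<open>zeta_exps\<close> the
  weights sum to \<zeta>(r n^2); r = n = 1 encodes the products of prime fields.\<close>

definition mset_of_nat :: "nat \<Rightarrow> nat \<Rightarrow> nat \<Rightarrow> (nat \<times> nat) multiset" where
  "mset_of_nat r n k = image_mset (\<lambda>p. (p ^ r, n)) (prime_factorization k)"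

lemma mat_norm_image_mset:
  "mat_norm (image_mset (\<lambda>p. (p ^ r, n)) P) = prod_mset P ^ (r * n\<^sup>2)"
  by (induction P) (simp_all add: power_mult power_mult_distrib)

lemma mat_norm_mset_of_nat: "k \<ge> 1 \<Longrightarrow> mat_norm (mset_of_nat r n k) = k ^ (r * n\<^sup>2)"
  by (simp add: mset_of_nat_def mat_norm_image_mset)

text \<open>Unique factorisation: the multisets of primes are exactly the prime factorisations of
  positive integers, and r \<ge> 1 keeps the map from p to p^r injective.\<close>

lemma bij_betw_mset_of_nat:
  assumes r: "r \<ge> 1"
  shows "bij_betw (mset_of_nat r n) {1..} (msets_on (mat_gens {(r, n)}))"
  unfolding bij_betw_def
proof
  have inj: "inj_on (\<lambda>p :: nat. (p ^ r, n)) UNIV"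
    using r by (auto simp: inj_on_def power_eq_iff_eq_base)
  show "inj_on (mset_of_nat r n) {1..}"
  proof (rule inj_onI)
    fix k l :: nat assume k: "k \<in> {1..}" and l: "l \<in> {1..}" and "mset_of_nat r n k = mset_of_nat r n l"
    then have "prime_factorization k = prime_factorization l"
      unfolding mset_of_nat_def by (intro injD[OF multiset.inj_map[OF inj]])
    then have "prod_mset (prime_factorization k) = prod_mset (prime_factorization l)" by simp
    then show "k = l" using k l by simp
  qed
  show "mset_of_nat r n ` {1..} = msets_on (mat_gens {(r, n)})"
  proof (intro equalityI subsetI)
    fix M assume "M \<in> mset_of_nat r n ` {1..}"
    then show "M \<in> msets_on (mat_gens {(r, n)})"
      unfolding mset_of_nat_def msets_on_def mat_gens_def by clarsimp (blast dest: in_prime_factors_imp_prime)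
  next
    fix M assume M: "M \<in> msets_on (mat_gens {(r, n)})"
    then have "\<exists>P. (\<forall>p\<in>#P. prime p) \<and> M = image_mset (\<lambda>p. (p ^ r, n)) P"
    proof (induction M)
      case empty
      show ?case by (rule exI[of _ "{#}"]) simp
    next
      case (add z M)
      have "M \<in> msets_on (mat_gens {(r, n)})" "z \<in> mat_gens {(r, n)}" using add.prems by (auto simp: msets_on_def)
      then obtain P p where "\<forall>p\<in>#P. prime p" "M = image_mset (\<lambda>p. (p ^ r, n)) P" "prime p" "z = (p ^ r, n)"
        using add.IH by (auto simp: mat_gens_def)
      then show ?case by (intro exI[of _ "add_mset p P"]) auto
    qed
    then obtain P where P: "\<And>p. p \<in># P \<Longrightarrow> prime p" "M = image_mset (\<lambda>p. (p ^ r, n)) P" by blast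
    have "prime_factorization (prod_mset P) = P" using P(1) by (intro prime_factorization_prod_mset_primes) auto
    moreover have "0 \<notin># P" using P(1)[of 0] by auto
    then have "prod_mset P > 0" by (intro gr0I) simp
    ultimately show "M \<in> mset_of_nat r n ` {1..}"
      using P(2) by (intro image_eqI[of _ _ "prod_mset P"]) (auto simp: mset_of_nat_def Suc_le_eq)
  qed
qed

lemma zeta_nat_has_sum:
  assumes "s \<ge> 2"
  shows "((\<lambda>k. 1 / real (k ^ s)) has_sum zeta (real s)) {1..}"
proof -
  have "summable (\<lambda>k. 1 / real k ^ s)" using inverse_power_summable[of s] assms by (simp add: inverse_eq_divide)
  then have "summable (\<lambda>k. 1 / real (Suc k) ^ s)" by (subst summable_Suc_iff)
  moreover have "1 / real (Suc k) ^ s = 1 / real (Suc k) powr real s" for k by (simp add: powr_realpow)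
  ultimately have "(\<lambda>k. 1 / real (Suc k) ^ s) sums zeta (real s)" unfolding zeta_def by (simp add: summable_sums)
  then have "((\<lambda>k. 1 / real (Suc k) ^ s) has_sum zeta (real s)) UNIV" by (rule sums_nonneg_imp_has_sum) simp
  then have "((\<lambda>k. 1 / real (k ^ s)) \<circ> Suc has_sum zeta (real s)) UNIV" by (simp add: comp_def)
  then have "((\<lambda>k. 1 / real (k ^ s)) has_sum zeta (real s)) (range Suc)"
    by (subst has_sum_reindex) auto
  moreover have "range Suc = {1..}" by (auto simp: image_iff Suc_le_eq gr0_conv_Suc)
  ultimately show ?thesis by simp
qed

lemma mat_weight_has_sum_single:
  assumes "(r, n) \<in> zeta_exps"
  shows "(mat_weight has_sum zeta (real (r * n\<^sup>2))) (msets_on (mat_gens {(r, n)}))"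
proof -
  have r: "r \<ge> 1" "r * n\<^sup>2 \<ge> 2" using assms by (auto simp: zeta_exps_def)
  have "((\<lambda>k. mat_weight (mset_of_nat r n k)) has_sum zeta (real (r * n\<^sup>2))) {1..}"
    using zeta_nat_has_sum[OF r(2)]
    by (rule iffD1[OF has_sum_cong, rotated]) (simp add: mat_weight_def mat_norm_mset_of_nat)
  then show ?thesis using has_sum_reindex_bij_betw[OF bij_betw_mset_of_nat[OF r(1), of n]] by blast
qed

text \<open>A finite piece of the Euler product: each further (r, m) adjoins generators disjoint
  from the old ones and multiplies the sum by \<zeta>(r m^2).\<close>

lemma mat_weight_has_sum:
  assumes "finite A" "A \<subseteq> zeta_exps"
  shows "(mat_weight has_sum (\<Prod>(r, m)\<in>A. zeta (real (r * m\<^sup>2)))) (msets_on (mat_gens A))"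
  using assms
proof (induction A rule: finite_induct)
  case empty
  have "msets_on (mat_gens {}) = {{#}}" by (auto simp: msets_on_def mat_gens_def)
  then show ?case using has_sum_finite[of "{{#}}" mat_weight] by (simp add: mat_weight_def[of "{#}"])
next
  case (insert a A)
  obtain r m where a: "a = (r, m)" by (cases a)
  have disj: "mat_gens {a} \<inter> mat_gens A = {}"
    using insert.hyps insert.prems by (intro mat_gens_disjoint) (auto simp: zeta_exps_def)
  have "((\<lambda>(M, N). mat_weight M * mat_weight N) has_sum
      zeta (real (r * m\<^sup>2)) * (\<Prod>(r, m)\<in>A. zeta (real (r * m\<^sup>2)))) (msets_on (mat_gens {a}) \<times> msets_on (mat_gens A))"
    using insert mat_weight_has_sum_single[of r m] by (intro has_sum_product_nonneg) (auto simp: a)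
  moreover have "(\<lambda>(M, N). mat_weight M * mat_weight N) = (\<lambda>z. mat_weight (case z of (M, N) \<Rightarrow> M + N))"
    by (auto simp: mat_weight_def)
  ultimately have "(mat_weight has_sum zeta (real (r * m\<^sup>2)) * (\<Prod>(r, m)\<in>A. zeta (real (r * m\<^sup>2))))
      (msets_on (mat_gens {a} \<union> mat_gens A))"
    by (simp add: has_sum_reindex_bij_betw[OF bij_betw_msets_on_Un[OF disj]])
  then show ?case using insert.hyps by (simp add: a mat_gens_Un[symmetric])
qed

text \<open>For k \<ge> 2 and s \<ge> 2, k^s \<ge> 2^(s - 2) k^2, so the terms of \<zeta>(s) after
  the first add up to at most 4 \<zeta>(2) / 2^s; this is the origin of \<open>C\<close>.\<close>

lemma zeta_nat_le:
  obtains C where "C \<ge> 0" "\<And>s. s \<ge> 2 \<Longrightarrow> zeta (real s) \<le> 1 + C / 2 ^ s"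
proof -
  define C where "C = 4 * zeta (real 2)"
  have z2: "((\<lambda>k. 1 / real (k ^ 2)) has_sum zeta (real 2)) {1..}" by (rule zeta_nat_has_sum) simp
  have z20: "zeta (real 2) \<ge> 0" by (rule has_sum_nonneg[OF z2]) auto
  show ?thesis
  proof (rule that[of C])
    show "C \<ge> 0" using z20 by (simp add: C_def)
    fix s :: nat assume s: "s \<ge> 2"
    show "zeta (real s) \<le> 1 + C / 2 ^ s"
    proof (rule has_sum_le_finite_sums[OF zeta_nat_has_sum[OF s]])
      fix F :: "nat set" assume F: "finite F" "F \<subseteq> {1..}"
      have each: "1 / real (k ^ s) \<le> (if k = 1 then 1 else 0) + 4 / 2 ^ s * (1 / real (k ^ 2))" if "k \<in> F" for k
      proof (cases "k = 1")
        case False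
        then have k: "k \<ge> 2" using that F by force
        have "real k ^ s = real k ^ 2 * real k ^ (s - 2)" using s by (metis le_add_diff_inverse power_add)
        also have "\<dots> \<ge> real k ^ 2 * 2 ^ (s - 2)" using k by (intro mult_left_mono power_mono) auto
        finally have "1 / real k ^ s \<le> 1 / (real k ^ 2 * 2 ^ (s - 2))" using k by (intro divide_left_mono) auto
        also have "(2::real) ^ (s - 2) = 2 ^ s / 4" using s by (simp add: power_diff)
        finally show ?thesis using False by (simp add: mult.commute)
      qed simp
      have "sum (\<lambda>k. 1 / real (k ^ s)) F \<le> (\<Sum>k\<in>F. (if k = 1 then 1 else 0) + 4 / 2 ^ s * (1 / real (k ^ 2)))"
        by (rule sum_mono) (rule each)
      also have "\<dots> = (\<Sum>k\<in>F. if k = 1 then 1 else 0) + 4 / 2 ^ s * (\<Sum>k\<in>F. 1 / real (k ^ 2))"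
        by (simp only: sum.distrib sum_distrib_left)
      also have "\<dots> \<le> 1 + 4 / 2 ^ s * zeta (real 2)"
      proof (intro add_mono mult_left_mono)
        show "(\<Sum>k\<in>F. if k = 1 then 1 else 0 :: real) \<le> 1" using F by simp
        show "(\<Sum>k\<in>F. 1 / real (k ^ 2)) \<le> zeta (real 2)" by (rule finite_sum_le_has_sum[OF z2 F]) auto
      qed simp
      finally show "sum (\<lambda>k. 1 / real (k ^ s)) F \<le> 1 + C / 2 ^ s" by (simp add: C_def)
    qed
  qed
qed

lemma geometric_half_sum: "(\<Sum>i\<le>n. (1/2::real) ^ i) \<le> 2"
proof -
  have "(\<Sum>i\<le>n. (1/2::real) ^ i) = 2 - (1/2) ^ n" by (induction n) (auto simp: field_simps)
  then show ?thesis by simp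
qed

text \<open>From r + m \<le> r m + 1 \<le> r m^2 + 1 each term is at most 2 (1/2)^r (1/2)^m. Two
  geometric series, each at most 2, and the factor 2 give 8.\<close>

lemma sum_two_power_zeta_exps:
  assumes "finite A" "A \<subseteq> zeta_exps"
  shows "(\<Sum>(r, m)\<in>A. 1 / 2 ^ (r * m\<^sup>2)) \<le> (8::real)"
proof -
  define R where "R = Max (insert 0 (fst ` A))"
  define S where "S = Max (insert 0 (snd ` A))"
  have sub: "A \<subseteq> {..R} \<times> {..S}"
    using assms(1) by (auto simp: R_def S_def intro!: Max_ge) (force intro!: Max_ge)+
  have le: "(1::real) / 2 ^ (r * m\<^sup>2) \<le> 2 * ((1/2) ^ r * (1/2) ^ m)" if "(r, m) \<in> A" for r m
  proof -
    have rm: "r \<ge> 1" "m \<ge> 1" using that assms(2) by (auto simp: zeta_exps_def)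
    have "r + m \<le> r * m + 1" using rm by (cases r; cases m) auto
    also have "r * m \<le> r * m\<^sup>2" using rm by (simp add: power2_eq_square)
    finally have "r + m \<le> Suc (r * m\<^sup>2)" by simp
    then have "(1/2::real) ^ Suc (r * m\<^sup>2) \<le> (1/2) ^ (r + m)" by (intro power_decreasing) auto
    then show ?thesis by (simp add: power_add power_one_over)
  qed
  have "(\<Sum>(r, m)\<in>A. 1 / 2 ^ (r * m\<^sup>2)) \<le> (\<Sum>(r, m)\<in>A. 2 * ((1/2::real) ^ r * (1/2) ^ m))"
    by (rule sum_mono) (use le in auto)
  also have "\<dots> \<le> (\<Sum>(r, m)\<in>{..R} \<times> {..S}. 2 * ((1/2::real) ^ r * (1/2) ^ m))"
    using sub by (intro sum_mono2) auto
  also have "\<dots> = 2 * ((\<Sum>r\<le>R. (1/2) ^ r) * (\<Sum>m\<le>S. (1/2) ^ m))"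
    unfolding sum_product sum.cartesian_product[symmetric] by (simp only: sum_distrib_left)
  also have "\<dots> \<le> 2 * (2 * 2)"
    using geometric_half_sum[of R] geometric_half_sum[of S]
    by (intro mult_left_mono mult_mono) (auto intro!: sum_nonneg)
  finally show ?thesis by simp
qed

text \<open>Each factor is at most 1 + C / 2^s \<le> exp (C / 2^s) with s = r m^2, so the product is
  bounded by the exponential of a bounded sum.\<close>

lemma prod_zeta_bounded:
  obtains C where "\<And>A. finite A \<Longrightarrow> A \<subseteq> zeta_exps \<Longrightarrow> (\<Prod>(r, m)\<in>A. zeta (real (r * m\<^sup>2))) \<le> C"
proof -
  obtain C where C: "C \<ge> 0" "\<And>s. s \<ge> 2 \<Longrightarrow> zeta (real s) \<le> 1 + C / 2 ^ s" using zeta_nat_le by blast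
  show ?thesis
  proof (rule that[of "exp (C * 8)"])
    fix A assume A: "finite A" "A \<subseteq> zeta_exps"
    have "(\<Prod>(r, m)\<in>A. zeta (real (r * m\<^sup>2))) \<le> (\<Prod>(r, m)\<in>A. exp (C * (1 / 2 ^ (r * m\<^sup>2))))"
    proof (rule prod_mono)
      fix z assume z: "z \<in> A"
      obtain r m where rm: "z = (r, m)" by (cases z)
      have s: "r * m\<^sup>2 \<ge> 2" using z A by (auto simp: rm zeta_exps_def)
      have "zeta (real (r * m\<^sup>2)) \<ge> 0" by (rule has_sum_nonneg[OF zeta_nat_has_sum[OF s]]) auto
      moreover have "zeta (real (r * m\<^sup>2)) \<le> exp (C * (1 / 2 ^ (r * m\<^sup>2)))"
        using order_trans[OF C(2)[OF s] exp_ge_add_one_self[of "C / 2 ^ (r * m\<^sup>2)"]] by simp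
      ultimately show "0 \<le> (case z of (r, m) \<Rightarrow> zeta (real (r * m\<^sup>2))) \<and>
          (case z of (r, m) \<Rightarrow> zeta (real (r * m\<^sup>2))) \<le> (case z of (r, m) \<Rightarrow> exp (C * (1 / 2 ^ (r * m\<^sup>2))))"
        by (simp add: rm)
    qed
    also have "\<dots> = exp (C * (\<Sum>(r, m)\<in>A. 1 / 2 ^ (r * m\<^sup>2)))"
      using A(1) by (simp add: exp_sum sum_distrib_left case_prod_beta')
    also have "\<dots> \<le> exp (C * 8)"
      using sum_two_power_zeta_exps[OF A] C(1) by (simp add: mult_left_mono)
    finally show "(\<Prod>(r, m)\<in>A. zeta (real (r * m\<^sup>2))) \<le> exp (C * 8)" .
  qed
qed

lemma finite_subset_msets_on:
  assumes "finite F" "F \<subseteq> msets_on (mat_gens zeta_exps)"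
  shows "\<exists>A. finite A \<and> A \<subseteq> zeta_exps \<and> F \<subseteq> msets_on (mat_gens A)"
proof -
  define G where "G = \<Union> (set_mset ` F)"
  have G: "finite G" "G \<subseteq> mat_gens zeta_exps" using assms by (auto simp: G_def msets_on_def)
  have "\<forall>g\<in>G. \<exists>a\<in>zeta_exps. g \<in> mat_gens {a}"
  proof
    fix g assume "g \<in> G"
    then obtain p r n where "prime p" "(r, n) \<in> zeta_exps" "g = (p ^ r, n)" using G(2) by (auto simp: mat_gens_def)
    then show "\<exists>a\<in>zeta_exps. g \<in> mat_gens {a}" by (intro bexI[of _ "(r, n)"]) (auto simp: mat_gens_def)
  qed
  then obtain c where c: "\<And>g. g \<in> G \<Longrightarrow> c g \<in> zeta_exps \<and> g \<in> mat_gens {c g}" by metis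
  have "mat_gens {c g} \<subseteq> mat_gens (c ` G)" if "g \<in> G" for g using that by (auto simp: mat_gens_def)
  then have "G \<subseteq> mat_gens (c ` G)" using c by blast
  then have "F \<subseteq> msets_on (mat_gens (c ` G))" by (auto simp: msets_on_def G_def)
  then show ?thesis using G(1) c by (intro exI[of _ "c ` G"]) auto
qed

text \<open>The partial product over A is the sum of the weights over the multisets with generators
  from A. It never exceeds the total sum S, and it dominates any given finite sum of weights once A
  is large enough, so the partial products tend to S. This convergence gives the \<open>Lim\<close>
  in \<open>alpha1\<close> its value.\<close>

lemma alpha1_has_sum: "(mat_weight has_sum alpha1) (msets_on (mat_gens zeta_exps))"
proof -
  let ?D = "msets_on (mat_gens zeta_exps)"
  let ?z = "\<lambda>A. \<Prod>(r, m)\<in>A. zeta (real (r * m\<^sup>2))"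
  obtain C where C: "\<And>A. finite A \<Longrightarrow> A \<subseteq> zeta_exps \<Longrightarrow> ?z A \<le> C" using prod_zeta_bounded by blast
  have part: "sum mat_weight F \<le> ?z A"
    if "finite F" "F \<subseteq> msets_on (mat_gens A)" "finite A" "A \<subseteq> zeta_exps" for F A
    by (rule finite_sum_le_has_sum[OF mat_weight_has_sum[OF that(3,4)] that(1,2)]) auto
  have "mat_weight summable_on ?D"
  proof (rule nonneg_bdd_above_summable_on)
    show "bdd_above (sum mat_weight ` {F. F \<subseteq> ?D \<and> finite F})"
    proof (rule bdd_aboveI2[where M = C])
      fix F assume "F \<in> {F. F \<subseteq> ?D \<and> finite F}"
      then obtain A where "finite A" "A \<subseteq> zeta_exps" "finite F" "F \<subseteq> msets_on (mat_gens A)"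
        using finite_subset_msets_on[of F] by blast
      then show "sum mat_weight F \<le> C" using part[of F A] C[of A] by linarith
    qed
  qed simp
  then obtain S where S: "(mat_weight has_sum S) ?D" by (auto simp: summable_on_def)
  have "(?z \<longlongrightarrow> S) (finite_subsets_at_top zeta_exps)"
  proof (rule tendstoI)
    fix e :: real assume e: "e > 0"
    have "\<forall>\<^sub>F F in finite_subsets_at_top ?D. dist (sum mat_weight F) S < e"
      using S e by (simp add: has_sum_def tendstoD)
    then obtain F where F: "finite F" "F \<subseteq> ?D" "dist (sum mat_weight F) S < e"
      unfolding eventually_finite_subsets_at_top by blast
    obtain A0 where A0: "finite A0" "A0 \<subseteq> zeta_exps" "F \<subseteq> msets_on (mat_gens A0)"
      using finite_subset_msets_on[OF F(1,2)] by blast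
    show "\<forall>\<^sub>F A in finite_subsets_at_top zeta_exps. dist (?z A) S < e"
      unfolding eventually_finite_subsets_at_top
    proof (intro exI[of _ A0] conjI allI impI)
      fix A assume A: "finite A \<and> A0 \<subseteq> A \<and> A \<subseteq> zeta_exps"
      have mono: "mat_gens A0 \<subseteq> mat_gens A" "mat_gens A \<subseteq> mat_gens zeta_exps" using A unfolding mat_gens_def by blast+
      then have "F \<subseteq> msets_on (mat_gens A)" using A0(3) by (auto simp: msets_on_def)
      then have "sum mat_weight F \<le> ?z A" using part[OF F(1)] A by blast
      moreover have "?z A \<le> S"
      proof (rule has_sum_le_finite_sums[OF mat_weight_has_sum])
        fix H assume "finite H" "H \<subseteq> msets_on (mat_gens A)"
        then show "sum mat_weight H \<le> S"
          using mono by (intro finite_sum_le_has_sum[OF S]) (auto simp: msets_on_def)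
      qed (use A in auto)
      ultimately show "dist (?z A) S < e" using F(3) by (auto simp: dist_real_def)
    qed (use A0 in auto)
  qed
  then have "alpha1 = S"
    unfolding alpha1_def zeta_exps_def by (intro tendsto_Lim) auto
  then show ?thesis using S by simp
qed

lemma alpha1_ge_1: "alpha1 \<ge> 1"
proof -
  have "sum mat_weight {{#}} \<le> alpha1"
    by (rule finite_sum_le_has_sum[OF alpha1_has_sum]) (auto simp: msets_on_def)
  then show ?thesis by (simp add: mat_weight_def)
qed

definition smooth_mset :: "real \<Rightarrow> (nat \<times> nat) multiset \<Rightarrow> bool" where
  "smooth_mset y M \<longleftrightarrow> (\<forall>(q, n)\<in>#M. real (q ^ n\<^sup>2) \<le> y)"

definition nonprime_msets :: "real \<Rightarrow> real \<Rightarrow> (nat \<times> nat) multiset set" where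
  "nonprime_msets x y = {N \<in> msets_on (mat_gens zeta_exps). smooth_mset y N \<and> real (mat_norm N) \<le> x}"

text \<open>Each such multiset has weight at least 1 / x, and the weights of all multisets sum to
  \<open>alpha1\<close>, so there are at most \<open>alpha1\<close> x of them.\<close>

lemma finite_nonprime_msets: "finite (nonprime_msets x y)"
proof (rule ccontr)
  assume inf: "infinite (nonprime_msets x y)"
  have le: "mat_weight N \<ge> 1 / \<bar>x\<bar>" "x > 0" if "N \<in> nonprime_msets x y" for N
  proof -
    have N: "N \<in> msets_on (mat_gens zeta_exps)" "real (mat_norm N) \<le> x" using that by (auto simp: nonprime_msets_def)
    have "mat_norm N \<ge> 1" by (rule mat_norm_ge_1[OF N(1)])
    then have "real (mat_norm N) \<ge> 1" by simp
    then show "x > 0" using N(2) by linarith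
    show "mat_weight N \<ge> 1 / \<bar>x\<bar>" unfolding mat_weight_def
      using N(2) \<open>real (mat_norm N) \<ge> 1\<close> by (intro divide_left_mono) auto
  qed
  obtain k :: nat where k: "real k > alpha1 * \<bar>x\<bar>" using reals_Archimedean2 by blast
  obtain F where F: "F \<subseteq> nonprime_msets x y" "finite F" "card F = k"
    using infinite_arbitrarily_large[OF inf] by blast
  obtain N where "N \<in> nonprime_msets x y" using inf by (metis finite.emptyI ex_in_conv)
  then have x0: "x > 0" using le by blast
  have "real k * (1 / \<bar>x\<bar>) = (\<Sum>N\<in>F. 1 / \<bar>x\<bar>)" using F by simp
  also have "\<dots> \<le> sum mat_weight F" using F le by (intro sum_mono) auto
  also have "\<dots> \<le> alpha1"
    using F by (intro finite_sum_le_has_sum[OF alpha1_has_sum]) (auto simp: nonprime_msets_def)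
  finally show False using k x0 by (simp add: field_simps)
qed

section \<open>Counting the smooth rings\<close>

lemma smooth_types_eq:
  "smooth_types x y = {M \<in> msets_on (mat_gens (insert (1, 1) zeta_exps)). smooth_mset y M \<and> real (mat_norm M) \<le> x}"
proof -
  have gens: "(q, n) \<in> mat_gens (insert (1, 1) zeta_exps) \<longleftrightarrow> n \<ge> 1 \<and> (\<exists>p r. prime p \<and> r \<ge> 1 \<and> q = p ^ r)" for q n
  proof
    assume "(q, n) \<in> mat_gens (insert (1, 1) zeta_exps)"
    then obtain p r where "prime p" "q = p ^ r" "(r, n) \<in> insert (1, 1) zeta_exps" by (auto simp: mat_gens_def)
    moreover from this(3) have "r \<ge> 1" "n \<ge> 1" by (auto simp: zeta_exps_def)
    ultimately show "n \<ge> 1 \<and> (\<exists>p r. prime p \<and> r \<ge> 1 \<and> q = p ^ r)" by blast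
  next
    assume "n \<ge> 1 \<and> (\<exists>p r. prime p \<and> r \<ge> 1 \<and> q = p ^ r)"
    then obtain p r where pr: "n \<ge> 1" "prime p" "r \<ge> 1" "q = p ^ r" by blast
    have "(r, n) \<in> insert (1, 1) zeta_exps"
    proof (cases "r * n\<^sup>2 > 1")
      \<comment> \<open>With r, n \<ge> 1, the bound r n^2 \<le> 1 leaves only r = n = 1, the prime
        fields.\<close>
      case False
      moreover have "r * n\<^sup>2 \<ge> r * 1" "r * n\<^sup>2 \<ge> 1 * n\<^sup>2" using pr by (intro mult_le_mono; simp)+
      ultimately have "r = 1" "n\<^sup>2 \<le> 1" using pr by linarith+
      moreover from this(2) have "n = 1" using pr(1) power2_nat_le_imp_le[of n 1] by simp
      ultimately show ?thesis by simp
    qed (use pr in \<open>auto simp: zeta_exps_def\<close>)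
    then show "(q, n) \<in> mat_gens (insert (1, 1) zeta_exps)" using pr unfolding mat_gens_def by blast
  qed
  show ?thesis unfolding smooth_types_def msets_on_def smooth_mset_def mat_norm_def
    using gens by (auto simp: subset_iff)
qed

lemma card_smooth_types:
  "real (card (smooth_types x y)) = (\<Sum>N\<in>nonprime_msets x y. real (smooth_count (x / real (mat_norm N)) y))"
proof -
  let ?f = "\<lambda>(N, k). mset_of_nat 1 1 k + N"
  let ?S = "Sigma (nonprime_msets x y) (\<lambda>N. smooth_nums (x / real (mat_norm N)) y)"
  have disj: "mat_gens {(1, 1)} \<inter> mat_gens zeta_exps = {}"
    by (rule mat_gens_disjoint) (auto simp: zeta_exps_def)
  have ins: "insert (1, 1) zeta_exps = {(1, 1)} \<union> zeta_exps" by simp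
  have bij1: "bij_betw (\<lambda>(M, N). M + N) (msets_on (mat_gens {(1, 1)}) \<times> msets_on (mat_gens zeta_exps))
      (msets_on (mat_gens (insert (1, 1) zeta_exps)))"
    unfolding ins mat_gens_Un by (rule bij_betw_msets_on_Un[OF disj])
  have bij2: "bij_betw (mset_of_nat 1 1) {1..} (msets_on (mat_gens {(1, 1)}))" by (rule bij_betw_mset_of_nat) simp
  have bij: "bij_betw ?f (msets_on (mat_gens zeta_exps) \<times> {1..}) (msets_on (mat_gens (insert (1, 1) zeta_exps)))"
    unfolding bij_betw_def
  proof
    show "inj_on ?f (msets_on (mat_gens zeta_exps) \<times> {1..})"
    proof (rule inj_onI)
      fix z z' assume z: "z \<in> msets_on (mat_gens zeta_exps) \<times> {1..}" and z': "z' \<in> msets_on (mat_gens zeta_exps) \<times> {1..}"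
        and eq: "?f z = ?f z'"
      obtain N k N' k' where zz: "z = (N, k)" "z' = (N', k')" by (cases z; cases z')
      have N: "N \<in> msets_on (mat_gens zeta_exps)" "N' \<in> msets_on (mat_gens zeta_exps)"
        and k: "k \<in> {1..}" "k' \<in> {1..}" using z z' zz by blast+
      have "mset_of_nat 1 1 k \<in> msets_on (mat_gens {(1, 1)})" "mset_of_nat 1 1 k' \<in> msets_on (mat_gens {(1, 1)})"
        using bij_betwE[OF bij2] k by blast+
      then have "(mset_of_nat 1 1 k, N) = (mset_of_nat 1 1 k', N')"
        using eq N zz by (intro inj_onD[OF bij_betw_imp_inj_on[OF bij1]]) auto
      then show "z = z'" using inj_onD[OF bij_betw_imp_inj_on[OF bij2] _ k] zz by simp
    qed
    have "?f ` (msets_on (mat_gens zeta_exps) \<times> {1..})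
        = (\<lambda>(M, N). M + N) ` ((mset_of_nat 1 1 ` {1..}) \<times> msets_on (mat_gens zeta_exps))"
      by (force simp: image_iff)
    then show "?f ` (msets_on (mat_gens zeta_exps) \<times> {1..}) = msets_on (mat_gens (insert (1, 1) zeta_exps))"
      using bij_betw_imp_surj_on[OF bij1] bij_betw_imp_surj_on[OF bij2] by simp
  qed
  have mem: "?f (N, k) \<in> smooth_types x y \<longleftrightarrow> N \<in> nonprime_msets x y \<and> k \<in> smooth_nums (x / real (mat_norm N)) y"
    if N: "N \<in> msets_on (mat_gens zeta_exps)" and k: "k \<in> {1..}" for N k
  proof -
    have k1: "k \<ge> 1" using k by simp
    have N1: "real (mat_norm N) \<ge> 1" using mat_norm_ge_1[OF N] by simp
    have "?f (N, k) \<in> msets_on (mat_gens (insert (1, 1) zeta_exps))"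
      using bij_betwE[OF bij] N k by blast
    then have "?f (N, k) \<in> smooth_types x y \<longleftrightarrow>
        smooth_mset y (mset_of_nat 1 1 k + N) \<and> real (mat_norm (mset_of_nat 1 1 k + N)) \<le> x"
      by (simp add: smooth_types_eq)
    also have "smooth_mset y (mset_of_nat 1 1 k + N) \<longleftrightarrow> smooth_mset y (mset_of_nat 1 1 k) \<and> smooth_mset y N"
      by (auto simp: smooth_mset_def)
    also have "smooth_mset y (mset_of_nat 1 1 k) \<longleftrightarrow> (\<forall>p. prime p \<and> p dvd k \<longrightarrow> real p \<le> y)"
      using k1 by (auto simp: smooth_mset_def mset_of_nat_def prime_factors_dvd)
    also have "real (mat_norm (mset_of_nat 1 1 k + N)) \<le> x \<longleftrightarrow> real k \<le> x / real (mat_norm N)"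
      using k1 N1 by (simp add: mat_norm_mset_of_nat field_simps)
    finally have *: "?f (N, k) \<in> smooth_types x y \<longleftrightarrow>
        ((\<forall>p. prime p \<and> p dvd k \<longrightarrow> real p \<le> y) \<and> smooth_mset y N) \<and> real k \<le> x / real (mat_norm N)" .
    \<comment> \<open>As k \<ge> 1, the bound on k implies the bound on the norm of N demanded in
      \<open>nonprime_msets\<close>.\<close>
    have "real (mat_norm N) \<le> x" if "real k \<le> x / real (mat_norm N)"
    proof -
      have "1 \<le> x / real (mat_norm N)" using that k1 by linarith
      then show ?thesis using N1 by (simp add: field_simps)
    qed
    then show ?thesis unfolding * nonprime_msets_def smooth_nums_def using N k1 by blast
  qed
  have "bij_betw ?f ?S (smooth_types x y)"
    unfolding bij_betw_def
  proof
    have sub: "?S \<subseteq> msets_on (mat_gens zeta_exps) \<times> {1..}"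
      by (auto simp: nonprime_msets_def smooth_nums_def)
    then show "inj_on ?f ?S" using bij_betw_imp_inj_on[OF bij] inj_on_subset by blast
    show "?f ` ?S = smooth_types x y"
    proof (intro equalityI subsetI)
      fix M assume "M \<in> ?f ` ?S"
      then obtain N k where Nk: "(N, k) \<in> ?S" "M = ?f (N, k)" by (force simp: image_iff)
      then show "M \<in> smooth_types x y" using mem[of N k] sub by auto
    next
      fix M assume M: "M \<in> smooth_types x y"
      then have "M \<in> msets_on (mat_gens (insert (1, 1) zeta_exps))" by (simp add: smooth_types_eq)
      then have "M \<in> ?f ` (msets_on (mat_gens zeta_exps) \<times> {1..})" using bij_betw_imp_surj_on[OF bij] by simp
      then obtain N k where Nk: "N \<in> msets_on (mat_gens zeta_exps)" "k \<in> {1..}" "M = ?f (N, k)" by (force simp: image_iff)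
      then have "(N, k) \<in> ?S" using mem[of N k] M by simp
      then show "M \<in> ?f ` ?S" using Nk(3) by (rule rev_image_eqI)
    qed
  qed
  then have "card (smooth_types x y) = card ?S" using bij_betw_same_card by metis
  also have "\<dots> = (\<Sum>N\<in>nonprime_msets x y. smooth_count (x / real (mat_norm N)) y)"
    unfolding smooth_count_def by (rule card_SigmaI) (auto simp: finite_nonprime_msets)
  finally show ?thesis by simp
qed

lemma Psi_sar_eq_sum_smooth_count:
  "real (Psi_sar x y) = (\<Sum>N\<in>nonprime_msets x y. real (smooth_count (x / real (mat_norm N)) y))"
  by (simp only: Psi_sar_eq_card_smooth_types card_smooth_types)

text \<open>The coefficient 5 is made up of \<eta> for the multisets outside \<open>F\<close>,
  \<eta> for the part of \<open>alpha1\<close> not covered by the weights in \<open>F\<close>, and 3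
  \<eta> within \<open>F\<close>: 2 \<eta> from Dickman's theorem and the Lipschitz bound, and
  \<eta> from the errors 1.\<close>

lemma Psi_sar_asymptotic:
  assumes U: "U > 0" and \<eta>: "\<eta> > 0"
  shows "\<exists>X0. \<forall>x\<ge>X0. \<forall>y\<ge>2. 0 < ln x / ln y \<and> ln x / ln y \<le> U \<longrightarrow>
    \<bar>real (Psi_sar x y) - alpha1 * x * dickman_rho (ln x / ln y)\<bar> \<le> 5 * \<eta> * x"
proof -
  let ?D = "msets_on (mat_gens zeta_exps)"
  have a1: "alpha1 \<ge> 1" by (rule alpha1_ge_1)
  \<comment> \<open>Summation over \<open>F\<close> multiplies errors by a total weight of at most
    \<open>alpha1\<close>, hence the division.\<close>
  define \<eta>' where "\<eta>' = \<eta> / alpha1"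
  have \<eta>': "\<eta>' > 0" using \<eta> a1 by (simp add: \<eta>'_def)
  have "\<forall>\<^sub>F F in finite_subsets_at_top ?D. dist (sum mat_weight F) alpha1 < \<eta>"
    using alpha1_has_sum \<eta> by (simp add: has_sum_def tendstoD)
  then obtain F where F: "finite F" "F \<subseteq> ?D" "dist (sum mat_weight F) alpha1 < \<eta>"
    unfolding eventually_finite_subsets_at_top by blast
  have sumF: "sum mat_weight F \<le> alpha1" by (rule finite_sum_le_has_sum[OF alpha1_has_sum F(1,2)]) simp
  have sumF': "sum mat_weight F \<ge> alpha1 - \<eta>" using F(3) by (simp add: dist_real_def abs_less_iff)
  define D where "D = real (Max (insert 1 (mat_norm ` F)))"
  have D1: "D \<ge> 1" unfolding D_def using F(1) by (simp add: Max_ge_iff)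
  have DF: "real (mat_norm N) \<le> D" if "N \<in> F" for N unfolding D_def using that F(1) by (intro of_nat_mono Max_ge) auto
  obtain Y where Y: "Y \<ge> 2" "\<And>x y. Y \<le> y \<Longrightarrow> 1 \<le> x \<Longrightarrow> ln x / ln y \<le> U \<Longrightarrow>
      \<bar>real (smooth_count x y) - x * dickman_rho (ln x / ln y)\<bar> \<le> \<eta>' * x + 1"
    using dickman_smooth_count[OF \<eta>', of U] by metis
  \<comment> \<open>y \<ge> Y is required by Dickman's theorem, y \<ge> D makes every multiset in
    \<open>F\<close> y-smooth, and the exponential makes ln D / ln y at most \<eta>'.\<close>
  define Z where "Z = max Y (max D (exp (ln D / \<eta>')))"
  have Z: "Z \<ge> Y" "Z \<ge> D" "ln Z \<ge> ln D / \<eta>'" "Z \<ge> 2"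
  proof -
    show "Z \<ge> Y" "Z \<ge> D" "Z \<ge> 2" using Y(1) by (auto simp: Z_def)
    have "exp (ln D / \<eta>') \<le> Z" by (simp add: Z_def)
    then have "ln (exp (ln D / \<eta>')) \<le> ln Z" by (intro ln_mono) auto
    then show "ln Z \<ge> ln D / \<eta>'" by simp
  qed
  \<comment> \<open>x \<ge> exp (U ln Z) and u \<le> U force y \<ge> Z; x \<ge> D puts the norms
    from \<open>F\<close> below x; the last bound absorbs one error 1 for each element of
    \<open>F\<close> into \<eta> x.\<close>
  define X0 where "X0 = max (exp (U * ln Z)) (max D (real (card F) / \<eta>))"
  show ?thesis
  proof (intro exI[of _ X0] allI impI)
    fix x y :: real assume x: "x \<ge> X0" and y: "y \<ge> 2" and u: "0 < ln x / ln y \<and> ln x / ln y \<le> U"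
    define u where "u = ln x / ln y"
    have xD: "x \<ge> D" "x \<ge> 1" and xF: "real (card F) \<le> \<eta> * x" and xe: "x \<ge> exp (U * ln Z)"
      using x D1 \<eta> by (auto simp: X0_def field_simps)
    have ly: "ln y > 0" using y by simp
    have "ln x \<ge> U * ln Z" using xe xD by (simp add: ln_ge_iff)
    moreover have "ln x \<le> U * ln y" using u ly by (simp add: field_simps)
    ultimately have "U * ln Z \<le> U * ln y" by linarith
    then have lZy: "ln Z \<le> ln y" using U by simp
    then have Zy: "Z \<le> y" using Z y by simp
    have lD: "ln D / ln y \<le> \<eta>'"
    proof -
      have "ln D / \<eta>' \<le> ln y" using Z(3) lZy by linarith
      then show ?thesis using ly \<eta>' by (simp add: field_simps)
    qed
    have dy: "real (q ^ n\<^sup>2) \<le> y" if N: "N \<in> F" "(q, n) \<in># N" for N q n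
    proof -
      obtain N' where N': "N = add_mset (q, n) N'" using mset_add[OF N(2)] by metis
      have "N \<in> ?D" using F(2) N(1) by blast
      then have "N' \<in> ?D" by (simp add: N' msets_on_def)
      then have "mat_norm N' \<ge> 1" by (rule mat_norm_ge_1)
      then have "q ^ n\<^sup>2 \<le> mat_norm N" unfolding N' mat_norm_simps by simp
      then show ?thesis using DF[OF N(1)] Z(2) Zy by linarith
    qed
    have FN: "F \<subseteq> nonprime_msets x y"
    proof
      fix N assume "N \<in> F"
      then show "N \<in> nonprime_msets x y"
        using F(2) dy DF[of N] xD by (auto simp: nonprime_msets_def smooth_mset_def)
    qed
    let ?R = "nonprime_msets x y - F"
    have ND: "nonprime_msets x y \<subseteq> ?D" by (auto simp: nonprime_msets_def)
    have cl: "0 \<le> real (smooth_count (x / real (mat_norm N)) y)"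
        "real (smooth_count (x / real (mat_norm N)) y) \<le> x * mat_weight N" for N
      using smooth_count_le[of "x / real (mat_norm N)" y] xD by (auto simp: mat_weight_def)
    have "sum mat_weight F + sum mat_weight ?R \<le> alpha1"
    proof -
      have "sum mat_weight F + sum mat_weight ?R = sum mat_weight (nonprime_msets x y)"
        using sum.subset_diff[OF FN finite_nonprime_msets, of mat_weight] by simp
      also have "\<dots> \<le> alpha1" by (rule finite_sum_le_has_sum[OF alpha1_has_sum finite_nonprime_msets ND]) simp
      finally show ?thesis .
    qed
    then have wR: "sum mat_weight ?R \<le> \<eta>" using sumF' by linarith
    have "(\<Sum>N\<in>?R. real (smooth_count (x / real (mat_norm N)) y)) \<le> (\<Sum>N\<in>?R. x * mat_weight N)"
      by (rule sum_mono) (rule cl)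
    also have "\<dots> = x * sum mat_weight ?R" by (simp only: sum_distrib_left)
    also have "\<dots> \<le> x * \<eta>" using wR xD by (intro mult_left_mono) auto
    finally have R: "(\<Sum>N\<in>?R. real (smooth_count (x / real (mat_norm N)) y)) \<le> \<eta> * x" by (simp add: mult.commute)
    have R0: "0 \<le> (\<Sum>N\<in>?R. real (smooth_count (x / real (mat_norm N)) y))" by (intro sum_nonneg cl)
    \<comment> \<open>Passing from x to x / |N| lowers u by ln |N| / ln y \<le> \<eta>'. One \<eta>'
      is Dickman's error at x / |N|, the other the Lipschitz bound for this shift.\<close>
    have each: "\<bar>real (smooth_count (x / real (mat_norm N)) y) - mat_weight N * (x * dickman_rho u)\<bar>
        \<le> 2 * \<eta>' * x * mat_weight N + 1" if N: "N \<in> F" for N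
    proof -
      define d where "d = real (mat_norm N)"
      have "mat_norm N \<ge> 1" using F(2) N by (intro mat_norm_ge_1) auto
      then have d: "d \<ge> 1" "d \<le> D" using DF[OF N] by (auto simp: d_def)
      have xd: "x / d \<ge> 1" using d xD by simp
      have ld: "ln (x / d) = ln x - ln d" using d xD by (simp add: ln_div)
      define v where "v = ln (x / d) / ln y"
      have vu: "v \<le> u" "0 \<le> v" "u - v \<le> \<eta>'"
      proof -
        show "v \<le> u" unfolding v_def u_def using ld d ly by (intro divide_right_mono) auto
        show "0 \<le> v" unfolding v_def using xd ly by (intro divide_nonneg_pos) auto
        have "u - v = ln d / ln y" unfolding u_def v_def ld by (simp add: diff_divide_distrib)
        also have "\<dots> \<le> ln D / ln y" using d ly by (intro divide_right_mono) auto
        finally show "u - v \<le> \<eta>'" using lD by linarith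
      qed
      have A: "\<bar>real (smooth_count (x / d) y) - x / d * dickman_rho v\<bar> \<le> \<eta>' * (x / d) + 1"
        unfolding v_def using Y(2)[of y "x / d"] Z Zy xd vu u unfolding v_def u_def by linarith
      have "0 \<le> dickman_rho v - dickman_rho u" "dickman_rho v - dickman_rho u \<le> \<eta>'"
        using dickman_rho_antimono[OF vu(2,1)] dickman_rho_lipschitz[OF vu(2,1)] vu(3) by linarith+
      then have "0 \<le> x / d * (dickman_rho v - dickman_rho u)" "x / d * (dickman_rho v - dickman_rho u) \<le> x / d * \<eta>'"
        using mult_nonneg_nonneg[of "x / d"] mult_left_mono[of _ _ "x / d"] xd by (simp_all only: order_trans[OF zero_le_one])
      then have "\<bar>real (smooth_count (x / d) y) - x / d * dickman_rho u\<bar> \<le> 2 * \<eta>' * (x / d) + 1"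
        using A unfolding right_diff_distrib mult.commute[of "x / d" \<eta>'] mult.assoc[of 2]
        by (smt (verit))
      then show ?thesis by (simp add: mat_weight_def d_def)
    qed
    have "\<bar>(\<Sum>N\<in>F. real (smooth_count (x / real (mat_norm N)) y)) - sum mat_weight F * (x * dickman_rho u)\<bar>
        = \<bar>\<Sum>N\<in>F. real (smooth_count (x / real (mat_norm N)) y) - mat_weight N * (x * dickman_rho u)\<bar>"
      by (simp only: sum_subtractf sum_distrib_right)
    also have "\<dots> \<le> (\<Sum>N\<in>F. 2 * \<eta>' * x * mat_weight N + 1)"
      by (rule order_trans[OF sum_abs sum_mono]) (rule each)
    also have "\<dots> = 2 * \<eta>' * x * sum mat_weight F + real (card F)"
      by (simp add: sum.distrib sum_distrib_left)
    also have "\<dots> \<le> 2 * \<eta>' * x * alpha1 + \<eta> * x"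
      using sumF xF \<eta>' xD by (intro add_mono mult_left_mono) auto
    also have "\<dots> = 3 * \<eta> * x" using a1 by (simp add: \<eta>'_def)
    finally have main: "\<bar>(\<Sum>N\<in>F. real (smooth_count (x / real (mat_norm N)) y)) - sum mat_weight F * (x * dickman_rho u)\<bar> \<le> 3 * \<eta> * x" .
    have u0: "u \<ge> 0" using u by (simp add: u_def)
    have r: "0 \<le> x * dickman_rho u" "x * dickman_rho u \<le> x"
      using dickman_rho_pos[OF u0] dickman_rho_le_1[of u] u0 xD by (auto simp: mult_le_cancel_left1)
    have "0 \<le> (alpha1 - sum mat_weight F) * (x * dickman_rho u)" using sumF r by simp
    moreover have "(alpha1 - sum mat_weight F) * (x * dickman_rho u) \<le> \<eta> * x"
      using sumF sumF' r \<eta> by (intro mult_mono) auto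
    moreover have "real (Psi_sar x y) = (\<Sum>N\<in>?R. real (smooth_count (x / real (mat_norm N)) y))
        + (\<Sum>N\<in>F. real (smooth_count (x / real (mat_norm N)) y))"
      unfolding Psi_sar_eq_sum_smooth_count by (rule sum.subset_diff[OF FN finite_nonprime_msets])
    ultimately have "\<bar>real (Psi_sar x y) - alpha1 * (x * dickman_rho u)\<bar> \<le> 5 * \<eta> * x"
      using main R R0 unfolding left_diff_distrib by linarith
    then show "\<bar>real (Psi_sar x y) - alpha1 * x * dickman_rho (ln x / ln y)\<bar> \<le> 5 * \<eta> * x"
      by (simp add: u_def mult.assoc)
  qed
qed

theorem mainTheorem3:
  fixes U :: real
  assumes "U > 0"
  shows "\<exists>E :: real \<Rightarrow> real \<Rightarrow> real.
     (\<forall>\<epsilon>>0. \<forall>\<^sub>F x in at_top. \<forall>y\<ge>2. 0 < ln x / ln y \<and> ln x / ln y \<le> U \<longrightarrow>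
        \<bar>E x y\<bar> < \<epsilon>) \<and>
     (\<forall>\<^sub>F x in at_top. \<forall>y\<ge>2. 0 < ln x / ln y \<and> ln x / ln y \<le> U \<longrightarrow>
        real (Psi_sar x y) = (1 + E x y) * alpha1 * x * dickman_rho (ln x / ln y))"
proof (intro exI conjI allI impI)
  have a1: "alpha1 \<ge> 1" by (rule alpha1_ge_1)
  have \<rho>U: "dickman_rho U > 0" using dickman_rho_pos[of U] assms by simp
  fix \<epsilon> :: real assume \<epsilon>: "\<epsilon> > 0"
  \<comment> \<open>Since \<open>alpha1\<close> \<ge> 1 and \<rho>(u) \<ge> \<rho>(U) > 0 for u
    \<le> U, the relative error is at most 5 \<eta> / \<rho>(U) = \<epsilon> / 2; here U has to be
    fixed.\<close>
  define \<eta> where "\<eta> = \<epsilon> * dickman_rho U / 10"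
  have \<eta>: "\<eta> > 0" using \<epsilon> \<rho>U by (simp add: \<eta>_def)
  obtain X0 where X0: "\<And>x y. x \<ge> X0 \<Longrightarrow> y \<ge> 2 \<Longrightarrow> 0 < ln x / ln y \<and> ln x / ln y \<le> U \<Longrightarrow>
      \<bar>real (Psi_sar x y) - alpha1 * x * dickman_rho (ln x / ln y)\<bar> \<le> 5 * \<eta> * x"
    using Psi_sar_asymptotic[OF assms \<eta>] by blast
  \<comment> \<open>This goal fixes the witness for E as the relative error, the quotient minus
    1.\<close>
  show "\<forall>\<^sub>F x in at_top. \<forall>y\<ge>2. 0 < ln x / ln y \<and> ln x / ln y \<le> U \<longrightarrow>
        \<bar>real (Psi_sar x y) / (alpha1 * x * dickman_rho (ln x / ln y)) - 1\<bar> < \<epsilon>"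
    using eventually_ge_at_top[of X0] eventually_gt_at_top[of 0]
  proof eventually_elim
    case (elim x)
    show ?case
    proof (intro allI impI)
      fix y :: real assume y: "y \<ge> 2" and u: "0 < ln x / ln y \<and> ln x / ln y \<le> U"
      define \<rho> where "\<rho> = dickman_rho (ln x / ln y)"
      have \<rho>: "dickman_rho U \<le> \<rho>" unfolding \<rho>_def using u by (intro dickman_rho_antimono) auto
      have pos: "alpha1 * x * \<rho> > 0" using a1 elim(2) \<rho> \<rho>U by simp
      have "real (Psi_sar x y) / (alpha1 * x * \<rho>) - 1 = (real (Psi_sar x y) - alpha1 * x * \<rho>) / (alpha1 * x * \<rho>)"
        by (simp only: diff_divide_distrib divide_self[OF less_imp_neq[OF pos, symmetric]])
      then have "\<bar>real (Psi_sar x y) / (alpha1 * x * \<rho>) - 1\<bar> = \<bar>real (Psi_sar x y) - alpha1 * x * \<rho>\<bar> / (alpha1 * x * \<rho>)"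
        using pos by (simp only: abs_divide abs_of_pos)
      also have "\<dots> \<le> 5 * \<eta> * x / (alpha1 * x * \<rho>)"
        using X0[OF elim(1) y u] pos unfolding \<rho>_def by (intro divide_right_mono) auto
      also have "\<dots> \<le> 5 * \<eta> * x / (1 * x * dickman_rho U)"
        using a1 \<rho> \<rho>U elim(2) \<eta> pos by (intro divide_left_mono mult_mono) auto
      also have "\<dots> < \<epsilon>" using \<rho>U elim(2) \<epsilon> by (simp add: \<eta>_def)
      finally show "\<bar>real (Psi_sar x y) / (alpha1 * x * dickman_rho (ln x / ln y)) - 1\<bar> < \<epsilon>"
        unfolding \<rho>_def .
    qed
  qed
next
  show "\<forall>\<^sub>F x in at_top. \<forall>y\<ge>2. 0 < ln x / ln y \<and> ln x / ln y \<le> U \<longrightarrow>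
        real (Psi_sar x y) = (1 + (real (Psi_sar x y) / (alpha1 * x * dickman_rho (ln x / ln y)) - 1)) * alpha1 * x * dickman_rho (ln x / ln y)"
    using eventually_gt_at_top[of 0]
  proof eventually_elim
    case (elim x)
    show ?case
    proof (intro allI impI)
      fix y :: real assume "y \<ge> 2" and u: "0 < ln x / ln y \<and> ln x / ln y \<le> U"
      have "dickman_rho (ln x / ln y) > 0" using dickman_rho_pos[of "ln x / ln y"] u by simp
      then show "real (Psi_sar x y) = (1 + (real (Psi_sar x y) / (alpha1 * x * dickman_rho (ln x / ln y)) - 1)) * alpha1 * x * dickman_rho (ln x / ln y)"
        using alpha1_ge_1 elim by simp
    qed
  qed
qed

end
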